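(* Let $1\leq p\leq\infty$, $\alpha>-1$, and let $\varphi$ be a measurable function on $(0,\infty)$ such that $\int_0^\infty t^{\frac{1+\alpha}{p}-1}|\varphi(t)|\,dt<\infty$. Then, for every $f\in\mathcal H^p_{|\cdot|^\alpha}(\mathbb C_+)$, $$(\mathscr H_\varphi f)^*=\mathcal H_\varphi(f^* )$$ (almost everywhere on $\mathbb R$).
   Context: $\mathbb C_+=\{x+iy\in\mathbb C: y>0\}$ is the upper half-plane. Functions on $(0,\infty)$ are complex-valued. When $p=\infty$, $\frac{1+\alpha}{p}$ is read as $0$. For a measurable function $\varphi$ on $(0,\infty)$, the Hausdorff operator is defined for suitable holomorphic functions $f$ on $\mathbb C_+$ by $\mathscr H_\varphi f(z)=\int_0^\infty f\left(\frac zt\right)\frac{\varphi(t)}{t}\,dt$, $z\in\mathbb C_+$; its real version is defined for suitable measurable functions $g$ on $\mathbb R$ by $\mathcal H_\varphi(g)(x)=\int_0^\infty g\left(\frac xt\right)\frac{\varphi(t)}{t}\,dt$, $x\in\mathbb R$. For $0<p\leq\infty$ and $\alpha>-1$, the power weighted Hardy space $\mathcal H^p_{|\cdot|^\alpha}(\mathbb C_+)$ is the set of all holomorphic functions $f$ on $\mathbb C_+$ with $\|f\|_{\mathcal H^p_{|\cdot|^\alpha}(\mathbb C_+)}<\infty$, where $\|f\|_{\mathcal H^p_{|\cdot|^\alpha}(\mathbb C_+)}:=\sup_{y>0}\left(\int_{-\infty}^\infty|f(x+iy)|^p|x|^\alpha\,dx\right)^{1/p}$ if $0<p<\infty$, and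 $\|f\|_{\mathcal H^\infty_{|\cdot|^\alpha}(\mathbb C_+)}:=\sup_{z\in\mathbb C_+}|f(z)|$. $L^p_{|\cdot|^\alpha}(\mathbb R)$ is the $L^p$ space on $\mathbb R$ with respect to the measure $|x|^\alpha dx$ (for $p=\infty$, $L^\infty(\mathbb R)$). It is well known that every $f\in\mathcal H^p_{|\cdot|^\alpha}(\mathbb C_+)$ has a boundary value function $f^*\in L^p_{|\cdot|^\alpha}(\mathbb R)$ given by $f^*(x)=\lim_{y\to0^+}f(x+iy)$ for a.e. $x\in\mathbb R$. *)

theory Defs
  imports "HOL-Analysis.Analysis"
begin

definition upper_half_plane :: "complex set" where
  "upper_half_plane = {z. Im z > 0}"

definition ennreal_powr :: "ennreal \<Rightarrow> real \<Rightarrow> ennreal" where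
  "ennreal_powr a r = (if a = \<infinity> then \<infinity> else ennreal (enn2real a powr r))"
  (* only used with r > 0 *)

definition hardy_norm :: "ennreal \<Rightarrow> real \<Rightarrow> (complex \<Rightarrow> complex) \<Rightarrow> ennreal" where
  "hardy_norm p \<alpha> f =
     (if p = \<infinity> then (SUP z\<in>upper_half_plane. ennreal (norm (f z)))
      else (SUP y\<in>{0<..}. ennreal_powr
             (\<integral>\<^sup>+x. ennreal (norm (f (Complex x y)) powr enn2real p * \<bar>x\<bar> powr \<alpha>) \<partial>lebesgue)
             (1 / enn2real p)))"

definition hardy_space :: "ennreal \<Rightarrow> real \<Rightarrow> (complex \<Rightarrow> complex) set" where
  "hardy_space p \<alpha> = {f. f holomorphic_on upper_half_plane \<and> hardy_norm p \<alpha> f < \<infinity>}"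

definition has_boundary_value :: "(complex \<Rightarrow> complex) \<Rightarrow> real \<Rightarrow> bool" where
  "has_boundary_value f x \<longleftrightarrow> (\<exists>l. ((\<lambda>y. f (Complex x y)) \<longlongrightarrow> l) (at_right 0))"

(* an unspecified constant at points where the limit does not exist *)
definition boundary_value :: "(complex \<Rightarrow> complex) \<Rightarrow> real \<Rightarrow> complex" where
  "boundary_value f x = Lim (at_right 0) (\<lambda>y. f (Complex x y))"

(* The Bochner integrals below are 0 when they do not converge absolutely; the two
   predicates express that the operator is genuinely defined at the given point. *)

definition hausdorff_defined_at :: "(real \<Rightarrow> complex) \<Rightarrow> (complex \<Rightarrow> complex) \<Rightarrow> complex \<Rightarrow> bool" where
  "hausdorff_defined_at \<phi> f z \<longleftrightarrow>
     set_integrable lebesgue {0<..} (\<lambda>t. f (z / of_real t) * (\<phi> t / of_real t))"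

definition hausdorff :: "(real \<Rightarrow> complex) \<Rightarrow> (complex \<Rightarrow> complex) \<Rightarrow> complex \<Rightarrow> complex" where
  "hausdorff \<phi> f z = (LINT t:{0<..}|lebesgue. f (z / of_real t) * (\<phi> t / of_real t))"

definition real_hausdorff_defined_at :: "(real \<Rightarrow> complex) \<Rightarrow> (real \<Rightarrow> complex) \<Rightarrow> real \<Rightarrow> bool" where
  "real_hausdorff_defined_at \<phi> g x \<longleftrightarrow>
     set_integrable lebesgue {0<..} (\<lambda>t. g (x / t) * (\<phi> t / of_real t))"

definition real_hausdorff :: "(real \<Rightarrow> complex) \<Rightarrow> (real \<Rightarrow> complex) \<Rightarrow> real \<Rightarrow> complex" where
  "real_hausdorff \<phi> g x = (LINT t:{0<..}|lebesgue. g (x / t) * (\<phi> t / of_real t))"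

definition weight_exponent :: "ennreal \<Rightarrow> real \<Rightarrow> real" where
  "weight_exponent p \<alpha> = (if p = \<infinity> then 0 else (1 + \<alpha>) / enn2real p)"

end

theory Submission
  imports Defs "HOL-Complex_Analysis.Complex_Analysis"
begin

text \<open>
  Write \<open>w = (1 + \<alpha>) / p\<close>.  Dilating by \<open>t\<close> multiplies the Hardy norm by \<open>t powr w\<close>, and on compact
  sets away from the imaginary axis the weight is harmless, so a function \<open>f\<close> of the weighted space
  satisfies unweighted local \<open>L\<^sup>1\<close> bounds, uniform in the height, for all its dilates with constant
  \<open>K t powr w\<close>.  Everything is reduced to such bounds.

  The main point is a local maximal estimate: the \<open>L\<^sup>1\<close> norm over \<open>[3, 5]\<close> of
  \<open>x \<mapsto> sup \<bar>f (x + i y)\<bar>\<close>, \<open>0 < y < 1\<close>, is bounded by a multiple of \<open>K\<close>.  On a rectangle the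
  maximum principle gives \<open>\<bar>h\<bar> \<le> exp (P u)\<close> with \<open>h w = f w (w - 2) (w - 6)\<close> (suitably normalised),
  \<open>P\<close> the Poisson integral and \<open>u\<close> the positive part of \<open>ln \<bar>h\<bar>\<close> on the bottom side; by Jensen's
  inequality \<open>exp (P u) \<le> (P (exp (u / 2)))\<^sup>2\<close>, and \<open>exp (u / 2)\<close> is square integrable, so the
  Hardy--Littlewood theorem in \<open>L\<^sup>2\<close> applies.

  Given this estimate, a primitive of \<open>f\<close> extends to an absolutely continuous function on the boundary,
  and \<open>f\<close> has a vertical limit wherever that function is differentiable.  By Tonelli's theorem the
  maximal function also supplies, for almost every \<open>x\<close>, an integrable majorant of
  \<open>t \<mapsto> f ((x + i y) / t) \<phi> t / t\<close> uniformly in small \<open>y\<close>, and dominated convergence concludes.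
\<close>

section \<open>The Hardy--Littlewood maximal function\<close>

text \<open>The obstacle is \<open>p = 1\<close> together with an unrestricted weight exponent. For
  large \<alpha> a function of the space can be so singular at 0 that it is not the Poisson integral
  of its boundary values, so no representation on the whole line is available. All estimates
  therefore live on windows away from 0 (data on [1, 8], maximum principle over [2, 6], conclusions
  on [3, 5]), and dilations and a reflection carry the result to the rest of the line. For
  \<open>p = 1\<close> the maximal operator has only a weak type bound, which yields no integrable
  majorant. The square root of the modulus is square integrable, where a strong bound holds, and it
  may replace the modulus because the logarithm of the modulus of a holomorphic function is
  subharmonic; hence the exponent \<open>u / 2\<close>. The same bound excludes a singular part of
  the boundary measure: increments of the primitive are dominated by integrals of one integrable
  function.\<close>

definition maximal_fn :: "(real \<Rightarrow> ennreal) \<Rightarrow> real \<Rightarrow> ennreal" where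
  "maximal_fn v x = (SUP r\<in>{r\<in>\<rat>. 0 < r}. (\<integral>\<^sup>+s\<in>{x-r..x+r}. v s \<partial>lborel) / ennreal (2 * r))"

lemma borel_measurable_window_integral:
  assumes [measurable]: "v \<in> borel_measurable borel"
  shows "(\<lambda>x::real. \<integral>\<^sup>+s\<in>{x-r..x+r}. v s \<partial>lborel) \<in> borel_measurable borel"
proof -
  have "(\<lambda>x::real. \<integral>\<^sup>+s. v s * (if x - r \<le> s \<and> s \<le> x + r then 1 else 0) \<partial>lborel) \<in> borel_measurable lborel"
    by measurable
  also have "(\<lambda>x::real. \<integral>\<^sup>+s. v s * (if x - r \<le> s \<and> s \<le> x + r then 1 else 0) \<partial>lborel)
     = (\<lambda>x::real. \<integral>\<^sup>+s\<in>{x-r..x+r}. v s \<partial>lborel)"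
    by (intro ext nn_integral_cong) (auto simp: indicator_def)
  finally show ?thesis by simp
qed

text \<open>Restricting the radii to rationals makes the supremum countable. The price is paid
  later: Poisson integrals are compared with the maximal function only at rational heights.\<close>

lemma borel_measurable_maximal_fn [measurable]:
  assumes "v \<in> borel_measurable borel"
  shows "maximal_fn v \<in> borel_measurable borel"
proof -
  have "countable {r\<in>\<rat>. (0::real) < r}"
    using countable_rat by (rule countable_subset[rotated]) auto
  then have "(\<lambda>x. SUP r\<in>{r\<in>\<rat>. 0 < r}. (\<integral>\<^sup>+s\<in>{x-r..x+r}. v s \<partial>lborel) / ennreal (2 * r)) \<in> borel_measurable borel"
    by (intro borel_measurable_SUP borel_measurable_divide_ennreal borel_measurable_window_integral[OF assms]) auto
  then show ?thesis by (simp add: maximal_fn_def[abs_def])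
qed

lemma window_integral_le_maximal_fn:
  assumes "r \<in> \<rat>" "0 < r"
  shows "(\<integral>\<^sup>+s\<in>{x-r..x+r}. v s \<partial>lborel) \<le> ennreal (2 * r) * maximal_fn v x"
proof -
  let ?I = "\<integral>\<^sup>+s\<in>{x-r..x+r}. v s \<partial>lborel"
  have "?I / ennreal (2 * r) \<le> maximal_fn v x"
    unfolding maximal_fn_def using assms by (intro SUP_upper) auto
  then have "?I / ennreal (2 * r) * ennreal (2*r) \<le> maximal_fn v x * ennreal (2 * r)"
    by (rule mult_right_mono) auto
  also have "?I / ennreal (2 * r) * ennreal (2*r) = ?I"
    using assms by (simp add: ennreal_divide_times mult_divide_eq_ennreal)
  finally show ?thesis by (simp add: mult.commute)
qed

text \<open>This is the truncation step of the strong bound: the bounded part of a function adds at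
  most its bound to every average.\<close>

lemma maximal_fn_add_le:
  assumes [measurable]: "u \<in> borel_measurable borel"
    and "\<And>s. v s \<le> ennreal c + u s" "0 \<le> c"
  shows "maximal_fn v x \<le> ennreal c + maximal_fn u x"
  unfolding maximal_fn_def[of v]
proof (rule SUP_least)
  fix r :: real assume r: "r \<in> {r\<in>\<rat>. 0 < r}"
  have "(\<integral>\<^sup>+s\<in>{x-r..x+r}. v s \<partial>lborel) \<le> (\<integral>\<^sup>+s. ennreal c * indicator {x-r..x+r} s + u s * indicator {x-r..x+r} s \<partial>lborel)"
    using assms by (intro nn_integral_mono) (auto simp: indicator_def)
  also have "\<dots> = ennreal c * ennreal (2*r) + (\<integral>\<^sup>+s\<in>{x-r..x+r}. u s \<partial>lborel)"
    using r by (subst nn_integral_add) (auto simp: nn_integral_cmult_indicator)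
  also have "\<dots> \<le> ennreal c * ennreal (2*r) + ennreal (2*r) * maximal_fn u x"
    using r by (intro add_left_mono window_integral_le_maximal_fn) auto
  also have "\<dots> = (ennreal c + maximal_fn u x) * ennreal (2*r)"
    by (simp add: algebra_simps)
  finally have "(\<integral>\<^sup>+s\<in>{x-r..x+r}. v s \<partial>lborel) / ennreal (2*r) \<le> (ennreal c + maximal_fn u x) * ennreal (2*r) / ennreal (2*r)"
    by (rule divide_right_mono_ennreal)
  also have "\<dots> = ennreal c + maximal_fn u x"
    using r by (simp add: mult_divide_eq_ennreal)
  finally show "(\<integral>\<^sup>+s\<in>{x-r..x+r}. v s \<partial>lborel) / ennreal (2*r) \<le> ennreal c + maximal_fn u x" .
qed

text \<open>Vitali covering argument. A ball with average at least \<open>l\<close> has radius at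
  most \<open>I / (2 * l)\<close>, the uniform bound needed to select disjoint balls whose fivefold
  enlargements cover. Disjointness lets the masses on the selected balls add up to at most the
  total; the 5 is the enlargement factor.\<close>

lemma maximal_fn_weak_type:
  fixes l :: real
  assumes v[measurable]: "v \<in> borel_measurable borel" and fin: "(\<integral>\<^sup>+s. v s \<partial>lborel) < \<infinity>" and l: "0 < l"
  shows "ennreal l * emeasure lborel {x. ennreal l < maximal_fn v x} \<le> 5 * (\<integral>\<^sup>+s. v s \<partial>lborel)"
proof -
  let ?V = "\<integral>\<^sup>+s. v s \<partial>lborel"
  let ?W = "\<lambda>A. \<integral>\<^sup>+s\<in>A. v s \<partial>lborel"
  let ?E = "{x. ennreal l < maximal_fn v x}"
  define I where "I = enn2real ?V"
  have I: "ennreal I = ?V"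
    using fin unfolding I_def by (simp add: less_top)
  define K where "K = {(x, r). r > 0 \<and> ennreal (l * (2 * r)) \<le> ?W (cball x r)}"
  have rB: "0 < snd i \<and> snd i \<le> I / (2 * l)" if "i \<in> K" for i
  proof -
    obtain x r where i: "i = (x, r)" by force
    have "ennreal (l * (2 * r)) \<le> ?W (cball x r)"
      using that by (auto simp: K_def i)
    also have "\<dots> \<le> ennreal I"
      unfolding I by (intro nn_integral_mono) (auto simp: indicator_def)
    finally have "l * (2 * r) \<le> I"
      by (rule ennreal_le_iff[THEN iffD1, rotated]) (simp add: I_def)
    then show ?thesis using that l by (auto simp: K_def i field_simps)
  qed
  have "?E \<subseteq> (\<Union>i\<in>K. cball (fst i) (snd i))"
  proof
    fix x assume "x \<in> ?E"
    then obtain r where r: "r \<in> \<rat>" "0 < r" "ennreal l < ?W {x-r..x+r} / ennreal (2 * r)"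
      by (auto simp: maximal_fn_def less_SUP_iff)
    have "ennreal l * ennreal (2*r) \<le> ?W {x-r..x+r} / ennreal (2 * r) * ennreal (2*r)"
      using r by (intro mult_right_mono) auto
    also have "\<dots> = ?W {x-r..x+r}"
      using r by (simp add: ennreal_divide_times mult_divide_eq_ennreal)
    finally have "(x, r) \<in> K"
      using r l by (simp add: K_def cball_eq_atLeastAtMost ennreal_mult)
    then show "x \<in> (\<Union>i\<in>K. cball (fst i) (snd i))"
      using r by (intro UN_I[of "(x,r)"]) auto
  qed
  then obtain C where C: "countable C" "C \<subseteq> K"
     "pairwise (\<lambda>i j. disjnt (cball (fst i) (snd i)) (cball (fst j) (snd j))) C"
     "?E \<subseteq> (\<Union>i\<in>C. cball (fst i) (5 * snd i))"
    by (rule Vitali_covering_lemma_cballs[where r = snd and B = "I / (2 * l)"]) (use rB in auto)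
  define J where "J = to_nat_on C ` C"
  define g where "g = from_nat_into C"
  have g: "g n \<in> C" "to_nat_on C (g n) = n" if "n \<in> J" for n
    using that C(1) by (auto simp: J_def g_def)
  have gJ: "\<exists>n\<in>J. g n = i" if "i \<in> C" for i
    using that C(1) by (auto simp: J_def g_def)
  define X where "X n = (if n \<in> J then cball (fst (g n)) (5 * snd (g n)) else {})" for n
  define Y where "Y n = (if n \<in> J then cball (fst (g n)) (snd (g n)) else {})" for n
  have disj: "disjoint_family Y"
    unfolding disjoint_family_on_def
  proof (intro ballI impI)
    fix m n :: nat assume "m \<noteq> n"
    show "Y m \<inter> Y n = {}"
    proof (cases "m \<in> J \<and> n \<in> J")
      case True
      then have "g m \<noteq> g n" using g(2) \<open>m \<noteq> n\<close> by metis
      then show ?thesis using C(3) True g(1) by (auto simp: Y_def pairwise_def disjnt_def)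
    qed (auto simp: Y_def)
  qed
  have Ysets: "Y n \<in> sets lborel" for n
    by (simp add: Y_def)
  have le: "ennreal l * emeasure lborel (X n) \<le> 5 * ?W (Y n)" for n
  proof (cases "n \<in> J")
    case True
    obtain x r where gn: "g n = (x, r)" by force
    have "(x, r) \<in> K" using g(1)[OF True] C(2) gn by auto
    then have r: "r > 0" "ennreal (l * (2 * r)) \<le> ?W (cball x r)"
      by (auto simp: K_def)
    have "ennreal l * emeasure lborel (X n) = ennreal (5 * (l * (2 * r)))"
      using True r l by (simp add: X_def gn cball_eq_atLeastAtMost ennreal_mult[symmetric])
    also have "\<dots> = 5 * ennreal (l * (2 * r))"
      using r l by (subst ennreal_mult) auto
    also have "\<dots> \<le> 5 * ?W (Y n)"
      using True r by (intro mult_left_mono) (auto simp: Y_def gn)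
    finally show ?thesis .
  qed (auto simp: X_def)
  have "?E \<subseteq> (\<Union>n. X n)"
  proof
    fix x assume "x \<in> ?E"
    then obtain i where "i \<in> C" "x \<in> cball (fst i) (5 * snd i)" using C(4) by auto
    moreover obtain n where "n \<in> J" "g n = i" using gJ \<open>i \<in> C\<close> by blast
    ultimately show "x \<in> (\<Union>n. X n)" by (auto simp: X_def intro!: exI[of _ n])
  qed
  then have "emeasure lborel ?E \<le> emeasure lborel (\<Union>n. X n)"
    by (rule emeasure_mono) (auto simp: X_def)
  also have "\<dots> \<le> (\<Sum>n. emeasure lborel (X n))"
    by (rule emeasure_subadditive_countably) (auto simp: X_def)
  finally have "ennreal l * emeasure lborel ?E
      \<le> ennreal l * (\<Sum>n. emeasure lborel (X n))"
    by (rule mult_left_mono) simp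
  also have "\<dots> = (\<Sum>n. ennreal l * emeasure lborel (X n))"
    by simp
  also have "\<dots> \<le> (\<Sum>n. 5 * ?W (Y n))"
    by (intro suminf_le le) auto
  also have "\<dots> = 5 * (\<Sum>n. \<integral>\<^sup>+s\<in>Y n. v s \<partial>lborel)"
    by simp
  also have "(\<Sum>n. \<integral>\<^sup>+s\<in>Y n. v s \<partial>lborel) = (\<integral>\<^sup>+s\<in>(\<Union>n. Y n). v s \<partial>lborel)"
    by (rule nn_integral_disjoint_family[of v lborel Y, symmetric]) (use v disj Ysets in simp_all)
  also have "\<dots> \<le> ?V"
    by (intro nn_integral_mono) (auto simp: indicator_def)
  finally show ?thesis by (simp add: mult_left_mono)
qed

text \<open>The square is the integral of \<open>2 * l\<close> over the levels \<open>l\<close>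
  below \<open>a\<close>. The bound is proved for finite \<open>b\<close> below \<open>a\<close>
  first, because a maximal function may take the value \<open>\<infinity>\<close>.\<close>

lemma ennreal_square_le_layer_cake:
  "a\<^sup>2 \<le> (\<integral>\<^sup>+l\<in>{0<..}. ennreal (2 * l) * (if ennreal l < a then 1 else 0) \<partial>lborel)"
proof -
  let ?I = "\<integral>\<^sup>+l\<in>{0<..}. ennreal (2 * l) * (if ennreal l < a then 1 else 0) \<partial>lborel"
  have *: "ennreal (b\<^sup>2) \<le> ?I"
    if "0 \<le> b" "ennreal b \<le> a" for b :: real
  proof -
    have "ennreal (b\<^sup>2) = (\<integral>\<^sup>+l. ennreal (2 * l) * indicator {0..b} l \<partial>lborel)"
      using that by (subst nn_integral_FTC_Icc[where F = "\<lambda>x. x\<^sup>2"]) (auto intro!: derivative_eq_intros)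
    also have "\<dots> \<le> ?I"
    proof (rule nn_integral_mono_AE)
      show "AE l in lborel. ennreal (2 * l) * indicator {0..b} l \<le> ennreal (2 * l) * (if ennreal l < a then 1 else 0) * indicator {0<..} l"
        using AE_lborel_singleton[of b]
      proof eventually_elim
        case (elim l)
        have "ennreal l < a" if "0 \<le> l" "l \<le> b"
          using that elim \<open>ennreal b \<le> a\<close> by (metis antisym_conv1 ennreal_lessI less_le_trans order_le_less_trans)
        then show ?case by (cases "l = 0") (auto simp: indicator_def)
      qed
    qed
    finally show ?thesis .
  qed
  show ?thesis
  proof (cases a)
    case (real r)
    then show ?thesis using *[of r] by (simp add: ennreal_power)
  next
    case top
    have "ennreal (real n) \<le> ?I" for n
    proof -
      have "ennreal (real n) \<le> ennreal ((real n)\<^sup>2)"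
        by (intro ennreal_leI) (metis of_nat_le_iff of_nat_power power2_nat_le_imp_le self_le_power power_0 le_square power2_eq_square)
      also have "\<dots> \<le> ?I"
        by (rule *) (auto simp: top)
      finally show ?thesis .
    qed
    then have "?I = top"
      by (metis ennreal_Ex_less_of_nat ennreal_of_nat_eq_real_of_nat leD top.not_eq_extremum)
    then show ?thesis by simp
  qed
qed

text \<open>Marcinkiewicz interpolation between the weak bound and the trivial sup bound. At level
  \<open>l\<close> only the part \<open>u l\<close> of \<open>v\<close> above \<open>l / 2\<close>
  matters, and the weak bound at level \<open>l / 2\<close> gives \<open>2 * l\<close> times the
  measure of \<open>?E l\<close> at most 20 times its integral. For fixed \<open>s\<close> only
  \<open>l < 2 * v s\<close> contributes, so integrating over the levels yields
  \<open>20 * v s * (2 * v s)\<close>, whence the 40.\<close>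

lemma maximal_fn_L2:
  assumes v[measurable]: "v \<in> borel_measurable borel"
  shows "(\<integral>\<^sup>+x. (maximal_fn v x)\<^sup>2 \<partial>lborel) \<le> 40 * (\<integral>\<^sup>+s. (v s)\<^sup>2 \<partial>lborel)"
proof (cases "(\<integral>\<^sup>+s. (v s)\<^sup>2 \<partial>lborel) = \<infinity>")
  case True
  then show ?thesis by (simp add: ennreal_mult_top)
next
  case False
  let ?E = "\<lambda>l::real. {x. ennreal l < maximal_fn v x}"
  let ?g = "\<lambda>l x::real. ennreal (2 * l) * (if ennreal l < maximal_fn v x then 1 else 0)"
  define u where "u l s = (if ennreal (l/2) < v s then v s else 0)" for l s
  have [measurable]: "(\<lambda>(l, s). u l s) \<in> borel_measurable (borel \<Otimes>\<^sub>M borel)" "u l \<in> borel_measurable borel" for l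
    unfolding u_def[abs_def] by measurable
  have weak: "ennreal (2*l) * emeasure lborel (?E l) \<le> 20 * (\<integral>\<^sup>+s. u l s \<partial>lborel)"
    if l: "0 < l" for l
  proof -
    \<comment> \<open>The weak bound needs an integrable function; above the height
      \<open>l / 2\<close> the function is dominated by a multiple of its square.\<close>
    have "(\<integral>\<^sup>+s. u l s \<partial>lborel) \<le> (\<integral>\<^sup>+s. ennreal (2/l) * (v s)\<^sup>2 \<partial>lborel)"
    proof (rule nn_integral_mono)
      fix s
      have "v s \<le> ennreal (2/l) * (v s)\<^sup>2" if "ennreal (l/2) < v s"
      proof -
        have "v s = ennreal (2/l) * (ennreal (l/2) * v s)"
          using l by (simp add: mult.assoc[symmetric] ennreal_mult[symmetric])
        also have "\<dots> \<le> ennreal (2/l) * (v s * v s)"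
          using that by (intro mult_left_mono mult_right_mono) auto
        finally show ?thesis by (simp add: power2_eq_square)
      qed
      then show "u l s \<le> ennreal (2/l) * (v s)\<^sup>2" by (auto simp: u_def)
    qed
    also have "\<dots> = ennreal (2/l) * (\<integral>\<^sup>+s. (v s)\<^sup>2 \<partial>lborel)"
      by (rule nn_integral_cmult) measurable
    also have "\<dots> < \<infinity>" using False by (simp add: ennreal_mult_less_top less_top)
    finally have fin: "(\<integral>\<^sup>+s. u l s \<partial>lborel) < \<infinity>" .
    have "(?E l) \<subseteq> {x. ennreal (l/2) < maximal_fn (u l) x}"
    proof safe
      fix x assume "ennreal l < maximal_fn v x"
      also have "maximal_fn v x \<le> ennreal (l/2) + maximal_fn (u l) x"
        using l by (intro maximal_fn_add_le) (auto simp: u_def not_less)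
      finally show "ennreal (l/2) < maximal_fn (u l) x"
        using l by (metis add_left_mono ennreal_plus field_sum_of_halves leD less_eq_real_def
            linorder_not_less half_gt_zero)
    qed
    then have "emeasure lborel (?E l) \<le> emeasure lborel {x. ennreal (l/2) < maximal_fn (u l) x}"
      by (rule emeasure_mono) measurable
    then have "ennreal (2*l) * emeasure lborel (?E l)
      \<le> ennreal (2*l) * emeasure lborel {x. ennreal (l/2) < maximal_fn (u l) x}"
      by (rule mult_left_mono) simp
    also have eq: "ennreal (2*l) = 4 * ennreal (l/2)"
      using l by (simp add: ennreal_mult[symmetric] flip: ennreal_numeral)
    also have "4 * ennreal (l/2) * emeasure lborel {x. ennreal (l/2) < maximal_fn (u l) x} \<le> 4 * (5 * (\<integral>\<^sup>+s. u l s \<partial>lborel))"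
      unfolding mult.assoc using maximal_fn_weak_type[OF _ fin, of "l/2"] l by (intro mult_left_mono) auto
    finally show ?thesis by (simp add: eq mult.assoc[symmetric])
  qed
  have "(\<integral>\<^sup>+x. (maximal_fn v x)\<^sup>2 \<partial>lborel)
     \<le> (\<integral>\<^sup>+x. (\<integral>\<^sup>+l\<in>{0<..}. ?g l x \<partial>lborel) \<partial>lborel)"
    by (intro nn_integral_mono ennreal_square_le_layer_cake)
  also have "\<dots> = (\<integral>\<^sup>+l. (\<integral>\<^sup>+x. ?g l x * indicator {0<..} l \<partial>lborel) \<partial>lborel)"
    by (rule lborel_pair.Fubini'[symmetric]) measurable
  also have "\<dots> \<le> (\<integral>\<^sup>+l. (\<integral>\<^sup>+s. 20 * (u l s * indicator {0<..} l) \<partial>lborel) \<partial>lborel)"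
  proof (rule nn_integral_mono)
    fix l :: real
    show "(\<integral>\<^sup>+x. ?g l x * indicator {0<..} l \<partial>lborel)
       \<le> (\<integral>\<^sup>+s. 20 * (u l s * indicator {0<..} l) \<partial>lborel)"
    proof (cases "0 < l")
      case True
      have "(\<integral>\<^sup>+x. ?g l x * indicator {0<..} l \<partial>lborel)
        = (\<integral>\<^sup>+x. ennreal (2 * l) * indicator (?E l) x \<partial>lborel)"
        using True by (intro nn_integral_cong) (auto simp: indicator_def)
      also have "\<dots> = ennreal (2*l) * emeasure lborel (?E l)"
        by (rule nn_integral_cmult_indicator) measurable
      also have "\<dots> \<le> 20 * (\<integral>\<^sup>+s. u l s \<partial>lborel)" by (rule weak[OF True])
      also have "\<dots> = (\<integral>\<^sup>+s. 20 * (u l s * indicator {0<..} l) \<partial>lborel)"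
        using True by (simp add: nn_integral_cmult)
      finally show ?thesis .
    qed auto
  qed
  also have "\<dots> = (\<integral>\<^sup>+s. (\<integral>\<^sup>+l. 20 * (u l s * indicator {0<..} l) \<partial>lborel) \<partial>lborel)"
    by (rule lborel_pair.Fubini') measurable
  also have "\<dots> \<le> (\<integral>\<^sup>+s. 40 * (v s)\<^sup>2 \<partial>lborel)"
  proof (rule nn_integral_mono)
    fix s
    show "(\<integral>\<^sup>+l. 20 * (u l s * indicator {0<..} l) \<partial>lborel) \<le> 40 * (v s)\<^sup>2"
    proof (cases "v s")
      case (real a)
      have "(\<integral>\<^sup>+l. 20 * (u l s * indicator {0<..} l) \<partial>lborel) \<le> (\<integral>\<^sup>+l. (20 * v s) * indicator {0..2*a} l \<partial>lborel)"
        using real by (intro nn_integral_mono) (auto simp: u_def indicator_def ennreal_less_iff)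
      also have "\<dots> = 20 * v s * ennreal (2 * a)"
        using real by (subst nn_integral_cmult_indicator) auto
      also have "\<dots> = 40 * (v s)\<^sup>2"
        using real by (simp add: ennreal_mult[symmetric] ennreal_power power2_eq_square flip: ennreal_numeral)
      finally show ?thesis .
    qed (simp add: ennreal_mult_top)
  qed
  also have "\<dots> = 40 * (\<integral>\<^sup>+s. (v s)\<^sup>2 \<partial>lborel)"
    by (rule nn_integral_cmult) measurable
  finally show ?thesis .
qed

section \<open>Poisson integrals on an interval\<close>

definition poisson_kernel :: "real \<Rightarrow> real \<Rightarrow> real" where
  "poisson_kernel y u = y / (pi * (u\<^sup>2 + y\<^sup>2))"

definition poisson_integral :: "real \<Rightarrow> real \<Rightarrow> (real \<Rightarrow> real) \<Rightarrow> real \<Rightarrow> real \<Rightarrow> real" where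
  "poisson_integral a b \<psi> x y = integral {a..b} (\<lambda>s. poisson_kernel y (x - s) * \<psi> s)"

lemma poisson_kernel_nonneg: "0 < y \<Longrightarrow> 0 \<le> poisson_kernel y u"
  by (simp add: poisson_kernel_def)

lemma continuous_on_poisson_kernel:
  assumes "0 < y"
  shows "continuous_on A (\<lambda>s. poisson_kernel y (x - s))"
  unfolding poisson_kernel_def
  by (intro continuous_intros) (use assms in \<open>auto simp: sum_power2_eq_zero_iff\<close>)

lemma poisson_kernel_has_integral:
  assumes "0 < y" "c \<le> d"
  shows "((\<lambda>s. poisson_kernel y (x - s)) has_integral (arctan ((d - x) / y) - arctan ((c - x) / y)) / pi) {c..d}"
proof -
  have "((\<lambda>s. arctan ((s - x) / y) / pi) has_vector_derivative poisson_kernel y (x - s)) (at s within {c..d})" for s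
  proof -
    have ne: "y + (s - x) * (s - x) / y \<noteq> 0"
      using assms by (intro less_imp_neq[symmetric] add_pos_nonneg) auto
    have "((\<lambda>s. arctan ((s - x) / y) / pi) has_real_derivative inverse (1 + ((s - x) / y)\<^sup>2) * (1 / y) / pi) (at s within {c..d})"
      using assms by (auto intro!: derivative_eq_intros)
    also have "inverse (1 + ((s - x) / y)\<^sup>2) * (1 / y) / pi = poisson_kernel y (x - s)"
    proof -
      have "1 + ((s - x) / y)\<^sup>2 = ((x - s)\<^sup>2 + y\<^sup>2) / y\<^sup>2"
        using assms by (simp add: field_simps power2_commute)
      then show ?thesis
        using assms by (simp add: poisson_kernel_def power2_eq_square)
    qed
    finally show ?thesis by (simp add: has_real_derivative_iff_has_vector_derivative)
  qed
  from fundamental_theorem_of_calculus[OF assms(2) this]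
  show ?thesis by (simp add: diff_divide_distrib)
qed

lemma poisson_kernel_integral_le_1:
  assumes "0 < y" "a \<le> b"
  shows "integral {a..b} (\<lambda>s. poisson_kernel y (x - s)) \<le> 1"
proof -
  have "arctan ((b - x) / y) - arctan ((a - x) / y) \<le> pi"
    using arctan_lbound[of "(a - x) / y"] arctan_ubound[of "(b - x) / y"] by linarith
  then show ?thesis
    using integral_unique[OF poisson_kernel_has_integral[OF assms, of x]] by (simp add: divide_le_eq)
qed

text \<open>Integrate the tangent line inequality for \<open>exp\<close> at the mean value; the window may carry
  less than the full mass of the kernel because the tangent line at \<open>0\<close> lies below \<open>1\<close>.\<close>

lemma poisson_integral_jensen:
  assumes y: "0 < y" and ab: "a \<le> b" and l: "continuous_on {a..b} \<psi>"
    and nn: "\<And>s. s \<in> {a..b} \<Longrightarrow> 0 \<le> \<psi> s"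
  shows "exp (poisson_integral a b \<psi> x y / 2) \<le> 1 + poisson_integral a b (\<lambda>s. exp (\<psi> s / 2) - 1) x y"
proof -
  define m where "m = poisson_integral a b \<psi> x y / 2"
  define k where "k s = poisson_kernel y (x - s)" for s
  define q where "q = integral {a..b} k"
  have kc: "continuous_on {a..b} k"
    unfolding k_def by (rule continuous_on_poisson_kernel[OF y])
  have q: "q \<le> 1"
    unfolding q_def k_def using poisson_kernel_integral_le_1[OF y ab] by simp
  have "(\<lambda>s. k s * (exp (\<psi> s / 2) - 1)) integrable_on {a..b}"
    by (intro integrable_continuous_interval continuous_intros kc l) auto
  have int: "(k has_integral q) {a..b}" "((\<lambda>s. k s * \<psi> s) has_integral (2 * m)) {a..b}"
    unfolding q_def m_def poisson_integral_def
    by (auto simp: k_def[symmetric] intro!: integrable_integral integrable_continuous_interval continuous_intros kc l)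
  \<comment> \<open>The integrand is the kernel times (tangent of \<open>exp\<close> at
    \<open>m\<close>, evaluated at half of \<psi>, minus 1). The coefficient of the bare kernel is
    nonpositive, so replacing the mass \<open>q\<close> by 1 only lowers the value.\<close>
  have "((\<lambda>s. (exp m * (1 - m) - 1) * k s + exp m / 2 * (k s * \<psi> s)) has_integral
       (exp m * (1 - m) - 1) * q + exp m / 2 * (2 * m)) {a..b}"
    by (intro has_integral_add has_integral_mult_right int)
  then have "(exp m * (1 - m) - 1) * q + exp m / 2 * (2 * m) \<le> integral {a..b} (\<lambda>s. k s * (exp (\<psi> s / 2) - 1))"
  proof (rule has_integral_le)
    show "((\<lambda>s. k s * (exp (\<psi> s / 2) - 1)) has_integral integral {a..b} (\<lambda>s. k s * (exp (\<psi> s / 2) - 1))) {a..b}"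
      by (intro integrable_integral integrable_continuous_interval continuous_intros kc l) auto
    fix s assume "s \<in> {a..b}"
    have "1 + (\<psi> s / 2 - m) \<le> exp (\<psi> s / 2 - m)"
      by (rule exp_ge_add_one_self)
    then have "exp m * (1 + (\<psi> s / 2 - m)) \<le> exp m * exp (\<psi> s / 2 - m)"
      by simp
    also have "\<dots> = exp (\<psi> s / 2)"
      by (simp add: exp_add[symmetric])
    finally have "k s * (exp m * (1 + (\<psi> s / 2 - m)) - 1) \<le> k s * (exp (\<psi> s / 2) - 1)"
      by (intro mult_left_mono) (auto simp: k_def poisson_kernel_nonneg y)
    then show "(exp m * (1 - m) - 1) * k s + exp m / 2 * (k s * \<psi> s) \<le> k s * (exp (\<psi> s / 2) - 1)"
      by (simp add: algebra_simps)
  qed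
  moreover have "exp m * (1 - m) \<le> 1"
  proof -
    have "1 - m \<le> exp (- m)" using exp_ge_add_one_self[of "- m"] by simp
    then have "exp m * (1 - m) \<le> exp m * exp (- m)" by simp
    then show ?thesis by (simp add: exp_add[symmetric])
  qed
  then have "(exp m * (1 - m) - 1) * q \<ge> (exp m * (1 - m) - 1)"
    using mult_left_mono_neg[OF q, of "exp m * (1 - m) - 1"] by simp
  ultimately have "exp m \<le> 1 + integral {a..b} (\<lambda>s. k s * (exp (\<psi> s / 2) - 1))"
    by (simp add: right_diff_distrib)
  then show ?thesis
    by (simp add: m_def k_def poisson_integral_def)
qed

text \<open>If \<open>j\<close> is the least index with \<open>\<bar>u\<bar> \<le> 2 ^ j * y\<close>
  and it is positive, then \<open>\<bar>u\<bar>\<close> exceeds half of that radius, so the kernel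
  is at most \<open>1 / (pi * y * 4 ^ (j - 1))\<close>. The factor 4 in the coefficients pays for
  this shift of index.\<close>

lemma poisson_kernel_le_dyadic:
  assumes "0 < y"
  shows "ennreal (poisson_kernel y u) \<le> (\<Sum>j. ennreal (4 / (pi * y * 4 ^ j)) * indicator {- (2 ^ j * y)..2 ^ j * y} u)"
proof -
  obtain j where j: "\<bar>u\<bar> \<le> 2 ^ j * y" "poisson_kernel y u \<le> 4 / (pi * y * 4 ^ j)"
  proof (cases "\<bar>u\<bar> \<le> y")
    case True
    have "poisson_kernel y u \<le> y / (pi * y\<^sup>2)"
      unfolding poisson_kernel_def using assms by (intro divide_left_mono) (auto intro!: mult_pos_pos add_nonneg_pos)
    also have "\<dots> \<le> 4 / (pi * y * 4 ^ 0)"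
      using assms by (simp add: power2_eq_square divide_simps)
    finally show ?thesis using True by (intro that[of 0]) auto
  next
    case False
    have "\<exists>j. \<bar>u\<bar> / y \<le> 2 ^ j"
      using real_arch_pow[of 2 "\<bar>u\<bar> / y"] by (auto intro: less_imp_le)
    then have ex: "\<exists>j. \<bar>u\<bar> \<le> 2 ^ j * y" using assms by (simp add: divide_le_eq)
    define j where "j = (LEAST j. \<bar>u\<bar> \<le> 2 ^ j * y)"
    have j: "\<bar>u\<bar> \<le> 2 ^ j * y" unfolding j_def by (rule LeastI_ex[OF ex])
    with False obtain i where i: "j = Suc i" by (cases j) auto
    have "\<not> \<bar>u\<bar> \<le> 2 ^ i * y" using not_less_Least[of i "\<lambda>j. \<bar>u\<bar> \<le> 2 ^ j * y"] i unfolding j_def by simp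
    then have "(2 ^ i * y)\<^sup>2 \<le> \<bar>u\<bar>\<^sup>2" using assms by (intro power_mono) auto
    then have le: "4 ^ i * y\<^sup>2 \<le> u\<^sup>2"
      by (simp add: power_mult_distrib power_even_eq[symmetric] power_mult[symmetric] mult.commute[of i 2])
         (simp add: power_mult)
    have "poisson_kernel y u \<le> y / (pi * (4 ^ i * y\<^sup>2))"
      unfolding poisson_kernel_def using assms le
      by (intro divide_left_mono mult_left_mono) (auto intro!: mult_pos_pos add_nonneg_pos add_increasing2)
    also have "\<dots> = 4 / (pi * y * 4 ^ j)"
      using assms by (simp add: i power2_eq_square)
    finally show ?thesis using j by (intro that[of j]) auto
  qed
  let ?F = "\<lambda>j. ennreal (4 / (pi * y * 4 ^ j)) * indicator {- (2 ^ j * y)..2 ^ j * y} u :: ennreal"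
  have "ennreal (poisson_kernel y u) \<le> ennreal (4 / (pi * y * 4 ^ j)) * indicator {- (2 ^ j * y)..2 ^ j * y} u"
    using j by (auto simp: indicator_def intro!: ennreal_leI)
  also have "\<dots> \<le> (\<Sum>j. ennreal (4 / (pi * y * 4 ^ j)) * indicator {- (2 ^ j * y)..2 ^ j * y} u)"
    using sum_le_suminf[OF summableI, of "{j}" ?F] by (simp only: sum.insert finite.emptyI sum.empty add_0_right finite.insertI empty_iff not_False_eq_True simp_thms zero_le)

  finally show ?thesis .
qed

lemma poisson_le_maximal_fn:
  assumes y: "0 < y" "y \<in> \<rat>" and [measurable]: "v \<in> borel_measurable borel"
  shows "(\<integral>\<^sup>+s. v s * ennreal (poisson_kernel y (x - s)) \<partial>lborel) \<le> 6 * maximal_fn v x"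
proof -
  let ?a = "\<lambda>j. ennreal (4 / (pi * y * 4 ^ j))"
  have "(\<integral>\<^sup>+s. v s * ennreal (poisson_kernel y (x - s)) \<partial>lborel)
     \<le> (\<integral>\<^sup>+s. (\<Sum>j. ?a j * (v s * indicator {x - 2 ^ j * y..x + 2 ^ j * y} s)) \<partial>lborel)"
  proof (rule nn_integral_mono)
    fix s
    have "v s * ennreal (poisson_kernel y (x - s))
       \<le> v s * (\<Sum>j. ?a j * indicator {- (2 ^ j * y)..2 ^ j * y} (x - s))"
      by (intro mult_left_mono poisson_kernel_le_dyadic y) auto
    also have "\<dots> = (\<Sum>j. v s * (?a j * indicator {- (2 ^ j * y)..2 ^ j * y} (x - s)))"
      by simp
    also have "\<dots> = (\<Sum>j. ?a j * (v s * indicator {x - 2 ^ j * y..x + 2 ^ j * y} s))"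
      by (intro arg_cong[where f = suminf] ext) (auto simp: indicator_def mult.commute)
    finally show "v s * ennreal (poisson_kernel y (x - s))
      \<le> (\<Sum>j. ?a j * (v s * indicator {x - 2 ^ j * y..x + 2 ^ j * y} s))" .
  qed
  also have "\<dots> = (\<Sum>j. ?a j * (\<integral>\<^sup>+s\<in>{x - 2 ^ j * y..x + 2 ^ j * y}. v s \<partial>lborel))"
    by (subst nn_integral_suminf) (auto simp: nn_integral_cmult)
  also have "\<dots> \<le> (\<Sum>j. ?a j * (ennreal (2 * (2 ^ j * y)) * maximal_fn v x))"
    using y by (intro suminf_le mult_left_mono window_integral_le_maximal_fn) auto
  also have "\<dots> = (\<Sum>j. maximal_fn v x * ennreal (8 / pi * (1/2) ^ j))"
  proof (intro arg_cong[where f = suminf] ext)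
    fix j
    have "4 / (pi * y * 4 ^ j) * (2 * (2 ^ j * y)) = 8 / pi * (1/2) ^ j"
    proof -
      have "(4::real) ^ j = 2 ^ j * 2 ^ j" by (simp add: power_mult_distrib[symmetric])
      then show ?thesis using y by (simp add: field_simps)
    qed
    then show "?a j * (ennreal (2 * (2 ^ j * y)) * maximal_fn v x) = maximal_fn v x * ennreal (8 / pi * (1/2) ^ j)"
      using y by (subst mult.assoc[symmetric], subst ennreal_mult[symmetric]) (simp_all add: mult.commute)
  qed
  also have "\<dots> = maximal_fn v x * (\<Sum>j. ennreal (8 / pi * (1/2) ^ j))"
    by simp
  also have "(\<Sum>j. ennreal (8 / pi * (1/2) ^ j)) = ennreal (16 / pi)"
  proof (rule suminf_ennreal_eq)
    show "(\<lambda>j. 8 / pi * (1/2) ^ j) sums (16 / pi)"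
      using sums_mult[OF geometric_sums[of "1/2::real"], of "8 / pi"] by simp
  qed auto
  also have "maximal_fn v x * ennreal (16 / pi) \<le> maximal_fn v x * ennreal 6"
    using pi_gt3 by (intro mult_left_mono ennreal_leI) (auto simp: field_simps)
  finally show ?thesis by (simp add: mult.commute)
qed

text \<open>Only the part of the kernel within distance \<open>\<delta>\<close> is used; near the end points, where that part
  leaves the interval, \<open>\<psi>\<close> is itself small.\<close>

lemma poisson_integral_lower_bound:
  assumes l: "continuous_on {a..b} \<psi>" and nn: "\<And>s. s \<in> {a..b} \<Longrightarrow> 0 \<le> \<psi> s"
    and ends: "\<psi> a = 0" "\<psi> b = 0" and ab: "a < b" and k: "0 < (\<kappa>::real)"
  shows "\<forall>\<^sub>F \<eta> in at_right 0. \<forall>s\<in>{a..b}. \<psi> s - \<kappa> \<le> poisson_integral a b \<psi> s \<eta>"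
proof -
  obtain \<delta> where \<delta>: "0 < \<delta>" "\<And>s t. \<lbrakk>s \<in> {a..b}; t \<in> {a..b}; dist t s \<le> \<delta>\<rbrakk> \<Longrightarrow> dist (\<psi> t) (\<psi> s) < \<kappa> / 2"
  proof -
    have "uniformly_continuous_on {a..b} \<psi>" using l by (rule compact_uniformly_continuous) simp
    then obtain d where "0 < d" "\<forall>s\<in>{a..b}. \<forall>t\<in>{a..b}. dist t s < d \<longrightarrow> dist (\<psi> t) (\<psi> s) < \<kappa> / 2"
      unfolding uniformly_continuous_on_def using k by (meson half_gt_zero)
    then show ?thesis by (intro that[of "d/2"]) auto
  qed
  obtain B where B: "0 < B" "\<And>s. s \<in> {a..b} \<Longrightarrow> \<psi> s \<le> B"
  proof -
    have "bounded (\<psi> ` {a..b})" by (intro compact_imp_bounded compact_continuous_image l) simp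
    then obtain B where "0 < B" "\<forall>x\<in>\<psi> ` {a..b}. norm x \<le> B" by (auto simp: bounded_pos)
    then show ?thesis by (intro that[of B]) force+
  qed
  let ?a = "\<lambda>\<eta>. 2 / pi * arctan (\<delta> / \<eta>)"
  have "((\<lambda>\<eta>. B * (1 - ?a \<eta>)) \<longlongrightarrow> B * (1 - 2 / pi * (pi / 2))) (at_right 0)"
  proof -
    have "filterlim (\<lambda>\<eta>. \<delta> / \<eta>) at_top (at_right 0)"
      using \<delta>(1) by real_asymp
    from filterlim_compose[OF tendsto_arctan_at_top this]
    show ?thesis by (intro tendsto_intros)
  qed
  then have "\<forall>\<^sub>F \<eta> in at_right 0. B * (1 - ?a \<eta>) < \<kappa> / 2"
    using k by (intro order_tendstoD) auto
  moreover have "\<forall>\<^sub>F \<eta> in at_right 0. (0::real) < \<eta>"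
    by (simp add: eventually_at_right_less)
  ultimately show ?thesis
  proof eventually_elim
    case (elim \<eta>)
    show ?case
    proof
      fix s assume s: "s \<in> {a..b}"
      let ?g = "\<lambda>t. poisson_kernel \<eta> (s - t) * \<psi> t"
      have gi: "?g integrable_on {a..b}"
        by (intro integrable_continuous_interval continuous_intros l continuous_on_poisson_kernel elim)
      have g0: "0 \<le> ?g t" if "t \<in> {a..b}" for t
        using nn[OF that] poisson_kernel_nonneg[OF elim(2)] by simp
      have pos: "0 \<le> poisson_integral a b \<psi> s \<eta>"
        unfolding poisson_integral_def by (intro integral_nonneg gi g0)
      consider "s - \<delta> < a" | "b < s + \<delta>" | "\<psi> s \<le> \<kappa> / 2" | "a \<le> s - \<delta>" "s + \<delta> \<le> b" "\<kappa> / 2 < \<psi> s" by linarith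
      then show "\<psi> s - \<kappa> \<le> poisson_integral a b \<psi> s \<eta>"
      proof cases
        case 1
        then have "dist (\<psi> s) (\<psi> a) < \<kappa> / 2" using s ab by (intro \<delta>) (auto simp: dist_real_def)
        then show ?thesis using pos ends k by (auto simp: dist_real_def)
      next
        case 2
        then have "dist (\<psi> s) (\<psi> b) < \<kappa> / 2" using s ab by (intro \<delta>) (auto simp: dist_real_def)
        then show ?thesis using pos ends k by (auto simp: dist_real_def)
      next
        case 3
        then show ?thesis using pos k by linarith
      next
        case 4
        let ?J = "{s - \<delta>..s + \<delta>}"
        have J: "?J \<subseteq> {a..b}" using 4 by auto
        \<comment> \<open>\<open>?a \<eta>\<close> is the mass of the kernel within distance
          \<delta>; the missing mass, multiplied by the bound \<open>B\<close>, costs less than half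
          of \<kappa>.\<close>
        have "\<psi> s - \<kappa> \<le> (\<psi> s - \<kappa> / 2) - B * (1 - ?a \<eta>)"
          using elim(1) by simp
        also have "\<dots> \<le> (\<psi> s - \<kappa> / 2) * ?a \<eta>"
        proof -
          have "arctan (\<delta> / \<eta>) < pi / 2" by (rule arctan_ubound)
          then have "0 \<le> 1 - ?a \<eta>" by (simp add: field_simps)
          then have "(\<psi> s - \<kappa> / 2) * (1 - ?a \<eta>) \<le> B * (1 - ?a \<eta>)"
            using B(2)[OF s] k by (intro mult_right_mono) auto
          then show ?thesis by (simp add: algebra_simps)
        qed
        also have "\<dots> = integral ?J (\<lambda>t. poisson_kernel \<eta> (s - t) * (\<psi> s - \<kappa> / 2))"
        proof -
          have "((\<lambda>t. poisson_kernel \<eta> (s - t)) has_integral ?a \<eta>) ?J"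
            using poisson_kernel_has_integral[OF elim(2), of "s - \<delta>" "s + \<delta>" s] \<delta>(1)
            by (simp add: arctan_minus)
          from integral_unique[OF has_integral_mult_left[OF this, of "\<psi> s - \<kappa> / 2"]]
          show ?thesis by (simp add: mult.commute)
        qed
        also have "\<dots> \<le> integral ?J ?g"
        proof (rule integral_le)
          show "(\<lambda>t. poisson_kernel \<eta> (s - t) * (\<psi> s - \<kappa> / 2)) integrable_on ?J"
            by (intro integrable_continuous_interval continuous_intros continuous_on_poisson_kernel elim)
          show "?g integrable_on ?J"
            using integrable_on_subinterval[OF gi] J by simp
          fix t assume t: "t \<in> ?J"
          then have "dist (\<psi> t) (\<psi> s) < \<kappa> / 2"
            using J s by (intro \<delta>) (auto simp: dist_real_def)
          then have "\<psi> s - \<kappa> / 2 \<le> \<psi> t" unfolding dist_real_def by linarith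
          then show "poisson_kernel \<eta> (s - t) * (\<psi> s - \<kappa> / 2) \<le> ?g t"
            by (intro mult_left_mono poisson_kernel_nonneg elim)
        qed
        also have "\<dots> \<le> integral {a..b} ?g"
          using g0 J by (intro integral_subset_le gi integrable_on_subinterval[OF gi]) auto
        finally show ?thesis by (simp add: poisson_integral_def)
      qed
    qed
  qed
qed

text \<open>A Cauchy integral normalised so that its real part is the Poisson integral. It turns the
  exponential of a Poisson integral into the modulus of a holomorphic function, so that the maximum
  modulus principle can stand in for a principle for subharmonic functions.\<close>

definition herglotz :: "real \<Rightarrow> real \<Rightarrow> (real \<Rightarrow> real) \<Rightarrow> complex \<Rightarrow> complex" where
  "herglotz a b \<psi> z = integral {a..b} (\<lambda>s. of_real (\<psi> s) / (of_real s - z)) / (of_real pi * \<i>)"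

lemma holomorphic_herglotz:
  assumes l: "continuous_on {a..b} \<psi>"
  shows "herglotz a b \<psi> holomorphic_on {z. Im z > 0}"
proof -
  have ne: "of_real s - z \<noteq> 0" if "Im z > 0" for s z
    using that by (metis Im_complex_of_real eq_iff_diff_eq_0 less_irrefl)
  have "(\<lambda>z. integral (cbox a b) (\<lambda>s. of_real (\<psi> s) / (of_real s - z))) holomorphic_on {z. Im z > 0}"
  proof (rule leibniz_rule_holomorphic)
    show "((\<lambda>z. of_real (\<psi> s) / (of_real s - z)) has_field_derivative of_real (\<psi> s) / (of_real s - z)\<^sup>2) (at z within {z. Im z > 0})"
      if "z \<in> {z. Im z > 0}" for z s
      using ne[of z s] that by (auto intro!: derivative_eq_intros simp: power2_eq_square)
    have l': "continuous_on A (\<lambda>p. \<psi> (snd p))" if "A \<subseteq> UNIV \<times> {a..b}" for A :: "(complex \<times> real) set"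
      using that by (intro continuous_on_compose2[OF l] continuous_intros) auto
    show "(\<lambda>s. complex_of_real (\<psi> s) / (of_real s - z)) integrable_on cbox a b" if "z \<in> {z. Im z > 0}" for z
      using ne that by (auto intro!: integrable_continuous_interval continuous_intros l)
    show "continuous_on ({z. Im z > 0} \<times> cbox a b) (\<lambda>(z, s). complex_of_real (\<psi> s) / (of_real s - z)\<^sup>2)"
      unfolding split_beta using ne by (intro continuous_intros l') auto
    show "convex {z. Im z > 0}" by (rule convex_halfspace_Im_gt)
  qed
  then show ?thesis
    unfolding herglotz_def[abs_def] by (intro holomorphic_intros) (auto simp: cbox_interval)
qed

lemma Re_herglotz:
  assumes l: "continuous_on {a..b} \<psi>" and y: "0 < Im z"
  shows "Re (herglotz a b \<psi> z) = poisson_integral a b \<psi> (Re z) (Im z)"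
proof -
  have ne: "of_real s - z \<noteq> 0" for s
    using y by (metis Im_complex_of_real eq_iff_diff_eq_0 less_irrefl)
  have "((\<lambda>s. of_real (\<psi> s) / (of_real s - z)) has_integral integral {a..b} (\<lambda>s. of_real (\<psi> s) / (of_real s - z))) {a..b}"
    using ne by (auto intro!: integrable_integral integrable_continuous_interval continuous_intros l)
  from has_integral_linear[OF has_integral_divide[OF this, of "of_real pi * \<i>"] bounded_linear_Re]
  have "((\<lambda>s. Re (of_real (\<psi> s) / (of_real s - z) / (of_real pi * \<i>))) has_integral Re (herglotz a b \<psi> z)) {a..b}"
    by (simp add: o_def herglotz_def)
  moreover have "Re (of_real (\<psi> s) / (of_real s - z) / (of_real pi * \<i>)) = poisson_kernel (Im z) (Re z - s) * \<psi> s" for s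
  proof -
    have "of_real (\<psi> s) / (of_real s - z) / (of_real pi * \<i>) = of_real (\<psi> s / pi) * (- \<i> * inverse (of_real s - z))"
      by (simp add: divide_inverse mult_ac)
    moreover have "Re (- \<i> * inverse (of_real s - z)) = Im z / ((Re z - s)\<^sup>2 + (Im z)\<^sup>2)"
      by (simp add: power2_commute)
    moreover have "Re (of_real c * w) = c * Re w" for c w by simp
    ultimately have "Re (of_real (\<psi> s) / (of_real s - z) / (of_real pi * \<i>))
        = \<psi> s / pi * (Im z / ((Re z - s)\<^sup>2 + (Im z)\<^sup>2))"
      by (simp only:)
    then show ?thesis by (simp add: poisson_kernel_def)
  qed
  ultimately show ?thesis
    by (simp add: poisson_integral_def integral_unique)
qed

section \<open>Functions bounded in mean on horizontal segments\<close>

text \<open>The window [1, 8] avoids 0, so that the weight is bounded below on it, and leaves enough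
  room around [2, 6] for discs of radius 1/2 followed by translations of length at most 1.\<close>

definition strip_bounded :: "(complex \<Rightarrow> complex) \<Rightarrow> real \<Rightarrow> bool" where
  "strip_bounded f K \<longleftrightarrow> f holomorphic_on upper_half_plane \<and>
     (\<forall>y>0. (\<integral>\<^sup>+x\<in>{1..8}. ennreal (norm (f (Complex x y))) \<partial>lborel) \<le> ennreal K)"

lemma convex_upper_half_plane: "convex upper_half_plane"
  unfolding upper_half_plane_def by (rule convex_halfspace_Im_gt)

lemma open_upper_half_plane: "open upper_half_plane"
  unfolding upper_half_plane_def by (rule open_halfspace_Im_gt)

lemma Complex_in_upper_half_plane [simp]: "Complex x y \<in> upper_half_plane \<longleftrightarrow> 0 < y"
  by (simp add: upper_half_plane_def)

lemma continuous_on_Complex [continuous_intros]: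
  assumes "continuous_on A f" "continuous_on A g"
  shows "continuous_on A (\<lambda>x. Complex (f x) (g x))"
  unfolding Complex_eq by (intro continuous_intros assms)

lemma continuous_on_upper_half_plane_compose:
  assumes "f holomorphic_on upper_half_plane" "continuous_on A g" "\<And>x. x \<in> A \<Longrightarrow> g x \<in> upper_half_plane"
  shows "continuous_on A (\<lambda>x. f (g x))"
  using continuous_on_compose2[OF holomorphic_on_imp_continuous_on[OF assms(1)] assms(2)] assms(3) by blast

lemma upper_half_plane_primitive:
  assumes "f holomorphic_on upper_half_plane"
  obtains G where "\<And>z. z \<in> upper_half_plane \<Longrightarrow> (G has_field_derivative f z) (at z)"
proof -
  obtain G where "\<And>z. z \<in> upper_half_plane \<Longrightarrow> (G has_field_derivative f z) (at z within upper_half_plane)"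
    using holomorphic_convex_primitive'[OF convex_upper_half_plane open_upper_half_plane assms] by blast
  then show ?thesis
    by (intro that[of G]) (simp add: at_within_open[OF _ open_upper_half_plane])
qed

lemma primitive_diff_horizontal:
  assumes G: "\<And>z. z \<in> upper_half_plane \<Longrightarrow> (G has_field_derivative f z) (at z)"
    and "0 < y" "c \<le> d"
  shows "((\<lambda>x. f (Complex x y)) has_integral G (Complex d y) - G (Complex c y)) {c..d}"
proof (rule fundamental_theorem_of_calculus[OF \<open>c \<le> d\<close>])
  fix x
  have "((\<lambda>x. Complex x y) has_vector_derivative 1) (at x within {c..d})"
    unfolding Complex_eq by (auto intro!: derivative_eq_intros)
  from field_vector_diff_chain_within[OF this has_field_derivative_at_within[OF G]]
  show "((\<lambda>x. G (Complex x y)) has_vector_derivative f (Complex x y)) (at x within {c..d})"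
    using \<open>0 < y\<close> by (simp add: o_def)
qed

lemma primitive_diff_vertical:
  assumes G: "\<And>z. z \<in> upper_half_plane \<Longrightarrow> (G has_field_derivative f z) (at z)"
    and "0 < c" "c \<le> d"
  shows "((\<lambda>y. \<i> * f (Complex x y)) has_integral G (Complex x d) - G (Complex x c)) {c..d}"
proof (rule fundamental_theorem_of_calculus[OF \<open>c \<le> d\<close>])
  fix y assume "y \<in> {c..d}"
  have "((\<lambda>y. Complex x y) has_vector_derivative \<i>) (at y within {c..d})"
    unfolding Complex_eq by (auto intro!: derivative_eq_intros)
  from field_vector_diff_chain_within[OF this has_field_derivative_at_within[OF G]]
  show "((\<lambda>y. G (Complex x y)) has_vector_derivative \<i> * f (Complex x y)) (at y within {c..d})"
    using \<open>0 < c\<close> \<open>y \<in> {c..d}\<close> by (simp add: o_def)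
qed

lemma strip_integral_le:
  assumes f: "strip_bounded f K" and "0 \<le> K" "0 < y" "1 \<le> c" "d \<le> 8"
  shows "integral {c..d} (\<lambda>x. norm (f (Complex x y))) \<le> K"
proof -
  have "continuous_on {c..d} (\<lambda>x. norm (f (Complex x y)))"
    using assms by (intro continuous_intros continuous_on_upper_half_plane_compose[of f]) (auto simp: strip_bounded_def)
  then have "((\<lambda>x. norm (f (Complex x y))) has_integral integral {c..d} (\<lambda>x. norm (f (Complex x y)))) {c..d}"
    by (intro integrable_integral integrable_continuous_interval)
  from nn_integral_has_integral_lebesgue'[OF _ this]
  have "ennreal (integral {c..d} (\<lambda>x. norm (f (Complex x y)))) = (\<integral>\<^sup>+x\<in>{c..d}. ennreal (norm (f (Complex x y))) \<partial>lborel)"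
    by simp
  also have "\<dots> \<le> (\<integral>\<^sup>+x\<in>{1..8}. ennreal (norm (f (Complex x y))) \<partial>lborel)"
    using assms by (intro nn_integral_mono) (auto simp: indicator_def)
  also have "\<dots> \<le> ennreal K" using assms by (auto simp: strip_bounded_def)
  finally show ?thesis using assms by simp
qed

text \<open>Translation differences of a primitive \<open>G\<close> are bounded by \<open>K\<close>, so Cauchy's inequality makes
  \<open>f = G'\<close> nearly constant in the horizontal direction.\<close>

lemma strip_bounded_pointwise:
  assumes f: "strip_bounded f K" and K: "0 \<le> K" and x: "2 \<le> x" "x \<le> 6" and y: "0 < y"
  shows "norm (f (Complex x y)) \<le> 3 * K / min y 1"
proof -
  have holf: "f holomorphic_on upper_half_plane" using f by (simp add: strip_bounded_def)
  then obtain G where G: "\<And>z. z \<in> upper_half_plane \<Longrightarrow> (G has_field_derivative f z) (at z)"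
    by (rule upper_half_plane_primitive) blast
  \<comment> \<open>Half of \<open>min y 1\<close>: the disc stays in the half-plane, and the
    segments from \<open>w\<close> to \<open>w + s\<close> stay inside [1, 8].\<close>
  define r where "r = min y 1 / 2"
  have r: "0 < r" "r \<le> 1/2" "r < y" using y by (auto simp: r_def min_def)
  define z where "z = Complex x y"
  have le: "norm (f z) \<le> norm (f (Complex (x + s) y)) + K / r" if s: "s \<in> {0..1}" for s
  proof -
    define D where "D w = G (w + of_real s) - G w" for w
    have U: "w \<in> upper_half_plane" "w + of_real s \<in> upper_half_plane" if "w \<in> cball z r" for w
      using that abs_Im_le_cmod[of "z - w"] r by (auto simp: z_def upper_half_plane_def dist_norm)
    have D: "(D has_field_derivative f (w + of_real s) - f w) (at w)" if "w \<in> cball z r" for w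
    proof -
      have "((\<lambda>w. G (w + of_real s)) has_field_derivative f (w + of_real s)) (at w)"
        using G[OF U(2)[OF that]] by (simp add: DERIV_shift)
      then show ?thesis unfolding D_def[abs_def] using G[OF U(1)[OF that]] by (rule DERIV_diff)
    qed
    have "norm ((deriv ^^ 1) D z) \<le> fact 1 * K / r ^ 1"
    proof (rule Cauchy_inequality)
      show "D holomorphic_on ball z r"
        unfolding holomorphic_on_open[OF open_ball] using D by (metis ball_subset_cball subsetD)
      show "continuous_on (cball z r) D"
        by (intro continuous_at_imp_continuous_on ballI DERIV_isCont[OF D]) auto
      fix w assume "norm (z - w) = r"
      then have w: "w \<in> cball z r" by (simp add: dist_norm)
      have "\<bar>x - Re w\<bar> \<le> r" using w abs_Re_le_cmod[of "z - w"] by (auto simp: z_def dist_norm)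
      have "((\<lambda>x. f (Complex x (Im w))) has_integral D w) {Re w..Re w + s}"
      proof -
        have "Complex (Re w + s) (Im w) = w + of_real s" by (simp add: complex_eq_iff)
        then show ?thesis
          using primitive_diff_horizontal[OF G, of "Im w" "Re w" "Re w + s"] U(1)[OF w] s
          by (simp add: D_def upper_half_plane_def)
      qed
      then have eq: "D w = integral {Re w..Re w + s} (\<lambda>x. f (Complex x (Im w)))"
        by (simp add: integral_unique)
      have "norm (D w) \<le> integral {Re w..Re w + s} (\<lambda>x. norm (f (Complex x (Im w))))"
        unfolding eq using U(1)[OF w]
        by (intro integral_norm_bound_integral integrable_continuous_interval continuous_intros
            continuous_on_upper_half_plane_compose[OF holf]) (auto simp: upper_half_plane_def)
      also have "\<dots> \<le> K"
        using U(1)[OF w] s x r \<open>\<bar>x - Re w\<bar> \<le> r\<close> K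
        by (intro strip_integral_le[OF f]) (auto simp: upper_half_plane_def)
      finally show "norm (D w) \<le> K" .
    qed (use r in auto)
    moreover have "deriv D z = f (z + of_real s) - f z"
      using D[of z] r by (intro DERIV_imp_deriv) auto
    moreover have "z + of_real s = Complex (x + s) y" by (simp add: z_def complex_eq_iff)
    ultimately have "norm (f (Complex (x + s) y) - f z) \<le> K / r" by simp
    then show ?thesis using norm_triangle_ineq2[of "f z" "f (Complex (x + s) y)"]
      by (simp add: norm_minus_commute)
  qed
  \<comment> \<open>Averaging over translations by 0 to 1 replaces the unknown value at the
    translated point by the mean bound \<open>K\<close>.\<close>
  have "norm (f z) = integral {x..x+1} (\<lambda>t. norm (f z))" by simp
  also have "\<dots> \<le> integral {x..x+1} (\<lambda>t. norm (f (Complex t y)) + K / r)"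
    using le[of "t - x" for t] y
    by (intro integral_le integrable_continuous_interval continuous_intros continuous_on_upper_half_plane_compose[OF holf])
      auto
  also have "\<dots> = integral {x..x+1} (\<lambda>t. norm (f (Complex t y))) + K / r"
    using y by (subst integral_add)
     (auto intro!: integrable_continuous_interval continuous_intros continuous_on_upper_half_plane_compose[OF holf])
  also have "\<dots> \<le> K + K / r"
    using x y K by (intro add_right_mono strip_integral_le[OF f]) auto
  also have "\<dots> \<le> K / min y 1 + 2 * K / min y 1"
    using y K by (intro add_mono) (auto simp: r_def min_def divide_simps mult_left_le)
  finally show ?thesis by (simp add: z_def)
qed

text \<open>The factor \<open>(w - 2) (w - 6)\<close> compensates the blow-up of the pointwise bound at the lower end
  of the vertical sides of the rectangle.\<close>

lemma strip_boundary_factor_le: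
  assumes f: "strip_bounded f K" and K: "0 < K" and w: "2 \<le> Re w" "Re w \<le> 6" "0 < Im w" "Im w \<le> 1"
    and side: "Re w = 2 \<or> Re w = 6 \<or> Im w = 1"
  shows "norm (f w * (w - 2) * (w - 6)) \<le> 75 * K"
proof -
  have fw: "norm (f w) \<le> 3 * K / Im w"
    using strip_bounded_pointwise[OF f _ w(1-3)] K w by (simp add: min_def)
  have m2: "norm (w - 2) \<le> 5" using cmod_le[of "w - 2"] w by simp
  have m6: "norm (w - 6) \<le> 5" using cmod_le[of "w - 6"] w by simp
  have c: "norm (w - 2) \<le> Im w \<or> norm (w - 6) \<le> Im w \<or> Im w = 1"
    using side cmod_le[of "w - 2"] cmod_le[of "w - 6"] w by auto
  \<comment> \<open>On a vertical side one factor is just the height and the other is at most 5; on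
    the top the height is 1 and both are at most 5. Against the pointwise bound
    \<open>3 * K / Im w\<close> this gives \<open>75 * K\<close>.\<close>
  have "norm (w - 2) * norm (w - 6) \<le> 25 * Im w"
  proof -
    consider "norm (w - 2) \<le> Im w" | "norm (w - 6) \<le> Im w" | "Im w = 1" using c by blast
    then show ?thesis
    proof cases
      case 1
      then have "norm (w - 2) * norm (w - 6) \<le> Im w * 5" using m6 w by (intro mult_mono) auto
      then show ?thesis using w by simp
    next
      case 2
      then have "norm (w - 2) * norm (w - 6) \<le> 5 * Im w" using m2 w by (intro mult_mono) auto
      then show ?thesis using w by simp
    next
      case 3
      have "norm (w - 2) * norm (w - 6) \<le> 5 * 5" using m2 m6 by (intro mult_mono) auto
      then show ?thesis using 3 by simp
    qed
  qed
  then have "norm (f w) * (norm (w - 2) * norm (w - 6)) \<le> (3 * K / Im w) * (25 * Im w)"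
    using fw w K by (rule_tac mult_mono) auto
  then show ?thesis using w by (simp add: norm_mult mult.assoc)
qed

text \<open>Maximum modulus for the shifted function times \<open>exp (- H)\<close>, with
  \<open>H\<close> the Herglotz integral of \<psi>. Lifting the bottom side to height \<epsilon>
  makes the boundary data continuous. The truncated logarithm \<psi> vanishes at 2 and 6 because
  \<open>q\<close> is at most 1 on the vertical sides, which is exactly the end point condition in
  the lower bound for Poisson integrals.\<close>

lemma strip_harmonic_majorant:
  assumes f: "strip_bounded f K" and K: "0 < K" and e: "0 < \<epsilon>"
    and x: "2 \<le> x" "x \<le> 6" and y: "0 < y" "y + \<epsilon> \<le> 1"
  defines "q \<equiv> \<lambda>w. norm (f w * (w - 2) * (w - 6)) / (75 * K)"
  defines "\<psi> \<equiv> \<lambda>s. ln (max 1 (q (Complex s \<epsilon>)))"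
  shows "q (Complex x (y + \<epsilon>)) \<le> exp (poisson_integral 2 6 \<psi> x y)"
proof -
  let ?P = "poisson_integral 2 6 \<psi>"
  have holf: "f holomorphic_on upper_half_plane" using f by (simp add: strip_bounded_def)
  have cont_q: "continuous_on A (\<lambda>t. q (g t))" if "continuous_on A g" "\<And>t. t \<in> A \<Longrightarrow> g t \<in> upper_half_plane"
    for A :: "'z::topological_space set" and g
    unfolding q_def using K that by (intro continuous_intros continuous_on_upper_half_plane_compose[OF holf]) auto
  have \<psi>: "continuous_on {2..6} \<psi>"
    unfolding \<psi>_def using e by (intro continuous_intros cont_q) auto
  have \<psi>0: "0 \<le> \<psi> s" for s by (simp add: \<psi>_def)
  have qside: "q w \<le> 1" if "2 \<le> Re w" "Re w \<le> 6" "0 < Im w" "Im w \<le> 1" "Re w = 2 \<or> Re w = 6 \<or> Im w = 1" for w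
    using strip_boundary_factor_le[OF f K that] K by (simp add: q_def)
  have ends: "\<psi> 2 = 0" "\<psi> 6 = 0"
    using qside[of "Complex 2 \<epsilon>"] qside[of "Complex 6 \<epsilon>"] e y by (auto simp: \<psi>_def max_def)
  have appr: "q (Complex x (y + \<epsilon>)) \<le> exp (2 * \<kappa>) * exp (?P x y)" if \<kappa>: "0 < \<kappa>" for \<kappa> :: real
  proof -
    \<comment> \<open>\<open>H\<close> is controlled only in the open half-plane, so the rectangle
      starts at a small height \<eta>. One \<kappa> pays for comparing the data at heights
      \<epsilon> and \<open>\<eta> + \<epsilon>\<close> by uniform continuity of \<open>Q\<close>,
      the other for comparing \<psi> with its Poisson integral at height \<eta>.\<close>
    define Q where "Q = (\<lambda>(s, t). ln (max 1 (q (Complex s t))))"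
    have "continuous_on ({2..6} \<times> {\<epsilon>..1}) Q"
      unfolding Q_def split_beta using e by (intro continuous_intros cont_q) auto
    then have "uniformly_continuous_on ({2..6} \<times> {\<epsilon>..1}) Q"
      by (rule compact_uniformly_continuous) (intro compact_Times compact_Icc)
    then obtain d where d: "0 < d" "\<And>u v. \<lbrakk>u \<in> {2..6} \<times> {\<epsilon>..1}; v \<in> {2..6} \<times> {\<epsilon>..1}; dist v u < d\<rbrakk> \<Longrightarrow> dist (Q v) (Q u) < \<kappa>"
      unfolding uniformly_continuous_on_def using \<kappa> by metis
    have "\<forall>\<^sub>F \<eta> in at_right 0. \<forall>s\<in>{2..6}. \<psi> s - \<kappa> \<le> ?P s \<eta>"
      by (rule poisson_integral_lower_bound[OF \<psi> \<psi>0 ends _ \<kappa>]) auto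
    moreover have "\<forall>\<^sub>F \<eta> in at_right 0. \<eta> < min d y" "\<forall>\<^sub>F \<eta>::real in at_right 0. 0 < \<eta>"
      using d(1) y(1) by (auto intro!: eventually_at_rightI[of 0 "min d y"])
    ultimately have "\<forall>\<^sub>F \<eta> in at_right 0. 0 < \<eta> \<and> \<eta> < min d y \<and> (\<forall>s\<in>{2..6}. \<psi> s - \<kappa> \<le> ?P s \<eta>)"
      by eventually_elim auto
    then obtain \<eta> where \<eta>: "0 < \<eta>" "\<eta> < d" "\<eta> < y" "\<And>s. s \<in> {2..6} \<Longrightarrow> \<psi> s - \<kappa> \<le> ?P s \<eta>"
      by (auto dest!: eventually_happens)
    define H where "H = herglotz 2 6 \<psi>"
    define F where "F w = f (w + \<i> * \<epsilon>) * (w + \<i> * \<epsilon> - 2) * (w + \<i> * \<epsilon> - 6) * exp (- H w)" for w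
    have normF: "norm (F w) = 75 * K * q (w + \<i> * \<epsilon>) * exp (- ?P (Re w) (Im w))" if "0 < Im w" for w
      using Re_herglotz[OF \<psi> that] K by (simp add: F_def q_def H_def norm_mult)
    define S where "S = cbox (Complex 2 \<eta>) (Complex 6 (1 - \<epsilon>))"
    have holF: "F holomorphic_on {w. Im w > 0}"
    proof -
      have "(\<lambda>w. f (w + \<i> * \<epsilon>)) holomorphic_on {w. Im w > 0}"
        using e by (intro holomorphic_on_compose_gen[OF _ holf, unfolded o_def] holomorphic_intros)
          (auto simp: upper_half_plane_def)
      then show ?thesis
        unfolding F_def H_def by (intro holomorphic_intros holomorphic_herglotz \<psi>)
    qed
    have S: "S \<subseteq> {w. Im w > 0}" using \<eta> by (auto simp: S_def in_cbox_complex_iff)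
    have "norm (F (Complex x y)) \<le> 75 * K * exp (2 * \<kappa>)"
    proof (rule maximum_modulus_frontier[where f = F and S = S])
      show "F holomorphic_on interior S"
        using holF by (rule holomorphic_on_subset) (use S interior_subset in blast)
      show "continuous_on (closure S) F"
        using holomorphic_on_imp_continuous_on[OF holF] S by (auto simp: S_def intro: continuous_on_subset)
      show "bounded S" by (simp add: S_def)
      show "Complex x y \<in> S" using x y \<eta> by (simp add: S_def in_cbox_complex_iff)
      fix w assume w: "w \<in> frontier S"
      have wb: "2 \<le> Re w" "Re w \<le> 6" "\<eta> \<le> Im w" "Im w \<le> 1 - \<epsilon>"
        using w by (auto simp: S_def frontier_cbox in_cbox_complex_iff)
      consider "Im w = \<eta>" | "Re w = 2 \<or> Re w = 6 \<or> Im w = 1 - \<epsilon>"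
        using w by (auto simp: S_def frontier_cbox in_cbox_complex_iff in_box_complex_iff)
      then have "q (w + \<i> * \<epsilon>) \<le> exp (2 * \<kappa>) * exp (?P (Re w) (Im w))"
      proof cases
        case 1
        have "w + \<i> * \<epsilon> = Complex (Re w) (\<eta> + \<epsilon>)" using 1 by (simp add: complex_eq_iff)
        then have "q (w + \<i> * \<epsilon>) \<le> exp (Q (Re w, \<eta> + \<epsilon>))" by (simp add: Q_def)
        moreover have "Q (Re w, \<eta> + \<epsilon>) \<le> Q (Re w, \<epsilon>) + \<kappa>"
        proof -
          have "dist (Q (Re w, \<eta> + \<epsilon>)) (Q (Re w, \<epsilon>)) < \<kappa>"
            using wb \<eta> e y by (intro d(2)) (auto simp: dist_Pair_Pair dist_real_def)
          then show ?thesis by (auto simp: dist_real_def)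
        qed
        moreover have "Q (Re w, \<epsilon>) + \<kappa> \<le> 2 * \<kappa> + ?P (Re w) (Im w)"
          using \<eta>(4)[of "Re w"] wb 1 by (auto simp: Q_def \<psi>_def)
        ultimately have "q (w + \<i> * \<epsilon>) \<le> exp (2 * \<kappa> + ?P (Re w) (Im w))"
          by (meson exp_le_cancel_iff order_trans)
        then show ?thesis by (simp add: exp_add)
      next
        case 2
        have "q (w + \<i> * \<epsilon>) \<le> 1" using 2 wb \<eta> e by (intro qside) auto
        moreover have "0 \<le> ?P (Re w) (Im w)"
          unfolding poisson_integral_def using wb \<eta>
          by (intro integral_nonneg integrable_continuous_interval continuous_intros \<psi> continuous_on_poisson_kernel)
            (auto simp: poisson_kernel_nonneg \<psi>0)
        ultimately show ?thesis using \<kappa> by (smt (verit) exp_ge_add_one_self mult_exp_exp)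
      qed
      then have "75 * K * q (w + \<i> * \<epsilon>) * exp (- ?P (Re w) (Im w))
         \<le> 75 * K * (exp (2 * \<kappa>) * exp (?P (Re w) (Im w))) * exp (- ?P (Re w) (Im w))"
        using K by (intro mult_right_mono mult_left_mono) auto
      also have "\<dots> = 75 * K * exp (2 * \<kappa>)"
        by (simp add: mult.assoc flip: exp_add)
      finally show "norm (F w) \<le> 75 * K * exp (2 * \<kappa>)"
        using normF[of w] wb \<eta> by simp
    qed
    moreover have "Complex x y + \<i> * \<epsilon> = Complex x (y + \<epsilon>)" by (simp add: complex_eq_iff)
    ultimately have "75 * K * q (Complex x (y + \<epsilon>)) * exp (- ?P x y) \<le> 75 * K * exp (2 * \<kappa>)"
      using normF[of "Complex x y"] y by simp
    then show ?thesis using K by (simp add: exp_minus field_simps)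
  qed
  have "((\<lambda>\<kappa>. exp (2 * \<kappa>) * exp (?P x y)) \<longlongrightarrow> exp (2 * 0) * exp (?P x y)) (at_right 0)"
    by (intro tendsto_intros)
  then have "q (Complex x (y + \<epsilon>)) \<le> exp (2 * 0) * exp (?P x y)"
    by (rule tendsto_lowerbound) (auto intro!: eventually_at_rightI[of 0 1] appr)
  then show ?thesis by simp
qed

section \<open>The vertical maximal function\<close>

text \<open>Rational heights give a countable supremum, hence measurability; by continuity every
  height below 1 is still dominated. The cut at 1 is the top of the rectangle.\<close>

definition vertical_maximal :: "(complex \<Rightarrow> complex) \<Rightarrow> real \<Rightarrow> ennreal" where
  "vertical_maximal f x = (SUP y\<in>{y\<in>\<rat>. 0 < y \<and> y < 1}. ennreal (norm (f (Complex x y))))"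

lemma borel_measurable_holomorphic_line:
  assumes "f holomorphic_on upper_half_plane" "0 < y"
  shows "(\<lambda>x. f (Complex x y)) \<in> borel_measurable borel"
  using assms by (intro borel_measurable_continuous_onI continuous_on_upper_half_plane_compose[OF assms(1)] continuous_intros) auto

lemma borel_measurable_norm_holomorphic_line:
  assumes "f holomorphic_on upper_half_plane" "0 < y"
  shows "(\<lambda>x. ennreal (norm (f (Complex x y)))) \<in> borel_measurable borel"
proof -
  have "(\<lambda>x. norm (f (Complex x y))) \<in> borel_measurable borel"
    using assms by (intro borel_measurable_continuous_onI continuous_intros continuous_on_upper_half_plane_compose[OF assms(1)]) auto
  from measurable_compose[OF this measurable_ennreal] show ?thesis .
qed

lemma countable_rat_Collect: "countable {y::real. y \<in> \<rat> \<and> P y}"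
  using countable_rat by (rule countable_subset[rotated]) auto

lemma borel_measurable_vertical_maximal:
  assumes "f holomorphic_on upper_half_plane"
  shows "vertical_maximal f \<in> borel_measurable borel"
proof -
  have "(\<lambda>x. SUP y\<in>{y\<in>\<rat>. 0 < y \<and> y < 1}. ennreal (norm (f (Complex x y)))) \<in> borel_measurable borel"
    by (intro borel_measurable_SUP countable_rat_Collect borel_measurable_norm_holomorphic_line[OF assms]) auto
  then show ?thesis by (simp add: vertical_maximal_def[abs_def])
qed

lemma norm_le_vertical_maximal:
  assumes f: "f holomorphic_on upper_half_plane" and y: "0 < y" "y < 1"
  shows "ennreal (norm (f (Complex x y))) \<le> vertical_maximal f x"
proof (rule ccontr)
  assume "\<not> ?thesis"
  then have less: "vertical_maximal f x < ennreal (norm (f (Complex x y)))" by simp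
  have "continuous_on {0<..<1} (\<lambda>y. norm (f (Complex x y)))"
    by (intro continuous_intros continuous_on_upper_half_plane_compose[OF f]) auto
  then have "((\<lambda>y. norm (f (Complex x y))) \<longlongrightarrow> norm (f (Complex x y))) (at y)"
    using y by (simp add: continuous_on_eq_continuous_at isCont_def)
  then have "((\<lambda>y. ennreal (norm (f (Complex x y)))) \<longlongrightarrow> ennreal (norm (f (Complex x y)))) (at y)"
    by (intro tendsto_ennrealI)
  then have "\<forall>\<^sub>F t in at y. vertical_maximal f x < ennreal (norm (f (Complex x t)))"
    using less by (rule order_tendstoD)
  then obtain d where d: "0 < d" "\<And>t. \<lbrakk>t \<noteq> y; dist t y < d\<rbrakk> \<Longrightarrow> vertical_maximal f x < ennreal (norm (f (Complex x t)))"
    by (auto simp: eventually_at)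
  obtain t where t: "t \<in> \<rat>" "y < t" "t < min (y + d) 1"
    using Rats_dense_in_real[of y "min (y + d) 1"] d y by auto
  then have "vertical_maximal f x < ennreal (norm (f (Complex x t)))"
    by (intro d) (auto simp: dist_real_def)
  also have "\<dots> \<le> vertical_maximal f x"
    unfolding vertical_maximal_def using t y by (intro SUP_upper) auto
  finally show False by simp
qed

lemma poisson_integral_eq_nn_integral:
  assumes "0 < y" "continuous_on {a..b} g" "\<And>s. s \<in> {a..b} \<Longrightarrow> 0 \<le> g s"
  shows "ennreal (poisson_integral a b g x y)
    = (\<integral>\<^sup>+s. (ennreal (g s) * indicator {a..b} s) * ennreal (poisson_kernel y (x - s)) \<partial>lborel)"
proof -
  have "((\<lambda>s. poisson_kernel y (x - s) * g s) has_integral poisson_integral a b g x y) {a..b}"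
    unfolding poisson_integral_def
    by (intro integrable_integral integrable_continuous_interval continuous_intros continuous_on_poisson_kernel assms)
  from nn_integral_has_integral_lebesgue'[OF _ this]
  have "ennreal (poisson_integral a b g x y) = (\<integral>\<^sup>+s. ennreal (poisson_kernel y (x - s) * g s) * indicator {a..b} s \<partial>lborel)"
    using assms by (simp add: poisson_kernel_nonneg)
  also have "\<dots> = (\<integral>\<^sup>+s. (ennreal (g s) * indicator {a..b} s) * ennreal (poisson_kernel y (x - s)) \<partial>lborel)"
    using assms by (intro nn_integral_cong) (auto simp: indicator_def poisson_kernel_nonneg ennreal_mult mult.commute)
  finally show ?thesis .
qed

text \<open>The harmonic majorant starts from the line at height \<epsilon>, so only heights above
  \<epsilon> are reached; what matters is that the constant does not depend on \<epsilon>.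
  Rationality of \<epsilon> makes \<open>y - \<epsilon>\<close> an admissible height for the
  comparison with the maximal function.\<close>

lemma strip_maximal_above:
  assumes f: "strip_bounded f K" and K: "0 < K" and e: "0 < \<epsilon>" "\<epsilon> < 1" "\<epsilon> \<in> \<rat>"
  shows "(\<integral>\<^sup>+x\<in>{3..5}. (SUP y\<in>{y\<in>\<rat>. \<epsilon> < y \<and> y < 1}. ennreal (norm (f (Complex x y)))) \<partial>lborel) \<le> ennreal (216300 * K)"
proof -
  let ?S = "\<lambda>x. SUP y\<in>{y\<in>\<rat>. \<epsilon> < y \<and> y < 1}. ennreal (norm (f (Complex x y)))"
  have holf: "f holomorphic_on upper_half_plane" using f by (simp add: strip_bounded_def)
  define q where "q w = norm (f w * (w - 2) * (w - 6)) / (75 * K)" for w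
  define \<psi> where "\<psi> s = ln (max 1 (q (Complex s \<epsilon>)))" for s
  define g where "g s = exp (\<psi> s / 2) - 1" for s
  define v where "v s = ennreal (g s) * indicator {2..6} s" for s
  have q0: "0 \<le> q w" for w using K by (simp add: q_def)
  have \<psi>c: "continuous_on UNIV \<psi>"
    unfolding \<psi>_def q_def using e K by (intro continuous_intros continuous_on_upper_half_plane_compose[OF holf]) auto
  then have gc: "continuous_on UNIV g" unfolding g_def by (intro continuous_intros) auto
  then have [measurable]: "g \<in> borel_measurable borel" by (rule borel_measurable_continuous_onI)
  have \<psi>0: "0 \<le> \<psi> s" for s by (simp add: \<psi>_def)
  then have g0: "0 \<le> g s" for s by (simp add: g_def)
  have [measurable]: "v \<in> borel_measurable borel" unfolding v_def by measurable
  note [measurable] = borel_measurable_norm_holomorphic_line[OF holf e(1)]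
  \<comment> \<open>The square of \<open>g\<close> is at most \<open>q\<close>, and \<open>q\<close>
    is at most \<open>norm f / K\<close> on the line because both linear factors are at most 5
    there; the mean bound \<open>K\<close> then cancels.\<close>
  have vL2: "(\<integral>\<^sup>+s. (v s)\<^sup>2 \<partial>lborel) \<le> 1"
  proof -
    have "(\<integral>\<^sup>+s. (v s)\<^sup>2 \<partial>lborel) \<le> (\<integral>\<^sup>+s. ennreal (1 / K) * (ennreal (norm (f (Complex s \<epsilon>))) * indicator {1..8} s) \<partial>lborel)"
    proof (rule nn_integral_mono)
      fix s
      show "(v s)\<^sup>2 \<le> ennreal (1 / K) * (ennreal (norm (f (Complex s \<epsilon>))) * indicator {1..8} s)"
      proof (cases "s \<in> {2..6}")
        case True
        let ?w = "Complex s \<epsilon>"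
        have "norm (?w - 2) \<le> 5" "norm (?w - 6) \<le> 5"
          using cmod_le[of "?w - 2"] cmod_le[of "?w - 6"] True e by auto
        then have "norm (?w - 2) * norm (?w - 6) \<le> 5 * 5" by (rule mult_mono) auto
        then have "norm (f ?w) * (norm (?w - 2) * norm (?w - 6)) \<le> norm (f ?w) * 75"
          by (intro mult_left_mono) auto
        then have "norm (f ?w) * (norm (?w - 2) * norm (?w - 6)) / (75 * K) \<le> norm (f ?w) * 75 / (75 * K)"
          using K by (intro divide_right_mono) auto
        then have qle: "q ?w \<le> 1 / K * norm (f ?w)"
          by (simp add: q_def norm_mult mult.assoc)
        have "(g s)\<^sup>2 \<le> q ?w"
        proof (cases "q ?w \<le> 1")
          case True
          then show ?thesis using q0 by (simp add: g_def \<psi>_def max_def)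
        next
          case False
          then have "(exp (\<psi> s / 2))\<^sup>2 = q ?w"
            by (simp add: \<psi>_def max_def flip: exp_double)
          moreover have "(g s)\<^sup>2 \<le> (exp (\<psi> s / 2))\<^sup>2" using g0[of s] by (intro power_mono) (auto simp: g_def)
          ultimately show ?thesis by simp
        qed
        then have "(g s)\<^sup>2 \<le> 1 / K * norm (f ?w)" using qle by simp
        then have "ennreal ((g s)\<^sup>2) \<le> ennreal (1 / K * norm (f ?w))" by (rule ennreal_leI)
        then show ?thesis using True K g0[of s] by (simp add: v_def ennreal_power ennreal_mult[symmetric])
      qed (simp add: v_def)
    qed
    also have "\<dots> = ennreal (1 / K) * (\<integral>\<^sup>+s\<in>{1..8}. ennreal (norm (f (Complex s \<epsilon>))) \<partial>lborel)"
      by (rule nn_integral_cmult) measurable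
    also have "\<dots> \<le> ennreal (1 / K) * ennreal K"
      using f e by (intro mult_left_mono) (auto simp: strip_bounded_def)
    also have "\<dots> = 1" using K by (simp add: ennreal_mult[symmetric])
    finally show ?thesis .
  qed
  have pt: "ennreal (norm (f (Complex x y))) \<le> ennreal (75 * K) * (2 + 72 * (maximal_fn v x)\<^sup>2)"
    if x: "x \<in> {3..5}" and y: "y \<in> \<rat>" "\<epsilon> < y" "y < 1" for x y
  proof -
    define m where "m = poisson_integral 2 6 g x (y - \<epsilon>)"
    have m0: "0 \<le> m"
      unfolding m_def poisson_integral_def using y
      by (intro integral_nonneg integrable_continuous_interval continuous_intros continuous_on_poisson_kernel
          continuous_on_subset[OF gc] mult_nonneg_nonneg poisson_kernel_nonneg g0) auto
    let ?w = "Complex x y"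
    have "1 * 1 \<le> norm (?w - 2) * norm (?w - 6)"
      using complex_Re_le_cmod[of "?w - 2"] complex_Re_le_cmod[of "6 - ?w"] x
      by (intro mult_mono) (auto simp: norm_minus_commute)
    then have "norm (f ?w) * 1 \<le> norm (f ?w) * (norm (?w - 2) * norm (?w - 6))"
      by (intro mult_left_mono) auto
    also have "\<dots> = 75 * K * q ?w" using K by (simp add: q_def norm_mult)
    also have "q ?w \<le> exp (poisson_integral 2 6 \<psi> x (y - \<epsilon>))"
      using strip_harmonic_majorant[OF f K e(1), of x "y - \<epsilon>"] x y
      by (simp add: q_def[abs_def] \<psi>_def[abs_def])
    also have "\<dots> = (exp (poisson_integral 2 6 \<psi> x (y - \<epsilon>) / 2))\<^sup>2"
      by (simp flip: exp_double)
    also have "\<dots> \<le> (1 + m)\<^sup>2"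
      unfolding m_def g_def using y
      by (intro power_mono poisson_integral_jensen continuous_on_subset[OF \<psi>c] \<psi>0) auto
    also have "\<dots> \<le> 2 + 2 * m\<^sup>2"
      using sum_squares_bound[of 1 m] by (simp add: power2_sum)
    finally have "norm (f ?w) \<le> 75 * K * (2 + 2 * m\<^sup>2)"
      using K by (simp add: mult_left_mono)
    then have "ennreal (norm (f ?w)) \<le> ennreal (75 * K * (2 + 2 * m\<^sup>2))" by (rule ennreal_leI)
    also have "\<dots> = ennreal (75 * K) * (2 + 2 * (ennreal m)\<^sup>2)"
      using K m0 by (simp add: ennreal_mult ennreal_plus ennreal_power flip: ennreal_numeral)
    also have "ennreal m \<le> 6 * maximal_fn v x"
    proof -
      have "ennreal m = (\<integral>\<^sup>+s. v s * ennreal (poisson_kernel (y - \<epsilon>) (x - s)) \<partial>lborel)"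
        unfolding m_def v_def using y g0
        by (intro poisson_integral_eq_nn_integral continuous_on_subset[OF gc]) auto
      also have "\<dots> \<le> 6 * maximal_fn v x"
        using y e by (intro poisson_le_maximal_fn) auto
      finally show ?thesis .
    qed
    finally show ?thesis
      using K by (auto simp: power_mult_distrib mult_left_mono power_mono elim!: order_trans)
  qed
  have "(\<integral>\<^sup>+x\<in>{3..5}. ?S x \<partial>lborel)
    \<le> (\<integral>\<^sup>+x. ennreal (75 * K) * (2 * indicator {3..5} x + 72 * (maximal_fn v x)\<^sup>2) \<partial>lborel)"
  proof (rule nn_integral_mono)
    fix x
    have "?S x \<le> ennreal (75 * K) * (2 + 72 * (maximal_fn v x)\<^sup>2)"
      if "x \<in> {3..5}" using pt[OF that] by (intro SUP_least) auto
    then show "?S x * indicator {3..5} x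
       \<le> ennreal (75 * K) * (2 * indicator {3..5} x + 72 * (maximal_fn v x)\<^sup>2)"
      by (auto simp: indicator_def)
  qed
  \<comment> \<open>The constant is 75 * (2 * 2 + 72 * 40) = 216300: the interval has length 2, the
    factor 72 is 2 times the square of 6, and 40 comes from the square-integral bound.\<close>
  also have "\<dots> = ennreal (75 * K) * (2 * emeasure lborel {3..5::real} + 72 * (\<integral>\<^sup>+x. (maximal_fn v x)\<^sup>2 \<partial>lborel))"
    by (simp add: nn_integral_cmult nn_integral_add)
  also have "\<dots> \<le> ennreal (75 * K) * (2 * ennreal 2 + 72 * (40 * 1))"
    using order_trans[OF maximal_fn_L2[of v] mult_left_mono[OF vL2]]
    by (intro mult_left_mono add_mono) (auto simp: mult_left_mono)
  also have "\<dots> = ennreal (216300 * K)"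
    using K by (simp add: ennreal_mult[symmetric] ennreal_plus[symmetric] flip: ennreal_numeral)
  finally show ?thesis .
qed

lemma strip_maximal:
  assumes f: "strip_bounded f K" and K: "0 < K"
  shows "(\<integral>\<^sup>+x\<in>{3..5}. vertical_maximal f x \<partial>lborel) \<le> ennreal (216300 * K)"
proof -
  have holf: "f holomorphic_on upper_half_plane" using f by (simp add: strip_bounded_def)
  \<comment> \<open>The cut-offs \<open>1 / (n + 2)\<close> are rational, below 1 and decrease to 0,
    so the uniform estimate passes to all heights by monotone convergence.\<close>
  define S where "S n = {y::real. y \<in> \<rat> \<and> 1 / (real n + 2) < y \<and> y < 1}" for n
  define g where "g n x = (SUP y\<in>S n. ennreal (norm (f (Complex x y)))) * indicator {3..5} x" for n x
  have S: "(\<Union>n. S n) = {y\<in>\<rat>. 0 < y \<and> y < 1}"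
  proof (intro set_eqI iffI)
    fix y :: real assume "y \<in> (\<Union>n. S n)"
    then obtain n where "y \<in> \<rat>" "1 / (real n + 2) < y" "y < 1" by (auto simp: S_def)
    moreover have "0 < 1 / (real n + 2)" by simp
    ultimately have "0 < y" by (rule_tac less_trans)
    then show "y \<in> {y\<in>\<rat>. 0 < y \<and> y < 1}" using \<open>y \<in> \<rat>\<close> \<open>y < 1\<close> by auto
  next
    fix y :: real assume y: "y \<in> {y\<in>\<rat>. 0 < y \<and> y < 1}"
    then obtain n where "inverse (real (Suc n)) < y" using reals_Archimedean by auto
    moreover have "1 / (real n + 2) \<le> inverse (real (Suc n))" by (simp add: field_simps)
    ultimately have "y \<in> S n" using y by (auto simp: S_def)
    then show "y \<in> (\<Union>n. S n)" by auto
  qed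
  have Smono: "S m \<subseteq> S n" if "m \<le> n" for m n
  proof -
    have "1 / (real n + 2) \<le> 1 / (real m + 2)" using that by (intro divide_left_mono) auto
    then show ?thesis by (auto simp: S_def)
  qed
  have Spos: "0 < y" if "y \<in> S n" for y n using S that by blast
  have "vertical_maximal f x * indicator {3..5} x = (SUP n. g n x)" for x
  proof -
    have "vertical_maximal f x = (SUP n. SUP y\<in>S n. ennreal (norm (f (Complex x y))))"
      unfolding vertical_maximal_def S[symmetric] by (simp add: SUP_UNION)
    then show ?thesis unfolding g_def by (auto simp: indicator_def)
  qed
  then have "(\<integral>\<^sup>+x\<in>{3..5}. vertical_maximal f x \<partial>lborel) = (\<integral>\<^sup>+x. (SUP n. g n x) \<partial>lborel)" by simp
  also have "\<dots> = (SUP n. integral\<^sup>N lborel (g n))"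
  proof (rule nn_integral_monotone_convergence_SUP)
    show "incseq g"
      unfolding g_def by (intro monoI le_funI mult_right_mono SUP_subset_mono Smono) auto
    have "(\<lambda>x. SUP y\<in>S n. ennreal (norm (f (Complex x y)))) \<in> borel_measurable borel" for n
      by (intro borel_measurable_SUP borel_measurable_norm_holomorphic_line[OF holf] Spos)
         (auto simp: S_def intro: countable_rat_Collect)
    then show "g n \<in> borel_measurable lborel" for n unfolding g_def by measurable
  qed
  also have "\<dots> \<le> ennreal (216300 * K)"
  proof (rule SUP_least)
    fix n
    have "(1::real) / (real n + 2) = inverse (of_nat (n + 2))" by (simp add: field_simps)
    then have "1 / (real n + 2) \<in> \<rat>" by (simp only: Rats_inverse Rats_of_nat)
    then show "integral\<^sup>N lborel (g n) \<le> ennreal (216300 * K)"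
      unfolding g_def S_def by (intro strip_maximal_above[OF f K]) auto
  qed
  finally show ?thesis .
qed

section \<open>Differentiability of absolutely continuous functions\<close>

text \<open>The differentiation theorem used here concerns averages over intervals to the right of
  the point. Applying it also to \<open>h (- x)\<close> at \<open>- x\<close> supplies the left
  difference quotients.\<close>

lemma indefinite_integral_differentiable_AE:
  fixes F h :: "real \<Rightarrow> real"
  assumes F: "\<And>c d. c \<le> d \<Longrightarrow> (h has_integral F d - F c) {c..d}"
  obtains N where "negligible N" "\<And>x. x \<notin> N \<Longrightarrow> (F has_real_derivative h x) (at x)"
proof -
  have hi: "h integrable_on cbox c d" for c d
    using F[of c d] by (cases "c \<le> d") auto
  obtain N1 where N1: "negligible N1" "\<And>x e. \<lbrakk>x \<notin> N1; 0 < e\<rbrakk> \<Longrightarrow>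
      \<exists>d>0. \<forall>k. 0 < k \<and> k < d \<longrightarrow> norm (integral (cbox x (x + k *\<^sub>R One)) h /\<^sub>R k ^ DIM(real) - h x) < e"
    using integrable_ccontinuous_explicit[of h] hi by metis
  have hi': "(\<lambda>x. h (- x)) integrable_on cbox c d" for c d
    using hi[of "- d" "- c"] Henstock_Kurzweil_Integration.integrable_reflect_real[where f = h and a = "- d" and b = "- c"] by simp
  obtain N2 where N2: "negligible N2" "\<And>x e. \<lbrakk>x \<notin> N2; 0 < e\<rbrakk> \<Longrightarrow>
      \<exists>d>0. \<forall>k. 0 < k \<and> k < d \<longrightarrow> norm (integral (cbox x (x + k *\<^sub>R One)) (\<lambda>x. h (- x)) /\<^sub>R k ^ DIM(real) - h (- x)) < e"
    using integrable_ccontinuous_explicit[of "\<lambda>x. h (- x)"] hi' by metis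
  show ?thesis
  proof (rule that[of "N1 \<union> uminus ` N2"])
    show "negligible (N1 \<union> uminus ` N2)"
      using N1(1) N2(1) by (intro negligible_Un negligible_differentiable_image_negligible) (auto intro!: differentiable_on_minus differentiable_on_ident)
    fix x assume "x \<notin> N1 \<union> uminus ` N2"
    then have x: "x \<notin> N1" "- x \<notin> N2" by force+
    show "(F has_real_derivative h x) (at x)"
      unfolding DERIV_def
    proof (rule LIM_I)
      fix e :: real assume "0 < e"
      obtain d1 where d1: "d1 > 0" "\<And>k. \<lbrakk>0 < k; k < d1\<rbrakk> \<Longrightarrow> \<bar>integral {x..x + k} h / k - h x\<bar> < e"
        using N1(2)[OF x(1) \<open>0 < e\<close>] by (auto simp: divide_inverse mult.commute)
      obtain d2 where d2: "d2 > 0" "\<And>k. \<lbrakk>0 < k; k < d2\<rbrakk> \<Longrightarrow> \<bar>integral {-x..- x + k} (\<lambda>x. h (- x)) / k - h x\<bar> < e"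
        using N2(2)[OF x(2) \<open>0 < e\<close>] by (auto simp: divide_inverse mult.commute)
      show "\<exists>s>0. \<forall>k. k \<noteq> 0 \<and> norm (k - 0) < s \<longrightarrow> norm ((F (x + k) - F x) / k - h x) < e"
      proof (intro exI[of _ "min d1 d2"] conjI allI impI)
        fix k :: real assume k: "k \<noteq> 0 \<and> norm (k - 0) < min d1 d2"
        show "norm ((F (x + k) - F x) / k - h x) < e"
        proof (cases "0 < k")
          case True
          then show ?thesis
            using d1(2)[of k] k integral_unique[OF F[of x "x + k"]] by simp
        next
          case False
          with k have k': "0 < - k" "- k < d2" by auto
          have "integral {-x..- x + - k} (\<lambda>x. h (- x)) = integral {x + k..x} h"
            using Henstock_Kurzweil_Integration.integral_reflect_real[of x "x + k" h] by simp
          also have "\<dots> = F x - F (x + k)"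
            using F[of "x + k" x] k' by (simp add: integral_unique)
          finally have "integral {-x..- x + - k} (\<lambda>x. h (- x)) / - k = (F (x + k) - F x) / k"
            by (simp add: minus_divide_right[symmetric] flip: minus_divide_left) (simp add: diff_divide_distrib)
          then show ?thesis using d2(2)[OF k'] by simp
        qed
      qed (use d1 d2 in auto)
    qed
  qed
qed

lemma has_integral_Ioc_imp_Icc:
  fixes f :: "real \<Rightarrow> real"
  assumes "(f has_integral I) {c<..d}"
  shows "(f has_integral I) {c..d}"
proof -
  have "negligible {x \<in> {c<..d} - {c..d}. f x \<noteq> 0}" "negligible {x \<in> {c..d} - {c<..d}. f x \<noteq> 0}"
    by (rule negligible_subset[OF negligible_sing[of c]]; auto)+
  then show ?thesis using assms has_integral_spike_set_eq by blast
qed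

lemma has_integral_enn2real:
  fixes h :: "real \<Rightarrow> ennreal"
  assumes h[measurable]: "h \<in> borel_measurable lborel"
    and I: "(\<integral>\<^sup>+x\<in>{c<..d}. h x \<partial>lborel) = ennreal I" "0 \<le> I"
  shows "((\<lambda>x. enn2real (h x)) has_integral I) {c..d}"
proof (rule has_integral_Ioc_imp_Icc)
  have "AE x in lborel. h x * indicator {c<..d} x \<noteq> \<infinity>"
    using I by (intro nn_integral_PInf_AE) auto
  then have "(\<integral>\<^sup>+x. ennreal (enn2real (h x) * indicator {c<..d} x) \<partial>lborel) = (\<integral>\<^sup>+x\<in>{c<..d}. h x \<partial>lborel)"
    by (intro nn_integral_cong_AE) (auto simp: indicator_def less_top)
  then have "((\<lambda>x. enn2real (h x) * indicator {c<..d} x) has_integral I) UNIV"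
    using I h by (intro nn_integral_has_integral) (auto simp: indicator_def)
  also have "(\<lambda>x. enn2real (h x) * indicator {c<..d} x) = (\<lambda>x. if x \<in> {c<..d} then enn2real (h x) else 0)"
    by (auto simp: indicator_def)
  finally show "((\<lambda>x. enn2real (h x)) has_integral I) {c<..d}"
    by (simp only: has_integral_restrict_UNIV)
qed

text \<open>The Stieltjes measures of \<open>F1\<close> and \<open>F2\<close> add up to the measure with density \<open>m\<close>, so the first
  one is absolutely continuous.\<close>

lemma monotone_summand_differentiable_AE:
  fixes F1 F2 :: "real \<Rightarrow> real" and m :: "real \<Rightarrow> ennreal"
  assumes mono: "\<And>c d. c \<le> d \<Longrightarrow> F1 c \<le> F1 d" "\<And>c d. c \<le> d \<Longrightarrow> F2 c \<le> F2 d"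
    and cont: "continuous_on UNIV F1" "continuous_on UNIV F2"
    and m[measurable]: "m \<in> borel_measurable borel"
    and sum: "\<And>c d. c \<le> d \<Longrightarrow> (\<integral>\<^sup>+x\<in>{c<..d}. m x \<partial>lborel) = ennreal ((F1 d - F1 c) + (F2 d - F2 c))"
  obtains N where "negligible N" "\<And>x. x \<notin> N \<Longrightarrow> \<exists>D. (F1 has_real_derivative D) (at x)"
proof -
  let ?E = "range (\<lambda>(a, b). {a<..b::real})"
  define \<mu>1 where "\<mu>1 = interval_measure F1"
  define \<mu>2 where "\<mu>2 = interval_measure F2"
  define \<nu> where "\<nu> = measure_of UNIV (sets borel) (\<lambda>A. emeasure \<mu>1 A + emeasure \<mu>2 A)"
  have right: "continuous (at_right a) F1" "continuous (at_right a) F2" for a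
    using cont by (auto simp: continuous_on_eq_continuous_at intro: continuous_at_imp_continuous_at_within)
  have Ioc: "emeasure \<mu>1 {c<..d} = ennreal (F1 d - F1 c)" "emeasure \<mu>2 {c<..d} = ennreal (F2 d - F2 c)" if "c \<le> d" for c d
    unfolding \<mu>1_def \<mu>2_def using that by (auto intro!: emeasure_interval_measure_Ioc mono right)
  have sets\<mu>: "sets \<mu>1 = sets borel" "sets \<mu>2 = sets borel" by (simp_all add: \<mu>1_def \<mu>2_def)
  have sets\<nu>: "sets \<nu> = sets borel" unfolding \<nu>_def by (metis sets.sets_measure_of_eq space_borel)
  have em: "emeasure \<nu> A = emeasure \<mu>1 A + emeasure \<mu>2 A" if A: "A \<in> sets borel" for A
  proof (rule emeasure_measure_of[OF \<nu>_def])
    show "countably_additive (sets \<nu>) (\<lambda>A. emeasure \<mu>1 A + emeasure \<mu>2 A)"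
      unfolding countably_additive_def
    proof (intro allI impI)
      fix B :: "nat \<Rightarrow> real set" assume B: "range B \<subseteq> sets \<nu>" "disjoint_family B" "\<Union> (range B) \<in> sets \<nu>"
      have "(\<Sum>i. emeasure \<mu>1 (B i)) = emeasure \<mu>1 (\<Union> (range B))" "(\<Sum>i. emeasure \<mu>2 (B i)) = emeasure \<mu>2 (\<Union> (range B))"
        using B by (auto intro!: suminf_emeasure simp: sets\<mu> sets\<nu>)
      then show "(\<Sum>i. emeasure \<mu>1 (B i) + emeasure \<mu>2 (B i)) = emeasure \<mu>1 (\<Union> (range B)) + emeasure \<mu>2 (\<Union> (range B))"
        by (subst suminf_add[symmetric]) auto
    qed
  qed (use A in \<open>auto simp: sets\<nu> positive_def\<close>)
  \<comment> \<open>Half-open intervals form a generator stable under intersection and exhaust the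
    line with finite measure, so agreement on them suffices.\<close>
  have eq: "\<nu> = density lborel m"
  proof (rule measure_eqI_generator_eq[where E = "?E" and \<Omega> = UNIV and A = "\<lambda>i. {- real i<..real i}"])
    show "Int_stable ?E"
      by (auto simp: Int_stable_def)
    show "sets \<nu> = sigma_sets UNIV ?E"
      by (simp add: sets\<nu> borel_sigma_sets_Ioc)
    show "sets (density lborel m) = sigma_sets UNIV ?E"
      by (simp add: borel_sigma_sets_Ioc)
    show "emeasure \<nu> X = emeasure (density lborel m) X" if X0: "X \<in> ?E" for X
    proof -
      obtain p where "X = (case p of (a, b) \<Rightarrow> {a<..b::real})" using X0 by blast
      then obtain a b where X: "X = {a<..b}" by (cases p) auto
      show ?thesis
      proof (cases "a \<le> b")
        case True
        then have "emeasure \<nu> X = ennreal ((F1 b - F1 a) + (F2 b - F2 a))"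
          using mono[of a b] by (simp add: X em Ioc ennreal_plus)
        also have "\<dots> = emeasure (density lborel m) X"
          unfolding X using sum[OF True] by (subst emeasure_density) auto
        finally show ?thesis .
      qed (simp add: X)
    qed
    show "(\<Union>i. {- real i<..real i}) = UNIV"
    proof (intro equalityI subsetI)
      fix x :: real
      obtain n where "\<bar>x\<bar> < real n" using reals_Archimedean2 by blast
      then show "x \<in> (\<Union>i. {- real i<..real i})" by (intro UN_I[of n]) auto
    qed simp
    show "emeasure \<nu> {- real i<..real i} \<noteq> \<infinity>" for i
      by (simp add: em Ioc)
  qed auto
  have "absolutely_continuous lborel \<mu>1"
    unfolding absolutely_continuous_def
  proof
    fix A :: "real set" assume A: "A \<in> null_sets lborel"
    then have "emeasure \<nu> A = 0"
      unfolding eq using absolutely_continuousI_density[OF m[folded measurable_lborel2]]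
      by (auto simp: absolutely_continuous_def)
    then show "A \<in> null_sets \<mu>1"
      using A em[of A] by (auto simp: null_sets_def sets\<mu>)
  qed
  then obtain h where h[measurable]: "h \<in> borel_measurable lborel" and hd: "density lborel h = \<mu>1"
    using sigma_finite_measure.Radon_Nikodym[OF sigma_finite_lborel, of \<mu>1] sets\<mu> by auto
  have int: "((\<lambda>x. enn2real (h x)) has_integral F1 d - F1 c) {c..d}" if cd: "c \<le> d" for c d
  proof -
    have "(\<integral>\<^sup>+x\<in>{c<..d}. h x \<partial>lborel) = ennreal (F1 d - F1 c)"
      using Ioc(1)[OF cd] unfolding hd[symmetric] by (subst (asm) emeasure_density) auto
    then show ?thesis using mono(1)[OF cd] by (intro has_integral_enn2real) auto
  qed
  show ?thesis
    by (rule indefinite_integral_differentiable_AE[OF int]) (auto intro!: that)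
qed

text \<open>With \<open>M\<close> the indefinite integral of \<open>m\<close>, both
  \<open>M + u\<close> and \<open>M - u\<close> are increasing and their sum \<open>2 * M\<close> is
  absolutely continuous. Hence each summand is differentiable almost everywhere, and
  \<open>u\<close> is half their difference.\<close>

lemma dominated_increments_differentiable_AE:
  fixes u :: "real \<Rightarrow> real" and m :: "real \<Rightarrow> ennreal"
  assumes ab: "a \<le> b" and m[measurable]: "m \<in> borel_measurable borel"
    and fin: "(\<integral>\<^sup>+x\<in>{a..b}. m x \<partial>lborel) < \<infinity>"
    and u: "\<And>c d. \<lbrakk>a \<le> c; c \<le> d; d \<le> b\<rbrakk> \<Longrightarrow> ennreal \<bar>u d - u c\<bar> \<le> (\<integral>\<^sup>+x\<in>{c..d}. m x \<partial>lborel)"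
  obtains N where "negligible N" "\<And>x. \<lbrakk>x \<in> {a<..<b}; x \<notin> N\<rbrakk> \<Longrightarrow> \<exists>D. (u has_real_derivative D) (at x)"
proof -
  define m' where "m' x = m x * indicator {a..b} x" for x
  have [measurable]: "m' \<in> borel_measurable borel" unfolding m'_def by measurable
  let ?I = "\<lambda>c d. \<integral>\<^sup>+t\<in>{c<..d}. m' t \<partial>lborel"
  define M where "M x = enn2real (\<integral>\<^sup>+t\<in>{a<..x}. m' t \<partial>lborel)" for x
  \<comment> \<open>Clamping to [a, b] extends all functions to the line as constants outside the
    interval, as needed for Stieltjes measures on the line.\<close>
  define cl where "cl x = max a (min b x)" for x
  have m'fin: "(\<integral>\<^sup>+x\<in>A. m' x \<partial>lborel) < \<infinity>" for A
  proof -
    have "(\<integral>\<^sup>+x\<in>A. m' x \<partial>lborel) \<le> (\<integral>\<^sup>+x\<in>{a..b}. m x \<partial>lborel)"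
      by (intro nn_integral_mono) (auto simp: m'_def indicator_def)
    then show ?thesis using fin by simp
  qed
  have Mdiff: "0 \<le> M d - M c \<and> ennreal (M d - M c) = ?I c d" if "a \<le> c" "c \<le> d" for c d
  proof -
    have "?I a d = (\<integral>\<^sup>+t. m' t * indicator {a<..c} t + m' t * indicator {c<..d} t \<partial>lborel)"
      using that by (intro nn_integral_cong) (auto simp: indicator_def)
    also have "\<dots> = ?I a c + ?I c d"
      by (rule nn_integral_add) measurable
    finally have "ennreal (M d) = ennreal (M c) + ?I c d"
      using m'fin by (simp add: M_def)
    moreover obtain r where r: "0 \<le> r" "?I c d = ennreal r"
      using m'fin[of "{c<..d}"] by (metis less_top_ennreal infinity_ennreal_def)
    ultimately have "M d = M c + r"
      by (metis M_def add_nonneg_nonneg enn2real_ennreal enn2real_nonneg ennreal_plus)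
    then show ?thesis using r by simp
  qed
  have cl: "a \<le> cl x" "cl x \<le> b" "x \<le> y \<Longrightarrow> cl x \<le> cl y" "a \<le> x \<Longrightarrow> x \<le> b \<Longrightarrow> cl x = x" for x y
    using ab by (auto simp: cl_def)
  have Mcl: "ennreal (M (cl d) - M (cl c)) = ?I c d" if "c \<le> d" for c d
  proof -
    have "ennreal (M (cl d) - M (cl c)) = ?I (cl c) (cl d)"
      using Mdiff cl that by blast
    also have "\<dots> = ?I c d"
    proof (intro nn_integral_cong_AE)
      show "AE t in lborel. m' t * indicator {cl c<..cl d} t = m' t * indicator {c<..d} t"
        using AE_lborel_singleton[of a]
        by eventually_elim (auto simp: m'_def indicator_def cl_def)
    qed
    finally show ?thesis .
  qed
  have uM: "\<bar>u (cl d) - u (cl c)\<bar> \<le> M (cl d) - M (cl c)" if "c \<le> d" for c d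
  proof -
    have "ennreal \<bar>u (cl d) - u (cl c)\<bar> \<le> (\<integral>\<^sup>+x\<in>{cl c..cl d}. m x \<partial>lborel)"
      using u cl that by blast
    also have "\<dots> = (\<integral>\<^sup>+x\<in>{cl c<..cl d}. m' x \<partial>lborel)"
    proof (intro nn_integral_cong_AE)
      show "AE t in lborel. m t * indicator {cl c..cl d} t = m' t * indicator {cl c<..cl d} t"
        using AE_lborel_singleton[of "cl c"]
        by eventually_elim (use cl[of c] cl[of d] in \<open>auto simp: m'_def indicator_def\<close>)
    qed
    also have "\<dots> = ennreal (M (cl d) - M (cl c))"
      using Mdiff[of "cl c" "cl d"] cl that by simp
    finally have le: "ennreal \<bar>u (cl d) - u (cl c)\<bar> \<le> ennreal (M (cl d) - M (cl c))" .
    have "0 \<le> M (cl d) - M (cl c)"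
      using Mdiff[of "cl c" "cl d"] cl that by blast
    with le show ?thesis by (simp only: ennreal_le_iff)
  qed
  have Mcont: "continuous_on UNIV (\<lambda>x. M (cl x))"
  proof -
    have m'i: "(\<lambda>t. enn2real (m' t)) integrable_on cbox c d \<and> integral {c..d} (\<lambda>t. enn2real (m' t)) = M (cl d) - M (cl c)" if "c \<le> d" for c d
    proof -
      have "((\<lambda>x. enn2real (m' x)) has_integral M (cl d) - M (cl c)) {c..d}"
        using Mcl[OF that] uM[OF that] by (intro has_integral_enn2real) auto
      then show ?thesis by (auto simp: integral_unique)
    qed
    have "isCont (\<lambda>x. M (cl x)) x" for x
    proof -
      have "continuous_on {x - 1..x + 1} (\<lambda>t. integral {x - 1..t} (\<lambda>t. enn2real (m' t)))"
        using m'i[of "x - 1" "x + 1"] by (intro indefinite_integral_continuous_1) auto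
      then have "continuous_on {x - 1..x + 1} (\<lambda>t. integral {x - 1..t} (\<lambda>t. enn2real (m' t)) + M (cl (x - 1)))"
        by (intro continuous_intros)
      also have "?this \<longleftrightarrow> continuous_on {x - 1..x + 1} (\<lambda>t. M (cl t))"
        using m'i by (intro continuous_on_cong) auto
      finally have "continuous_on {x - 1<..<x + 1} (\<lambda>t. M (cl t))"
        by (rule continuous_on_subset) auto
      then show ?thesis by (simp add: continuous_on_eq_continuous_at)
    qed
    then show ?thesis by (simp add: continuous_on_eq_continuous_at)
  qed
  \<comment> \<open>Continuity of \<open>u\<close> is inherited from \<open>M\<close> through the
    domination of increments; it is needed because the Stieltjes measure has the expected interval
    values only for right-continuous functions.\<close>
  have ucont: "continuous_on UNIV (\<lambda>x. u (cl x))"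
    unfolding continuous_on_eq_continuous_at[OF open_UNIV]
  proof
    fix x
    have "((\<lambda>y. \<bar>M (cl y) - M (cl x)\<bar>) \<longlongrightarrow> \<bar>M (cl x) - M (cl x)\<bar>) (at x)"
      using Mcont by (intro tendsto_intros) (simp add: continuous_on_eq_continuous_at isCont_def)
    then have lim: "((\<lambda>y. \<bar>M (cl y) - M (cl x)\<bar>) \<longlongrightarrow> 0) (at x)" by simp
    have "\<bar>u (cl y) - u (cl x)\<bar> \<le> \<bar>M (cl y) - M (cl x)\<bar>" for y
      using uM[of x y] uM[of y x] by (cases "x \<le> y") (auto simp: abs_minus_commute)
    then have "((\<lambda>y. u (cl y) - u (cl x)) \<longlongrightarrow> 0) (at x)"
      by (intro Lim_null_comparison[OF _ lim] always_eventually) auto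
    then show "isCont (\<lambda>x. u (cl x)) x" by (simp add: isCont_def LIM_zero_iff)
  qed
  define F1 where "F1 x = M (cl x) + u (cl x)" for x
  define F2 where "F2 x = M (cl x) - u (cl x)" for x
  have mono: "F1 c \<le> F1 d" "F2 c \<le> F2 d" if "c \<le> d" for c d
    using uM[OF that] by (auto simp: F1_def F2_def)
  have cont: "continuous_on UNIV F1" "continuous_on UNIV F2"
    unfolding F1_def F2_def by (intro continuous_intros Mcont ucont)+
  have sum: "(\<integral>\<^sup>+x\<in>{c<..d}. 2 * m' x \<partial>lborel) = ennreal ((F1 d - F1 c) + (F2 d - F2 c))" if "c \<le> d" for c d
  proof -
    have "(\<integral>\<^sup>+x\<in>{c<..d}. 2 * m' x \<partial>lborel) = 2 * ennreal (M (cl d) - M (cl c))"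
      using Mcl[OF that] by (simp add: mult.assoc nn_integral_cmult)
    also have "\<dots> = ennreal (2 * (M (cl d) - M (cl c)))"
      using uM[OF that] by (subst ennreal_mult) auto
    also have "2 * (M (cl d) - M (cl c)) = (F1 d - F1 c) + (F2 d - F2 c)"
      by (simp add: F1_def F2_def)
    finally show ?thesis .
  qed
  obtain N1 where N1: "negligible N1" "\<And>x. x \<notin> N1 \<Longrightarrow> \<exists>D. (F1 has_real_derivative D) (at x)"
    by (rule monotone_summand_differentiable_AE[where ?F1.0 = F1 and ?F2.0 = F2 and m = "\<lambda>x. 2 * m' x"])
      (use mono cont sum in auto)
  obtain N2 where N2: "negligible N2" "\<And>x. x \<notin> N2 \<Longrightarrow> \<exists>D. (F2 has_real_derivative D) (at x)"
    by (rule monotone_summand_differentiable_AE[where ?F1.0 = F2 and ?F2.0 = F1 and m = "\<lambda>x. 2 * m' x"])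
      (use mono cont sum in \<open>auto simp: add.commute\<close>)
  show ?thesis
  proof (rule that[of "N1 \<union> N2"])
    show "negligible (N1 \<union> N2)" using N1 N2 by simp
    fix x assume x: "x \<in> {a<..<b}" "x \<notin> N1 \<union> N2"
    then obtain D1 D2 where "(F1 has_real_derivative D1) (at x)" "(F2 has_real_derivative D2) (at x)"
      using N1 N2 by blast
    then have "((\<lambda>x. (F1 x - F2 x) / 2) has_real_derivative (D1 - D2) / 2) (at x)"
      by (auto intro!: derivative_eq_intros)
    then have "(u has_real_derivative (D1 - D2) / 2) (at x)"
      by (rule has_field_derivative_transform_within_open[of _ _ _ "{a<..<b}"]) (use x cl in \<open>auto simp: F1_def F2_def\<close>)
    then show "\<exists>D. (u has_real_derivative D) (at x)" ..
  qed
qed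

section \<open>Existence of boundary values\<close>

text \<open>Cauchy's formula for the first derivative: the integrand splits into the difference
  quotient \<open>q\<close> over \<open>w - z\<close>, with removable singularity and
  \<open>q z\<close> the derivative, and a multiple of \<open>1 / (w - z)\<^sup>2\<close>, which has
  a primitive off \<open>z\<close>.\<close>

lemma contour_integral_rectpath_derivative:
  assumes S: "convex S" "open S" and u: "\<And>w. w \<in> S \<Longrightarrow> (u has_field_derivative u' w) (at w)"
    and box: "cbox a b \<subseteq> S" and z: "z \<in> box a b"
  shows "((\<lambda>w. u w / (w - z)\<^sup>2) has_contour_integral 2 * pi * \<i> * u' z) (rectpath a b)"
proof -
  let ?\<gamma> = "rectpath a b"
  have ab: "Re a < Re b" "Im a < Im b" using z by (auto simp: in_box_complex_iff)
  have zS: "z \<in> S" using z box box_subset_cbox by blast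
  have img: "path_image ?\<gamma> \<subseteq> S - {z}"
    using path_image_rectpath_cbox_minus_box[of a b] ab box z by auto
  have holu: "u holomorphic_on S" using u S by (auto simp: holomorphic_on_open)
  define q where "q w = (if w = z then deriv u z else (u w - u z) / (w - z))" for w
  have "q holomorphic_on S" unfolding q_def using holu S by (intro pole_lemma_open)
  from Cauchy_integral_formula_convex_simple[OF S(1) this _ _ img]
  have 1: "((\<lambda>w. q w / (w - z)) has_contour_integral 2 * pi * \<i> * u' z) ?\<gamma>"
    using winding_number_rectpath[OF z] zS S(2) DERIV_imp_deriv[OF u[OF zS]] by (simp add: interior_open q_def)
  have 2: "((\<lambda>w. u z / (w - z)\<^sup>2) has_contour_integral 0) ?\<gamma>"
  proof (rule Cauchy_theorem_primitive)
    show "((\<lambda>w. - u z / (w - z)) has_field_derivative u z / (w - z)\<^sup>2) (at w within - {z})" if "w \<in> - {z}" for w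
      using that by (auto intro!: derivative_eq_intros simp: power2_eq_square)
  qed (use img in auto)
  have "((\<lambda>w. q w / (w - z) + u z / (w - z)\<^sup>2) has_contour_integral 2 * pi * \<i> * u' z + 0) ?\<gamma>"
    by (intro has_contour_integral_add 1 2)
  then have "((\<lambda>w. u w / (w - z)\<^sup>2) has_contour_integral 2 * pi * \<i> * u' z + 0) ?\<gamma>"
  proof (rule has_contour_integral_eq)
    fix w assume "w \<in> path_image ?\<gamma>"
    then have "w \<noteq> z" using img by auto
    then show "q w / (w - z) + u z / (w - z)\<^sup>2 = u w / (w - z)\<^sup>2"
      by (simp add: q_def power2_eq_square diff_divide_distrib)
  qed
  then show ?thesis by simp
qed

text \<open>Subtracting the Cauchy integral for the reflected point \<open>cnj z\<close>, which vanishes, leaves a kernel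
  that is small of order \<open>y\<close> away from the bottom side and controlled by the Poisson kernel on it.\<close>

lemma derivative_bound_by_bottom_side:
  assumes G: "\<And>z. z \<in> upper_half_plane \<Longrightarrow> (G has_field_derivative f z) (at z)"
    and B: "\<And>x y. \<lbrakk>3 \<le> x; x \<le> 5; 0 < y; y < 1\<rbrakk> \<Longrightarrow> norm (G (Complex x y)) \<le> B"
    and d: "0 < d" "3 + d \<le> x0" "x0 + d \<le> 5" "d \<le> 1/4" and y: "0 < \<eta>" "\<eta> < y" "y < 1/4"
  shows "2 * pi * norm (f (Complex x0 (y + \<eta>))) \<le>
     integral {3..5} (\<lambda>s. norm (G (Complex s \<eta>)) * (4 * y * \<bar>s - x0\<bar> / ((s - x0)\<^sup>2 + y\<^sup>2)\<^sup>2)) + 36 * B * y / d ^ 4"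
proof -
  let ?k = "\<lambda>s. norm (G (Complex s \<eta>)) * (4 * y * \<bar>s - x0\<bar> / ((s - x0)\<^sup>2 + y\<^sup>2)\<^sup>2)"
  let ?c = "12 * y / d ^ 4"
  have B0: "0 \<le> B" using order_trans[OF norm_ge_zero B[of 3 "1/2"]] by simp
  \<comment> \<open>After the shift by \<eta> the function is holomorphic on a half-plane reaching
    below the real axis, so the rectangle may rest on the axis. Since \<eta> is less than
    \<open>y\<close>, the reflected point lies outside \<open>S\<close>, which is why its Cauchy
    integral vanishes.\<close>
  define S where "S = {w. - \<eta> < Im w}"
  define u where "u w = G (w + \<i> * \<eta>)" for w
  define z where "z = Complex x0 y"
  let ?a = "Complex 3 0" and ?b = "Complex 5 (1/2)"
  let ?\<gamma> = "rectpath ?a ?b"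
  have S: "convex S" "open S" by (auto simp: S_def convex_halfspace_Im_gt open_halfspace_Im_gt)
  have u: "(u has_field_derivative f (w + \<i> * \<eta>)) (at w)" if "w \<in> S" for w
    unfolding u_def using that G[of "w + \<i> * \<eta>"] by (simp add: DERIV_shift S_def upper_half_plane_def)
  have holu: "u holomorphic_on S" using u S by (auto simp: holomorphic_on_open)
  have box: "cbox ?a ?b \<subseteq> S" using y by (auto simp: S_def in_cbox_complex_iff)
  have zb: "z \<in> box ?a ?b" using d y by (auto simp: z_def in_box_complex_iff)
  have img: "path_image ?\<gamma> \<subseteq> cbox ?a ?b" by (rule path_image_rectpath_subset_cbox) auto
  have zne: "w \<noteq> z" "w \<noteq> cnj z" if "w \<in> path_image ?\<gamma>" for w
    using that img y zb path_image_rectpath_inter_box[of ?a ?b]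
    by (auto simp: z_def in_cbox_complex_iff)
  \<comment> \<open>On the real axis the modulus of this kernel is \<open>2 * pi\<close> times that
    of the derivative of the Poisson kernel at height \<open>y\<close>.\<close>
  define k where "k w = 4 * \<i> * y * (w - x0) / ((w - z)\<^sup>2 * (w - cnj z)\<^sup>2)" for w :: complex
  have k: "1 / (w - z)\<^sup>2 - 1 / (w - cnj z)\<^sup>2 = k w" if "w \<noteq> z" "w \<noteq> cnj z" for w
  proof -
    have "1 / (w - z)\<^sup>2 - 1 / (w - cnj z)\<^sup>2 = ((w - cnj z)\<^sup>2 - (w - z)\<^sup>2) / ((w - z)\<^sup>2 * (w - cnj z)\<^sup>2)"
      using that by (simp add: diff_frac_eq)
    also have "(w - cnj z)\<^sup>2 - (w - z)\<^sup>2 = 4 * \<i> * y * (w - x0)"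
    proof -
      have "z = x0 + \<i> * y" "cnj z = x0 - \<i> * y" by (simp_all add: z_def complex_eq_iff)
      then show ?thesis by (simp add: power2_eq_square algebra_simps)
    qed
    finally show ?thesis by (simp add: k_def)
  qed
  have 1: "((\<lambda>w. u w / (w - z)\<^sup>2) has_contour_integral 2 * pi * \<i> * f (z + \<i> * \<eta>)) ?\<gamma>"
    by (rule contour_integral_rectpath_derivative[OF S u box zb])
  have 2: "((\<lambda>w. u w / (w - cnj z)\<^sup>2) has_contour_integral 0) ?\<gamma>"
  proof (rule Cauchy_theorem_convex_simple[OF _ S(1)])
    have "cnj z \<notin> S" using y by (simp add: S_def z_def)
    then show "(\<lambda>w. u w / (w - cnj z)\<^sup>2) holomorphic_on S"
      by (intro holomorphic_intros holu) auto
  qed (use img box in auto)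
  define h where "h w = u w * k w" for w
  have "((\<lambda>w. u w / (w - z)\<^sup>2 - u w / (w - cnj z)\<^sup>2) has_contour_integral 2 * pi * \<i> * f (z + \<i> * \<eta>) - 0) ?\<gamma>"
    by (intro has_contour_integral_diff 1 2)
  then have "(h has_contour_integral 2 * pi * \<i> * f (z + \<i> * \<eta>) - 0) ?\<gamma>"
  proof (rule has_contour_integral_eq)
    fix w assume "w \<in> path_image ?\<gamma>"
    then show "u w / (w - z)\<^sup>2 - u w / (w - cnj z)\<^sup>2 = h w"
      using k[OF zne] by (simp add: h_def algebra_simps flip: k[OF zne])
  qed
  then have tot: "contour_integral ?\<gamma> h = 2 * pi * \<i> * f (z + \<i> * \<eta>)"
    by (simp add: contour_integral_unique)
  let ?a2 = "Complex 5 0" and ?a4 = "Complex 3 (1/2)"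
  have pim: "path_image ?\<gamma> = closed_segment ?a ?a2 \<union> closed_segment ?a2 ?b \<union> closed_segment ?b ?a4 \<union> closed_segment ?a4 ?a"
    by (simp add: rectpath_def Let_def path_image_join Un_assoc)
  have conth: "continuous_on (path_image ?\<gamma>) h"
    unfolding h_def k_def using img box zne
    by (intro continuous_intros holomorphic_on_imp_continuous_on[OF holomorphic_on_subset[OF holu]]) auto
  then have ci: "h contour_integrable_on linepath ?a ?a2" "h contour_integrable_on linepath ?a2 ?b"
     "h contour_integrable_on linepath ?b ?a4" "h contour_integrable_on linepath ?a4 ?a"
    by (auto intro!: contour_integrable_continuous_linepath intro: continuous_on_subset simp: pim)
  have split: "contour_integral ?\<gamma> h = contour_integral (linepath ?a ?a2) h + (contour_integral (linepath ?a2 ?b) h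
      + (contour_integral (linepath ?b ?a4) h + contour_integral (linepath ?a4 ?a) h))"
    using ci by (simp add: rectpath_def Let_def)
  \<comment> \<open>Off the bottom side both \<open>z\<close> and \<open>cnj z\<close> are at
    distance at least \<open>d\<close>, and \<open>w - x0\<close> has modulus at most 3, whence the
    12. The three sides have total length 1/2 + 2 + 1/2 = 3, which produces the 36.\<close>
  have side: "norm (contour_integral (linepath p p') h) \<le> B * ?c * norm (p' - p)"
    if p: "h contour_integrable_on linepath p p'" "closed_segment p p' \<subseteq> path_image ?\<gamma>"
      and pp: "\<And>w. w \<in> closed_segment p p' \<Longrightarrow> Re w = 3 \<or> Re w = 5 \<or> Im w = 1/2" for p p'
  proof (rule contour_integral_bound_linepath[OF p(1)])
    show "0 \<le> B * ?c" using B0 y d by simp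
    fix w assume w: "w \<in> closed_segment p p'"
    then have wb: "3 \<le> Re w" "Re w \<le> 5" "0 \<le> Im w" "Im w \<le> 1/2"
      using p(2) img by (auto simp: in_cbox_complex_iff)
    have uw: "norm (u w) \<le> B"
    proof -
      have "w + \<i> * \<eta> = Complex (Re w) (Im w + \<eta>)" by (simp add: complex_eq_iff)
      then show ?thesis unfolding u_def using B[of "Re w" "Im w + \<eta>"] wb y by simp
    qed
    have "d \<le> norm (w - z)" "d \<le> norm (w - cnj z)"
      using pp[OF w] abs_Re_le_cmod[of "w - z"] abs_Im_le_cmod[of "w - z"]
        abs_Re_le_cmod[of "w - cnj z"] abs_Im_le_cmod[of "w - cnj z"] d y wb
      by (auto simp: z_def)
    then have "d\<^sup>2 * d\<^sup>2 \<le> norm ((w - z)\<^sup>2 * (w - cnj z)\<^sup>2)"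
      unfolding norm_mult norm_power using d by (intro mult_mono power_mono) auto
    moreover have "norm (w - x0) \<le> 3"
      using cmod_le[of "w - x0"] wb d by auto
    then have "norm (4 * \<i> * y * (w - x0)) \<le> 12 * y"
      using y by (simp add: norm_mult)
    ultimately have "norm (k w) \<le> 12 * y / (d\<^sup>2 * d\<^sup>2)"
      unfolding k_def norm_divide using d y by (intro frac_le) auto
    then have "norm (k w) \<le> ?c" by (simp flip: power_add)
    then show "norm (h w) \<le> B * ?c"
      unfolding h_def norm_mult using uw B0 by (intro mult_mono) auto
  qed
  have sides: "norm (contour_integral (linepath ?a2 ?b) h) \<le> B * ?c * (1/2)"
      "norm (contour_integral (linepath ?b ?a4) h) \<le> B * ?c * 2"
      "norm (contour_integral (linepath ?a4 ?a) h) \<le> B * ?c * (1/2)"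
  proof -
    have n: "norm (?b - ?a2) = 1/2" "norm (?a4 - ?b) = 2" "norm (?a - ?a4) = 1/2"
      by (simp_all add: cmod_def)
    show "norm (contour_integral (linepath ?a2 ?b) h) \<le> B * ?c * (1/2)"
      using side[OF ci(2)] n by (auto simp: pim closed_segment_same_Re)
    show "norm (contour_integral (linepath ?b ?a4) h) \<le> B * ?c * 2"
      using side[OF ci(3)] n by (auto simp: pim closed_segment_same_Im)
    show "norm (contour_integral (linepath ?a4 ?a) h) \<le> B * ?c * (1/2)"
      using side[OF ci(4)] n by (auto simp: pim closed_segment_same_Re)
  qed
  have bottom: "norm (contour_integral (linepath ?a ?a2) h) \<le>
     integral {3..5} ?k"
  proof -
    have "contour_integral (linepath ?a ?a2) h = integral {3..5} (\<lambda>s. h (of_real s))"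
      by (subst contour_integral_linepath_Reals_eq) (auto simp: complex_is_Real_iff)
    also have "norm \<dots> \<le> integral {3..5} ?k"
    proof (rule integral_norm_bound_integral)
      have seg: "of_real s \<in> path_image ?\<gamma>" if "s \<in> {3..5}" for s :: real
        using that by (auto simp: pim closed_segment_same_Im closed_segment_eq_real_ivl)
      show "(\<lambda>s. h (of_real s)) integrable_on {3..5}"
        by (intro integrable_continuous_interval continuous_on_compose2[OF conth]) (auto intro!: continuous_intros seg)
      have "continuous_on {3..5} (\<lambda>s. G (Complex s \<eta>))"
        using y by (intro continuous_on_upper_half_plane_compose[of G] continuous_intros)
          (auto simp: holomorphic_on_open[OF open_upper_half_plane] intro!: exI G)
      then show "?k integrable_on {3..5}"
        using y by (intro integrable_continuous_interval continuous_intros) (auto simp: sum_power2_eq_zero_iff)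
      fix s :: real
      have "norm (of_real s - z) ^ 2 = (s - x0)\<^sup>2 + y\<^sup>2" "norm (of_real s - cnj z) ^ 2 = (s - x0)\<^sup>2 + y\<^sup>2"
        by (simp_all add: cmod_power2 z_def)
      moreover have "norm (complex_of_real s - x0) = \<bar>s - x0\<bar>"
        by (metis norm_of_real of_real_diff)
      ultimately have "norm (k s) = 4 * y * \<bar>s - x0\<bar> / ((s - x0)\<^sup>2 + y\<^sup>2)\<^sup>2"
        using y by (simp add: k_def norm_divide norm_mult norm_power power2_eq_square)
      moreover have "of_real s + \<i> * \<eta> = Complex s \<eta>" by (simp add: complex_eq_iff)
      ultimately show "norm (h (of_real s)) \<le> ?k s"
        by (simp add: h_def u_def norm_mult)
    qed
    finally show ?thesis .
  qed
  have "2 * pi * norm (f (Complex x0 (y + \<eta>))) = norm (contour_integral ?\<gamma> h)"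
  proof -
    have "z + \<i> * \<eta> = Complex x0 (y + \<eta>)" by (simp add: z_def complex_eq_iff)
    then show ?thesis unfolding tot by (simp add: norm_mult)
  qed
  also have "\<dots> \<le> norm (contour_integral (linepath ?a ?a2) h) + (norm (contour_integral (linepath ?a2 ?b) h)
      + (norm (contour_integral (linepath ?b ?a4) h) + norm (contour_integral (linepath ?a4 ?a) h)))"
    unfolding split by (intro order_trans[OF norm_triangle_ineq] add_mono order_refl)
  also have "\<dots> \<le> integral {3..5} ?k
     + (B * ?c * (1/2) + (B * ?c * 2 + B * ?c * (1/2)))"
    by (intro add_mono bottom sides)
  also have "B * ?c * (1/2) + (B * ?c * 2 + B * ?c * (1/2)) = 36 * B * y / d ^ 4"
    by (simp add: field_simps)
  finally show ?thesis .
qed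

lemma at_within_Ioo_at_right:
  fixes a b :: real
  assumes "a < b"
  shows "at a within {a<..<b} = at_right a"
  by (rule at_within_nhd[of _ "{..<b}"]) (use assms in auto)

text \<open>Fatou's theorem at a point where the primitive vanishes to first order: near
  \<open>x0\<close> the extra factor \<open>\<bar>s - x0\<bar>\<close> turns the differentiated
  kernel into a multiple of the Poisson kernel, of mass at most 1, with small coefficient;
  everything else is of order \<open>y\<close>.\<close>

lemma boundary_limit_of_flat_primitive:
  assumes G: "\<And>z. z \<in> upper_half_plane \<Longrightarrow> (G has_field_derivative f z) (at z)"
    and B: "\<And>x y. \<lbrakk>3 \<le> x; x \<le> 5; 0 < y; y < 1\<rbrakk> \<Longrightarrow> norm (G (Complex x y)) \<le> B"
    and lim: "\<And>x. x \<in> {3..5} \<Longrightarrow> ((\<lambda>y. G (Complex x y)) \<longlongrightarrow> Gs x) (at_right 0)"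
    and x0: "3 < x0" "x0 < 5"
    and flat: "\<And>\<kappa>. 0 < \<kappa> \<Longrightarrow> \<exists>\<delta>>0. \<forall>s\<in>{3..5}. \<bar>s - x0\<bar> < \<delta> \<longrightarrow> norm (Gs s) \<le> \<kappa> * \<bar>s - x0\<bar>"
  shows "((\<lambda>y. f (Complex x0 y)) \<longlongrightarrow> 0) (at_right 0)"
proof -
  have B0: "0 \<le> B" using order_trans[OF norm_ge_zero B[of 3 "1/2"]] by simp
  have holG: "G holomorphic_on upper_half_plane"
    unfolding holomorphic_on_open[OF open_upper_half_plane] using G by blast
  then have "deriv G holomorphic_on upper_half_plane"
    by (rule holomorphic_deriv[OF _ open_upper_half_plane])
  then have holf: "f holomorphic_on upper_half_plane"
    by (rule holomorphic_transform) (use G DERIV_imp_deriv in blast)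
  define d where "d = min (min (x0 - 3) (5 - x0)) (1/4)"
  have d: "0 < d" "3 + d \<le> x0" "x0 + d \<le> 5" "d \<le> 1/4" using x0 unfolding d_def by linarith+
  define k where "k y s = 4 * y * \<bar>s - x0\<bar> / ((s - x0)\<^sup>2 + y\<^sup>2)\<^sup>2" for y s :: real
  have kc: "continuous_on A (k y)" if "0 < y" for y A
    unfolding k_def using that by (intro continuous_intros) (auto simp: sum_power2_eq_zero_iff)
  have k0: "0 \<le> k y s" if "0 < y" for y s using that by (simp add: k_def)
  let ?J = "\<lambda>y. integral {3..5} (\<lambda>s. norm (Gs s) * k y s)"
  have main: "(\<lambda>s. norm (Gs s) * k y s) integrable_on {3..5} \<and>
     2 * pi * norm (f (Complex x0 y)) \<le> ?J y + 36 * B * y / d ^ 4"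
    if y: "0 < y" "y < 1/4" for y
  proof -
    \<comment> \<open>Heights in (0, y) tending to 0: dominated convergence moves the bottom side
      down to the boundary values \<open>Gs\<close>, with \<open>B * k y s\<close> as
      majorant.\<close>
    define \<eta> where "\<eta> n = y / (real n + 2)" for n
    have \<eta>: "0 < \<eta> n" "\<eta> n < y" for n using y by (auto simp: \<eta>_def divide_less_eq)
    have \<eta>0: "\<eta> \<longlonglongrightarrow> 0" unfolding \<eta>_def by real_asymp
    have \<eta>r: "filterlim \<eta> (at_right 0) sequentially"
    proof -
      have "\<eta> n \<noteq> 0" for n using \<eta>(1)[of n] by simp
      then show ?thesis using \<eta> \<eta>0 by (auto simp: filterlim_at)
    qed
    let ?g = "\<lambda>n s. norm (G (Complex s (\<eta> n))) * k y s"
    have i1: "?g n integrable_on {3..5}" for n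
      using \<eta> by (intro integrable_continuous_interval continuous_intros kc y
          continuous_on_upper_half_plane_compose[OF holG]) auto
    have i2: "(\<lambda>s. B * k y s) integrable_on {3..5}"
      by (intro integrable_continuous_interval continuous_intros kc y)
    have i3: "norm (?g n s) \<le> B * k y s" if "s \<in> {3..5}" for n s
      using B[of s "\<eta> n"] \<eta>[of n] y that k0[of y s] by (auto simp: abs_mult intro!: mult_right_mono)
    have i4: "(\<lambda>n. ?g n s) \<longlonglongrightarrow> norm (Gs s) * k y s" if "s \<in> {3..5}" for s
      by (intro tendsto_intros filterlim_compose[OF lim[OF that] \<eta>r])
    note dc = dominated_convergence[OF i1 i2 i3 i4]
    have "continuous_on {0<..} (\<lambda>t. f (Complex x0 t))"
      by (intro continuous_on_upper_half_plane_compose[OF holf] continuous_intros) auto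
    moreover have "(\<lambda>n. y + \<eta> n) \<longlonglongrightarrow> y" using tendsto_add[OF tendsto_const \<eta>0, of y] by simp
    ultimately have "(\<lambda>n. f (Complex x0 (y + \<eta> n))) \<longlonglongrightarrow> f (Complex x0 y)"
      using y \<eta> by (intro continuous_on_tendsto_compose[of "{0<..}" "\<lambda>t. f (Complex x0 t)"])
        (auto intro!: always_eventually add_pos_pos)
    then have "(\<lambda>n. 2 * pi * norm (f (Complex x0 (y + \<eta> n)))) \<longlonglongrightarrow> 2 * pi * norm (f (Complex x0 y))"
      by (intro tendsto_intros)
    moreover have "(\<lambda>n. integral {3..5} (?g n) + 36 * B * y / d ^ 4)
        \<longlonglongrightarrow> ?J y + 36 * B * y / d ^ 4"
      by (intro tendsto_intros dc)
    ultimately have "2 * pi * norm (f (Complex x0 y)) \<le> ?J y + 36 * B * y / d ^ 4"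
    proof (rule LIMSEQ_le)
      show "\<exists>N. \<forall>n\<ge>N. 2 * pi * norm (f (Complex x0 (y + \<eta> n)))
         \<le> integral {3..5} (?g n) + 36 * B * y / d ^ 4"
        using derivative_bound_by_bottom_side[OF G B d \<eta> y(2)] by (auto simp: k_def)
    qed
    with dc(1) show ?thesis by blast
  qed
  show ?thesis
  proof (rule tendstoI)
    fix e :: real assume e: "0 < e"
    \<comment> \<open>The fraction \<open>e / 4\<close> cancels the 4 in \<open>k\<close>, so the
      near part contributes at most \<open>pi * e\<close>, half of the allowance
      \<open>2 * pi * e\<close>.\<close>
    obtain \<delta> where \<delta>: "0 < \<delta>" "\<And>s. \<lbrakk>s \<in> {3..5}; \<bar>s - x0\<bar> < \<delta>\<rbrakk> \<Longrightarrow> norm (Gs s) \<le> e / 4 * \<bar>s - x0\<bar>"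
      using flat[of "e / 4"] e by auto
    \<comment> \<open>The first term is the part at distance at least \<delta>, bounded by
      \<open>4 * B * y / \<delta> ^ 3\<close> on an interval of length 2; the second comes from the
      other three sides.\<close>
    define C where "C = 8 * B / \<delta> ^ 3 + 36 * B / d ^ 4"
    have bound: "2 * pi * norm (f (Complex x0 y)) \<le> pi * e + C * y" if y: "0 < y" "y < 1/4" for y
    proof -
      have GsB: "norm (Gs s) \<le> B" if "s \<in> {3..5}" for s
      proof (rule tendsto_upperbound[OF tendsto_norm[OF lim[OF that]]])
        show "\<forall>\<^sub>F y in at_right 0. norm (G (Complex s y)) \<le> B"
          using that by (auto intro!: eventually_at_rightI[of 0 1] B)
      qed simp
      have "?J y \<le> integral {3..5} (\<lambda>s. e * pi * poisson_kernel y (x0 - s) + 4 * B * y / \<delta> ^ 3)"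
      proof (rule integral_le)
        show "(\<lambda>s. norm (Gs s) * k y s) integrable_on {3..5}" using main[OF y] by blast
        show "(\<lambda>s. e * pi * poisson_kernel y (x0 - s) + 4 * B * y / \<delta> ^ 3) integrable_on {3..5}"
          by (intro integrable_continuous_interval continuous_intros continuous_on_poisson_kernel y)
        fix s :: real assume s: "s \<in> {3..5}"
        define t where "t = \<bar>s - x0\<bar>"
        have t0: "0 \<le> t" by (simp add: t_def)
        have kt: "k y s = 4 * y * t / (t\<^sup>2 + y\<^sup>2)\<^sup>2" by (simp add: k_def t_def)
        have pt: "poisson_kernel y (x0 - s) = y / (pi * (t\<^sup>2 + y\<^sup>2))" by (simp add: poisson_kernel_def t_def power2_commute)
        have posd: "0 < t\<^sup>2 + y\<^sup>2" using y by (simp add: add_nonneg_pos)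
        show "norm (Gs s) * k y s \<le> e * pi * poisson_kernel y (x0 - s) + 4 * B * y / \<delta> ^ 3"
        proof (cases "t < \<delta>")
          case True
          then have "norm (Gs s) * k y s \<le> (e / 4 * t) * k y s"
            using \<delta>(2)[OF s] k0[OF y(1)] by (intro mult_right_mono) (auto simp: t_def)
          also have "\<dots> = e * y / (t\<^sup>2 + y\<^sup>2) * (t\<^sup>2 / (t\<^sup>2 + y\<^sup>2))"
            by (simp add: kt power2_eq_square)
          also have "\<dots> \<le> e * y / (t\<^sup>2 + y\<^sup>2) * 1"
            using e y posd by (intro mult_left_mono) auto
          also have "\<dots> = e * pi * poisson_kernel y (x0 - s)"
            by (simp add: pt)
          also have "\<dots> \<le> \<dots> + 4 * B * y / \<delta> ^ 3" using B0 y \<delta> by simp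
          finally show ?thesis .
        next
          case False
          then have tp: "\<delta> \<le> t" "0 < t" using \<delta> by auto
          have "\<delta> ^ 3 * t \<le> t ^ 3 * t" using tp \<delta> by (intro mult_right_mono power_mono) auto
          also have "\<dots> = (t\<^sup>2)\<^sup>2" by (simp flip: power_mult power_Suc2)
          also have "\<dots> \<le> (t\<^sup>2 + y\<^sup>2)\<^sup>2" by (intro power_mono) auto
          finally have "4 * y * t / (t\<^sup>2 + y\<^sup>2)\<^sup>2 \<le> 4 * y * t / (\<delta> ^ 3 * t)"
            using y tp \<delta> posd by (intro divide_left_mono mult_pos_pos zero_less_power) auto
          then have "k y s \<le> 4 * y / \<delta> ^ 3" using tp by (simp add: kt)
          then have "norm (Gs s) * k y s \<le> B * (4 * y / \<delta> ^ 3)"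
            using GsB[OF s] B0 k0[OF y(1)] by (intro mult_mono) auto
          moreover have "0 \<le> e * pi * poisson_kernel y (x0 - s)"
            using e poisson_kernel_nonneg[OF y(1)] by simp
          moreover have "B * (4 * y / \<delta> ^ 3) = 4 * B * y / \<delta> ^ 3" by simp
          ultimately show ?thesis by linarith
        qed
      qed
      also have "\<dots> = e * pi * integral {3..5} (\<lambda>s. poisson_kernel y (x0 - s)) + 8 * B * y / \<delta> ^ 3"
        using y by (subst integral_add) (auto intro!: integrable_continuous_interval continuous_intros continuous_on_poisson_kernel)
      also have "\<dots> \<le> e * pi * 1 + 8 * B * y / \<delta> ^ 3"
        using e y by (intro add_right_mono mult_left_mono poisson_kernel_integral_le_1) auto
      finally show ?thesis using main[OF y] by (simp add: C_def algebra_simps)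
    qed
    have "((\<lambda>y. C * y) \<longlongrightarrow> C * 0) (at_right 0)" by (intro tendsto_intros)
    then have "\<forall>\<^sub>F y in at_right 0. C * y < pi * e"
      using e by (intro order_tendstoD) auto
    moreover have "\<forall>\<^sub>F y::real in at_right 0. 0 < y \<and> y < 1/4"
      by (auto intro!: eventually_at_rightI[of 0 "1/4"])
    ultimately show "\<forall>\<^sub>F y in at_right 0. dist (f (Complex x0 y)) 0 < e"
    proof eventually_elim
      case (elim y)
      then have "2 * pi * norm (f (Complex x0 y)) < 2 * pi * e" using bound[of y] by linarith
      then show ?case by simp
    qed
  qed
qed

text \<open>Subtracting the affine function with value \<open>Gs x0\<close> and slope
  \<open>g\<close> at \<open>x0\<close> reduces the claim to the flat case, and its derivative
  shifts \<open>f\<close> by exactly \<open>g\<close>.\<close>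

lemma boundary_limit_at_derivative:
  assumes G: "\<And>z. z \<in> upper_half_plane \<Longrightarrow> (G has_field_derivative f z) (at z)"
    and B: "\<And>x y. \<lbrakk>3 \<le> x; x \<le> 5; 0 < y; y < 1\<rbrakk> \<Longrightarrow> norm (G (Complex x y)) \<le> B"
    and lim: "\<And>x. x \<in> {3..5} \<Longrightarrow> ((\<lambda>y. G (Complex x y)) \<longlongrightarrow> Gs x) (at_right 0)"
    and x0: "3 < x0" "x0 < 5" and D: "(Gs has_vector_derivative g) (at x0)"
  shows "((\<lambda>y. f (Complex x0 y)) \<longlongrightarrow> g) (at_right 0)"
proof -
  have "((\<lambda>y. f (Complex x0 y) - g) \<longlongrightarrow> 0) (at_right 0)"
  proof (rule boundary_limit_of_flat_primitive[where G = "\<lambda>w. G w - Gs x0 - g * (w - of_real x0)"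
        and f = "\<lambda>w. f w - g" and Gs = "\<lambda>x. Gs x - Gs x0 - g * (of_real x - of_real x0)" and B = "B + norm (Gs x0) + norm g * 3"])
    show "((\<lambda>w. G w - Gs x0 - g * (w - of_real x0)) has_field_derivative f z - g) (at z)" if "z \<in> upper_half_plane" for z
      using G[OF that] by (auto intro!: derivative_eq_intros)
    show "norm (G (Complex x y) - Gs x0 - g * (Complex x y - of_real x0)) \<le> B + norm (Gs x0) + norm g * 3"
      if "3 \<le> x" "x \<le> 5" "0 < y" "y < 1" for x y
    proof -
      have "norm (Complex x y - of_real x0) \<le> 3"
        using cmod_le[of "Complex x y - of_real x0"] that x0 by auto
      then have "norm (g * (Complex x y - of_real x0)) \<le> norm g * 3"
        unfolding norm_mult by (intro mult_left_mono) auto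
      then show ?thesis
        using B[OF that] norm_triangle_ineq4[of "G (Complex x y) - Gs x0" "g * (Complex x y - of_real x0)"]
          norm_triangle_ineq4[of "G (Complex x y)" "Gs x0"] by linarith
    qed
    show "((\<lambda>y. G (Complex x y) - Gs x0 - g * (Complex x y - of_real x0)) \<longlongrightarrow> Gs x - Gs x0 - g * (of_real x - of_real x0)) (at_right 0)"
      if "x \<in> {3..5}" for x
    proof -
      have "((\<lambda>y. of_real x + \<i> * of_real y) \<longlongrightarrow> of_real x + \<i> * of_real 0) (at_right 0)"
        by (intro tendsto_intros)
      then have "((\<lambda>y. Complex x y) \<longlongrightarrow> of_real x) (at_right 0)" by (simp add: Complex_eq)
      then show ?thesis by (intro tendsto_intros lim that)
    qed
    fix \<kappa> :: real assume "0 < \<kappa>"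
    then obtain \<delta> where \<delta>: "0 < \<delta>" "\<And>s. norm (s - x0) < \<delta> \<Longrightarrow> norm (Gs s - Gs x0 - (s - x0) *\<^sub>R g) \<le> \<kappa> * norm (s - x0)"
      using D by (auto simp: has_vector_derivative_def has_derivative_at_alt)
    show "\<exists>\<delta>>0. \<forall>s\<in>{3..5}. \<bar>s - x0\<bar> < \<delta> \<longrightarrow> norm (Gs s - Gs x0 - g * (of_real s - of_real x0)) \<le> \<kappa> * \<bar>s - x0\<bar>"
    proof (intro exI[of _ \<delta>] conjI ballI impI)
      fix s assume "\<bar>s - x0\<bar> < \<delta>"
      moreover have "(s - x0) *\<^sub>R g = g * (of_real s - of_real x0)"
        by (simp add: scaleR_conv_of_real)
      ultimately show "norm (Gs s - Gs x0 - g * (of_real s - of_real x0)) \<le> \<kappa> * \<bar>s - x0\<bar>"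
        using \<delta>(2)[of s] by simp
    qed (rule \<delta>(1))
  qed (use x0 in auto)
  then show ?thesis by (simp add: LIM_zero_iff)
qed

text \<open>By the maximal estimate a primitive of \<open>f\<close> extends to an absolutely continuous function on the
  boundary, whose derivative is the boundary value.\<close>

lemma strip_fatou:
  assumes f: "strip_bounded f K" and K: "0 < K"
  obtains N where "negligible N" "\<And>x. \<lbrakk>x \<in> {3<..<5}; x \<notin> N\<rbrakk> \<Longrightarrow> has_boundary_value f x"
proof -
  have holf: "f holomorphic_on upper_half_plane" using f by (simp add: strip_bounded_def)
  then obtain G where G: "\<And>z. z \<in> upper_half_plane \<Longrightarrow> (G has_field_derivative f z) (at z)"
    by (rule upper_half_plane_primitive) blast
  let ?H = "\<lambda>x y. G (Complex x y)"
  define M where "M = vertical_maximal f"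
  let ?J = "\<lambda>c d::real. \<integral>\<^sup>+x\<in>{c..d}. M x \<partial>lborel"
  have M[measurable]: "M \<in> borel_measurable borel"
    unfolding M_def by (rule borel_measurable_vertical_maximal[OF holf])
  have fin: "?J 3 5 < \<infinity>"
    using strip_maximal[OF f K] unfolding M_def by (simp add: order_le_less_trans)
  have incr: "ennreal (norm (?H d y - ?H c y)) \<le> ?J c d"
    if "c \<le> d" "0 < y" "y < 1" for c d y
  proof -
    have cont: "continuous_on {c..d} (\<lambda>x. f (Complex x y))"
      using that by (intro continuous_on_upper_half_plane_compose[OF holf] continuous_intros) auto
    have "norm (?H d y - ?H c y) = norm (integral {c..d} (\<lambda>x. f (Complex x y)))"
      using primitive_diff_horizontal[OF G, of y c d] that by (simp add: integral_unique)
    also have "\<dots> \<le> integral {c..d} (\<lambda>x. norm (f (Complex x y)))"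
      by (intro integral_norm_bound_integral integrable_continuous_interval continuous_intros cont order_refl)
    finally have "ennreal (norm (?H d y - ?H c y)) \<le> ennreal (integral {c..d} (\<lambda>x. norm (f (Complex x y))))"
      by (rule ennreal_leI)
    also have "\<dots> = (\<integral>\<^sup>+x\<in>{c..d}. ennreal (norm (f (Complex x y))) \<partial>lborel)"
      by (intro nn_integral_has_integral_lebesgue'[symmetric] integrable_integral integrable_continuous_interval
          continuous_intros cont) auto
    also have "\<dots> \<le> ?J c d"
      using norm_le_vertical_maximal[OF holf that(2,3)] unfolding M_def
      by (intro nn_integral_mono mult_right_mono) auto
    finally show ?thesis .
  qed
  \<comment> \<open>Where the maximal function is finite it bounds the vertical derivative of
    \<open>G\<close>, so \<open>G\<close> is Lipschitz along that vertical line.\<close>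
  have vert: "norm (?H x y' - ?H x y) \<le> enn2real (M x) * \<bar>y' - y\<bar>"
    if "M x < \<infinity>" "0 < y" "y < 1" "0 < y'" "y' < 1" for x y y'
  proof -
    have *: "norm (?H x b - ?H x a) \<le> enn2real (M x) * \<bar>b - a\<bar>" if ab: "a \<le> b" "0 < a" "b < 1" for a b
    proof -
      have le: "norm (f (Complex x t)) \<le> enn2real (M x)" if "t \<in> {a..b}" for t
      proof -
        have "ennreal (norm (f (Complex x t))) \<le> M x"
          unfolding M_def using that ab by (intro norm_le_vertical_maximal[OF holf]) auto
        then show ?thesis
          using \<open>M x < \<infinity>\<close> by (metis enn2real_ennreal enn2real_mono infinity_ennreal_def norm_ge_zero)
      qed
      have "norm (?H x b - ?H x a) \<le> enn2real (M x) * Henstock_Kurzweil_Integration.content (cbox a b)"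
        by (rule has_integral_bound[of _ "\<lambda>t. \<i> * f (Complex x t)"])
          (use primitive_diff_vertical[OF G ab(2,1), of x] le in \<open>auto simp: norm_mult\<close>)
      then show ?thesis using ab by simp
    qed
    show ?thesis
      using *[of y y'] *[of y' y] that by (cases "y \<le> y'") (auto simp: norm_minus_commute abs_minus_commute)
  qed
  define \<nu> where "\<nu> = density lborel (\<lambda>x. M x * indicator {3..5} x)"
  \<comment> \<open>The maximal function may be infinite at \<open>x\<close>, yet a limit of
    \<open>G\<close> is needed at every \<open>x\<close> of the interval. A nearby \<open>x'\<close>
    with finite maximal function serves instead: the horizontal detour costs at most the integral of
    \<open>M\<close> between the two points, which is small because the measure \<nu> has no
    atoms.\<close>
  have near: "\<exists>x'\<in>{3..5}. M x' < \<infinity> \<and> ?J (min x x') (max x x') < ennreal e"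
    if x: "x \<in> {3..5}" and e: "0 < e" for x e
  proof -
    define A where "A n = {x - 1 / (real n + 1)..x + 1 / (real n + 1)}" for n
    have em: "emeasure \<nu> S = (\<integral>\<^sup>+t. M t * indicator {3..5} t * indicator S t \<partial>lborel)" if "S \<in> sets borel" for S
      unfolding \<nu>_def using that by (intro emeasure_density) auto
    have "(\<lambda>n. emeasure \<nu> (A n)) \<longlonglongrightarrow> emeasure \<nu> (\<Inter>n. A n)"
    proof (rule Lim_emeasure_decseq)
      show "range A \<subseteq> sets \<nu>" by (auto simp: \<nu>_def A_def)
      show "decseq A"
        unfolding A_def by (intro decseq_SucI) (auto intro!: order_trans[OF _ diff_left_mono] order_trans[OF add_left_mono] divide_left_mono simp: field_simps)
      have "emeasure \<nu> (A n) \<le> ?J 3 5" for n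
        by (subst em) (auto simp: A_def indicator_def intro!: nn_integral_mono)
      then show "emeasure \<nu> (A n) \<noteq> \<infinity>" for n using fin by (metis leD)
    qed
    also have "(\<Inter>n. A n) = {x}"
    proof (intro equalityI subsetI)
      fix t assume t: "t \<in> (\<Inter>n. A n)"
      have "\<bar>t - x\<bar> \<le> 1 / (real n + 1)" for n using t by (auto simp: A_def abs_le_iff algebra_simps)
      then have "\<bar>t - x\<bar> \<le> 0"
        by (intro LIMSEQ_le_const[of "\<lambda>n. 1 / (real n + 1)"]) (auto, real_asymp)
      then show "t \<in> {x}" by simp
    qed (auto simp: A_def)
    also have "emeasure \<nu> {x} = 0"
      using AE_lborel_singleton[of x] by (subst em) (auto simp: nn_integral_0_iff_AE indicator_def elim!: eventually_mono)
    finally have "\<forall>\<^sub>F n in sequentially. emeasure \<nu> (A n) < ennreal e"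
      using e by (intro order_tendstoD) auto
    then obtain n where n: "emeasure \<nu> (A n) < ennreal e" by (auto dest: eventually_happens)
    have ae1: "AE t in lborel. M t * indicator {3..5} t \<noteq> \<infinity>"
      using fin by (intro nn_integral_PInf_AE) auto
    have notae: "\<not> (AE t in lborel. t \<notin> A n \<inter> {3..5})"
    proof
      assume ae: "AE t in lborel. t \<notin> A n \<inter> {3..5}"
      have N: "A n \<inter> {3..5} \<in> sets lborel" "{t \<in> space lborel. \<not> t \<notin> A n \<inter> {3..5}} = A n \<inter> {3..5}"
        by (auto simp: A_def)
      define p q where "p = max 3 (x - 1 / (real n + 1))" and "q = min 5 (x + 1 / (real n + 1))"
      have "p < q"
      proof -
        have "max 3 (x - r) < min 5 (x + r)" if "0 < r" for r using x that by auto
        then show ?thesis by (simp add: p_def q_def)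
      qed
      moreover have "A n \<inter> {3..5} = {p..q}" by (auto simp: A_def p_def q_def)
      moreover have "emeasure lborel (A n \<inter> {3..5}) = 0"
        using ae by (rule AE_iff_measurable[OF N, THEN iffD1])
      ultimately show False by simp
    qed
    have "\<exists>x'\<in>A n \<inter> {3..5}. M x' < \<infinity>"
    proof (rule ccontr)
      assume no: "\<not> ?thesis"
      have "AE t in lborel. t \<notin> A n \<inter> {3..5}"
        using ae1 by eventually_elim (use no in \<open>auto simp: less_top\<close>)
      with notae show False by contradiction
    qed
    then obtain x' where x': "x' \<in> A n \<inter> {3..5}" "M x' < \<infinity>" by blast
    have "?J (min x x') (max x x') \<le> emeasure \<nu> (A n)"
      using x x' by (subst em) (auto simp: A_def indicator_def intro!: nn_integral_mono)
    then show ?thesis using x' n by (auto intro: order_le_less_trans)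
  qed
  have incr2: "norm (?H x y - ?H x' y) < e"
    if "?J (min x x') (max x x') < ennreal e" "0 < y" "y < 1" for x x' y e
  proof -
    have "ennreal (norm (?H (max x x') y - ?H (min x x') y)) < ennreal e"
      by (rule order_le_less_trans[OF incr that(1)]) (use that in auto)
    then have "norm (?H (max x x') y - ?H (min x x') y) < e"
      by (simp add: ennreal_less_iff)
    then show ?thesis by (cases "x \<le> x'") (auto simp: norm_minus_commute max_def min_def)
  qed
  have "\<exists>l. ((\<lambda>y. ?H x y) \<longlongrightarrow> l) (at_right 0)" if x: "x \<in> {3..5}" for x
  proof -
    have "uniformly_continuous_on {0<..<1} (\<lambda>y. ?H x y)"
      unfolding uniformly_continuous_on_def
    proof (intro allI impI)
      fix e :: real assume "0 < e"
      then obtain x' where x': "M x' < \<infinity>" "?J (min x x') (max x x') < ennreal (e / 3)"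
        using near[OF x, of "e / 3"] by auto
      define L where "L = enn2real (M x') + 1"
      have L: "0 < L" "enn2real (M x') \<le> L" by (simp_all add: L_def add_nonneg_pos)
      show "\<exists>d>0. \<forall>y\<in>{0<..<1}. \<forall>y'\<in>{0<..<1}. dist y' y < d \<longrightarrow> dist (?H x y') (?H x y) < e"
      proof (intro exI[of _ "e / (3 * L)"] conjI ballI impI)
        fix y y' :: real assume y: "y \<in> {0<..<1}" "y' \<in> {0<..<1}" "dist y' y < e / (3 * L)"
        have "norm (?H x' y' - ?H x' y) \<le> enn2real (M x') * \<bar>y' - y\<bar>"
          using vert[OF x'(1)] y by auto
        also have "\<dots> \<le> L * \<bar>y' - y\<bar>" using L by (intro mult_right_mono) auto
        also have "\<dots> < L * (e / (3 * L))" using L y(3) by (intro mult_strict_left_mono) (auto simp: dist_real_def)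
        also have "\<dots> = e / 3" using L by simp
        finally have 1: "norm (?H x' y' - ?H x' y) < e / 3" .
        have 2: "norm (?H x y - ?H x' y) < e / 3" "norm (?H x y' - ?H x' y') < e / 3"
          using incr2[OF x'(2)] y by auto
        have "?H x y' - ?H x y = (?H x y' - ?H x' y') +
          (?H x' y' - ?H x' y) - (?H x y - ?H x' y)" by simp
        then have "norm (?H x y' - ?H x y) \<le> norm (?H x y' - ?H x' y') +
          norm (?H x' y' - ?H x' y) + norm (?H x y - ?H x' y)"
          by (metis norm_triangle_ineq norm_triangle_ineq4 add_right_mono order_trans)
        then show "dist (?H x y') (?H x y) < e"
          using 1 2 by (simp add: dist_norm)
      qed (use \<open>0 < e\<close> L in auto)
    qed
    then obtain l where "((\<lambda>y. ?H x y) \<longlongrightarrow> l) (at 0 within {0<..<1})"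
      by (rule uniformly_continuous_on_extension_at_closure[of _ _ 0]) auto
    then show ?thesis using at_within_Ioo_at_right[of 0 1] by auto
  qed
  then obtain Gs where Gs: "\<And>x. x \<in> {3..5} \<Longrightarrow> ((\<lambda>y. ?H x y) \<longlongrightarrow> Gs x) (at_right 0)" by metis
  have Gsincr: "ennreal (norm (Gs d - Gs c)) \<le> ?J c d" if "3 \<le> c" "c \<le> d" "d \<le> 5" for c d
  proof (rule tendsto_upperbound)
    show "((\<lambda>y. ennreal (norm (?H d y - ?H c y))) \<longlongrightarrow> ennreal (norm (Gs d - Gs c))) (at_right 0)"
      using that by (intro tendsto_ennrealI tendsto_intros Gs) auto
    show "\<forall>\<^sub>F y in at_right 0. ennreal (norm (?H d y - ?H c y)) \<le> ?J c d"
      using that by (auto intro!: eventually_at_rightI[of 0 1] incr)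
  qed simp
  obtain B where B: "\<And>x y. \<lbrakk>3 \<le> x; x \<le> 5; 0 < y; y < 1\<rbrakk> \<Longrightarrow> norm (?H x y) \<le> B"
  proof -
    obtain x' where x': "x' \<in> {3..5}" "M x' < \<infinity>" using near[of 4 1] by auto
    define r where "r = enn2real (?J 3 5) + 1"
    have r: "?J (min x x') (max x x') < ennreal r" if "x \<in> {3..5}" for x
    proof -
      have "?J (min x x') (max x x') \<le> ?J 3 5"
        using that x' by (intro nn_integral_mono) (auto simp: indicator_def)
      also have "\<dots> = ennreal (r - 1)" using fin by (simp add: r_def)
      also have "\<dots> < ennreal r" by (intro ennreal_lessI) (auto simp: r_def add_nonneg_pos)
      finally show ?thesis .
    qed
    show ?thesis
    proof (rule that[of "r + enn2real (M x') + norm (G (Complex x' (1/2)))"])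
      fix x y :: real assume xy: "3 \<le> x" "x \<le> 5" "0 < y" "y < 1"
      have 1: "norm (?H x y - ?H x' y) < r" using incr2[OF r, of x y] xy by auto
      have "norm (?H x' y - G (Complex x' (1/2))) \<le> enn2real (M x') * \<bar>y - 1/2\<bar>"
        using vert[OF x'(2)] xy by auto
      also have "\<dots> \<le> enn2real (M x') * 1" using xy by (intro mult_left_mono) auto
      finally have 2: "norm (?H x' y - G (Complex x' (1/2))) \<le> enn2real (M x')" by simp
      show "norm (?H x y) \<le> r + enn2real (M x') + norm (G (Complex x' (1/2)))"
        using 1 2 norm_triangle_sub[of "?H x y" "?H x' y"]
          norm_triangle_sub[of "?H x' y" "G (Complex x' (1/2))"] by linarith
    qed
  qed
  \<comment> \<open>The differentiation lemma is for real functions, so it is applied to the real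
    and imaginary parts, both of which are 1-Lipschitz.\<close>
  have part: "\<exists>N. negligible N \<and> (\<forall>x\<in>{3<..<5} - N. \<exists>D. ((\<lambda>x. h (Gs x)) has_real_derivative D) (at x))"
    if h: "\<And>z z'. \<bar>h z - h z'\<bar> \<le> norm (z - z')" for h :: "complex \<Rightarrow> real"
  proof -
    have "ennreal \<bar>h (Gs d) - h (Gs c)\<bar> \<le> ?J c d" if "3 \<le> c" "c \<le> d" "d \<le> 5" for c d
      by (rule order_trans[OF ennreal_leI[OF h] Gsincr[OF that]])
    then obtain N where "negligible N" "\<And>x. \<lbrakk>x \<in> {3<..<5}; x \<notin> N\<rbrakk> \<Longrightarrow> \<exists>D. ((\<lambda>x. h (Gs x)) has_real_derivative D) (at x)"
      by (rule dominated_increments_differentiable_AE[OF _ M fin, of "\<lambda>x. h (Gs x)", rotated]) auto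
    then show ?thesis by blast
  qed
  have "\<bar>Re z - Re z'\<bar> \<le> norm (z - z')" "\<bar>Im z - Im z'\<bar> \<le> norm (z - z')" for z z'
    using abs_Re_le_cmod[of "z - z'"] abs_Im_le_cmod[of "z - z'"] by auto
  then obtain N1 N2 where N1: "negligible N1" "\<forall>x\<in>{3<..<5} - N1. \<exists>D. ((\<lambda>x. Re (Gs x)) has_real_derivative D) (at x)"
    and N2: "negligible N2" "\<forall>x\<in>{3<..<5} - N2. \<exists>D. ((\<lambda>x. Im (Gs x)) has_real_derivative D) (at x)"
    using part[of Re] part[of Im] by blast
  show ?thesis
  proof (rule that[of "N1 \<union> N2"])
    show "negligible (N1 \<union> N2)" using N1 N2 by simp
    fix x assume x: "x \<in> {3<..<5}" "x \<notin> N1 \<union> N2"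
    then obtain D1 D2 where "((\<lambda>x. Re (Gs x)) has_real_derivative D1) (at x)" "((\<lambda>x. Im (Gs x)) has_real_derivative D2) (at x)"
      using N1 N2 by blast
    then have "((\<lambda>x. of_real (Re (Gs x)) + \<i> * of_real (Im (Gs x))) has_vector_derivative of_real D1 + \<i> * of_real D2) (at x)"
      by (intro has_vector_derivative_add has_vector_derivative_mult_right has_vector_derivative_of_real)
    then have "(Gs has_vector_derivative of_real D1 + \<i> * of_real D2) (at x)"
      by (simp flip: complex_eq)
    from boundary_limit_at_derivative[OF G B Gs _ _ this] x
    show "has_boundary_value f x" by (auto simp: has_boundary_value_def)
  qed
qed

section \<open>Weighted Hardy spaces\<close>

text \<open>Here \<tau> is \<open>1 / t\<close> for the integration variable \<open>t\<close>, so
  the constant becomes \<open>K * t powr w\<close>, the growth against which \<phi> is assumed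
  integrable.\<close>

definition dilation_bounded :: "(complex \<Rightarrow> complex) \<Rightarrow> real \<Rightarrow> real \<Rightarrow> bool" where
  "dilation_bounded f K w \<longleftrightarrow> (\<forall>\<tau>>0. strip_bounded (\<lambda>z. f (of_real \<tau> * z)) (K * \<tau> powr - w))"

lemma holomorphic_on_dilation:
  assumes "f holomorphic_on upper_half_plane" "0 < \<tau>"
  shows "(\<lambda>z. f (of_real \<tau> * z)) holomorphic_on upper_half_plane"
  using assms(2) by (intro holomorphic_on_compose_gen[OF _ assms(1), unfolded o_def] holomorphic_intros)
    (auto simp: upper_half_plane_def)

text \<open>The windows see only positive abscissas; reflection in the imaginary axis covers the
  negative ones, and the outer conjugation restores holomorphy.\<close>

definition reflected :: "(complex \<Rightarrow> complex) \<Rightarrow> complex \<Rightarrow> complex" where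
  "reflected f z = cnj (f (- cnj z))"

lemma reflected_Complex: "reflected f (Complex x y) = cnj (f (Complex (- x) y))"
proof -
  have "- cnj (Complex x y) = Complex (- x) y" by (simp add: complex_eq_iff)
  then show ?thesis by (simp add: reflected_def)
qed

lemma holomorphic_on_reflected:
  assumes "f holomorphic_on upper_half_plane"
  shows "reflected f holomorphic_on upper_half_plane"
proof -
  have "(\<lambda>z. f (- z)) holomorphic_on cnj ` upper_half_plane"
    by (intro holomorphic_on_compose_gen[OF _ assms, unfolded o_def] holomorphic_intros)
      (auto simp: upper_half_plane_def)
  from holomorphic_on_compose_cnj_cnj[OF this open_upper_half_plane]
  show ?thesis by (simp add: o_def reflected_def[abs_def])
qed

lemma hardy_norm_reflected:
  assumes f: "f holomorphic_on upper_half_plane"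
  shows "hardy_norm p \<alpha> (reflected f) = hardy_norm p \<alpha> f"
proof (cases "p = \<infinity>")
  case True
  have "(\<lambda>z. ennreal (norm (reflected f z))) ` upper_half_plane = (\<lambda>z. ennreal (norm (f z))) ` (\<lambda>z. - cnj z) ` upper_half_plane"
    by (simp add: image_image reflected_def)
  also have "(\<lambda>z. - cnj z) ` upper_half_plane = upper_half_plane"
  proof (intro equalityI subsetI)
    fix z assume "z \<in> upper_half_plane"
    then show "z \<in> (\<lambda>z. - cnj z) ` upper_half_plane"
      by (intro image_eqI[of _ _ "- cnj z"]) (auto simp: upper_half_plane_def)
  qed (auto simp: upper_half_plane_def)
  finally show ?thesis using True by (simp add: hardy_norm_def)
next
  case False
  have "(\<integral>\<^sup>+x. ennreal (norm (reflected f (Complex x y)) powr enn2real p * \<bar>x\<bar> powr \<alpha>) \<partial>lebesgue)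
      = (\<integral>\<^sup>+x. ennreal (norm (f (Complex x y)) powr enn2real p * \<bar>x\<bar> powr \<alpha>) \<partial>lebesgue)" if y: "y \<in> {0<..}" for y
  proof -
    have [measurable]: "(\<lambda>x. f (Complex x y)) \<in> borel_measurable borel"
      using y by (intro borel_measurable_holomorphic_line[OF f]) auto
    have "(\<integral>\<^sup>+x. ennreal (norm (f (Complex x y)) powr enn2real p * \<bar>x\<bar> powr \<alpha>) \<partial>lborel)
      = (\<integral>\<^sup>+x. ennreal (norm (f (Complex (- x) y)) powr enn2real p * \<bar>x\<bar> powr \<alpha>) \<partial>lborel)"
      by (subst nn_integral_real_affine[where c = "-1" and t = 0]) auto
    then show ?thesis by (simp add: reflected_Complex nn_integral_completion)
  qed
  then show ?thesis using False unfolding hardy_norm_def by (auto intro!: SUP_cong)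
qed

lemma hardy_space_reflected:
  "f \<in> hardy_space p \<alpha> \<Longrightarrow> reflected f \<in> hardy_space p \<alpha>"
  by (simp add: hardy_space_def hardy_norm_reflected holomorphic_on_reflected)

lemma enn2real_ge_1: "1 \<le> p \<Longrightarrow> p \<noteq> \<infinity> \<Longrightarrow> 1 \<le> enn2real p"
  using enn2real_mono[of 1 p] by (simp add: less_top)

lemma hardy_space_line_integral_bound:
  assumes f: "f \<in> hardy_space p \<alpha>" and p: "1 \<le> p" "p \<noteq> \<infinity>"
  obtains A where "0 < A" "\<And>y. 0 < y \<Longrightarrow>
     (\<integral>\<^sup>+x. ennreal (norm (f (Complex x y)) powr enn2real p * \<bar>x\<bar> powr \<alpha>) \<partial>lborel) \<le> ennreal (A powr enn2real p)"
\<comment> \<open>The added 1 keeps the constant positive when the norm is 0, since the normalising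
  height \<open>s\<close> built from it is later a divisor.\<close>
proof (rule that[of "enn2real (hardy_norm p \<alpha> f) + 1"])
  let ?P = "enn2real p"
  have P: "1 \<le> ?P" using p by (simp add: enn2real_ge_1)
  show "0 < enn2real (hardy_norm p \<alpha> f) + 1" by (simp add: add_nonneg_pos)
  fix y :: real assume y: "0 < y"
  define I where "I = (\<integral>\<^sup>+x. ennreal (norm (f (Complex x y)) powr ?P * \<bar>x\<bar> powr \<alpha>) \<partial>lborel)"
  have "ennreal_powr I (1 / ?P) \<le> hardy_norm p \<alpha> f"
    unfolding hardy_norm_def I_def using p y by (auto simp: nn_integral_completion intro!: SUP_upper2[of y])
  also have fin: "hardy_norm p \<alpha> f < \<infinity>" using f by (simp add: hardy_space_def)
  finally have "I \<noteq> \<infinity>" by (auto simp: ennreal_powr_def)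
  have "ennreal (enn2real I powr (1 / ?P)) \<le> hardy_norm p \<alpha> f"
    using \<open>ennreal_powr I (1 / ?P) \<le> hardy_norm p \<alpha> f\<close> \<open>I \<noteq> \<infinity>\<close> by (simp add: ennreal_powr_def)
  also have "hardy_norm p \<alpha> f = ennreal (enn2real (hardy_norm p \<alpha> f))" using fin by simp
  finally have "enn2real I powr (1 / ?P) \<le> enn2real (hardy_norm p \<alpha> f)" by simp
  then have "(enn2real I powr (1 / ?P)) powr ?P \<le> (enn2real (hardy_norm p \<alpha> f) + 1) powr ?P"
    using P by (intro powr_mono2) auto
  moreover have "(enn2real I powr (1 / ?P)) powr ?P = enn2real I"
    using P by (simp add: powr_powr)
  ultimately have "ennreal (enn2real I) \<le> ennreal ((enn2real (hardy_norm p \<alpha> f) + 1) powr ?P)"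
    by (intro ennreal_leI) simp
  moreover have "ennreal (enn2real I) = I"
    using \<open>I \<noteq> \<infinity>\<close> by (simp add: less_top)
  ultimately show "I \<le> ennreal ((enn2real (hardy_norm p \<alpha> f) + 1) powr ?P)"
    by (rule back_subst[of "\<lambda>x. x \<le> _"])
qed

text \<open>The inequality \<open>g \<le> s (1 + (g / s) powr p)\<close> replaces Hoelder's inequality; away from the
  origin the weight is bounded below.\<close>

lemma hardy_space_dilation_bounded:
  assumes p: "1 \<le> p" and f: "f \<in> hardy_space p \<alpha>"
  obtains K where "0 < K" "dilation_bounded f K (weight_exponent p \<alpha>)"
proof -
  let ?J = "\<lambda>\<tau> y::real. \<integral>\<^sup>+x\<in>{1..8}. ennreal (norm (f (of_real \<tau> * Complex x y))) \<partial>lborel"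
  have holf: "f holomorphic_on upper_half_plane" using f by (simp add: hardy_space_def)
  note hol = holomorphic_on_dilation[OF holf]
  have dil: "of_real \<tau> * Complex x y = Complex (\<tau> * x) (\<tau> * y)" for \<tau> x y
    by (simp add: complex_eq_iff)
  show ?thesis
  proof (cases "p = \<infinity>")
    case True
    define A where "A = enn2real (hardy_norm p \<alpha> f) + 1"
    have A: "norm (f z) \<le> A" if "z \<in> upper_half_plane" for z
    proof -
      have "ennreal (norm (f z)) \<le> hardy_norm p \<alpha> f"
        using True that by (auto simp: hardy_norm_def intro!: SUP_upper)
      also have "\<dots> = ennreal (enn2real (hardy_norm p \<alpha> f))"
        using f by (simp add: hardy_space_def)
      finally show ?thesis by (simp add: A_def)
    qed
    have A0: "0 < A" by (simp add: A_def add_nonneg_pos)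
    show ?thesis
    proof (rule that[of "7 * A"])
      show "dilation_bounded f (7 * A) (weight_exponent p \<alpha>)"
        unfolding dilation_bounded_def strip_bounded_def
      proof (intro allI impI conjI hol)
        fix \<tau> y :: real assume "0 < \<tau>" "0 < y"
        then have "?J \<tau> y \<le> (\<integral>\<^sup>+x. ennreal A * indicator {1..8::real} x \<partial>lborel)"
          by (intro nn_integral_mono) (auto simp: indicator_def dil intro!: ennreal_leI A)
        also have "\<dots> = ennreal (7 * A)"
          using A0 by (subst nn_integral_cmult_indicator) (auto simp: ennreal_mult[symmetric] mult.commute simp flip: ennreal_numeral)
        finally show "?J \<tau> y \<le> ennreal (7 * A * \<tau> powr - weight_exponent p \<alpha>)"
          using True \<open>0 < \<tau>\<close> by (simp add: weight_exponent_def)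
      qed
    qed (use A0 in simp)
  next
    case False
    let ?P = "enn2real p" and ?w = "weight_exponent p \<alpha>"
    have P: "1 \<le> ?P" using p False by (simp add: enn2real_ge_1)
    obtain A where A: "0 < A" "\<And>y. 0 < y \<Longrightarrow>
       (\<integral>\<^sup>+x. ennreal (norm (f (Complex x y)) powr ?P * \<bar>x\<bar> powr \<alpha>) \<partial>lborel) \<le> ennreal (A powr ?P)"
      using hardy_space_line_integral_bound[OF f p False] by blast
    \<comment> \<open>A lower bound for the weight on [1, 8]: the minimum sits at 1 for nonnegative
      \<alpha> and at 8 otherwise.\<close>
    define c where "c = min 1 (8 powr \<alpha>)"
    have c: "0 < c" by (simp add: c_def)
    have cle: "c \<le> \<bar>x\<bar> powr \<alpha>" if "x \<in> {1..8}" for x :: real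
    proof (cases "0 \<le> \<alpha>")
      case True
      then have "1 powr \<alpha> \<le> \<bar>x\<bar> powr \<alpha>" using that by (intro powr_mono2) auto
      then show ?thesis by (simp add: c_def min_le_iff_disj)
    next
      case False
      then have "8 powr \<alpha> \<le> \<bar>x\<bar> powr \<alpha>" using that by (intro powr_mono2') auto
      then show ?thesis by (simp add: c_def min_le_iff_disj)
    qed
    have wP: "?w * ?P = 1 + \<alpha>" using False P by (simp add: weight_exponent_def)
    show ?thesis
    proof (rule that[of "A * (7 + 1 / c)"])
      show "0 < A * (7 + 1 / c)" using A c by (simp add: add_pos_pos)
      show "dilation_bounded f (A * (7 + 1 / c)) ?w"
        unfolding dilation_bounded_def strip_bounded_def
      proof (intro allI impI conjI hol)
        fix \<tau> y :: real assume \<tau>: "0 < \<tau>" and y: "0 < y"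
        \<comment> \<open>This height is scaled so that
          \<open>s powr ?P * \<tau> powr \<alpha> * \<tau>\<close> equals \<open>A powr ?P\<close>.
          The two terms of the elementary inequality then become \<open>7 * s\<close> (the window
          has length 7) and \<open>s / c\<close>, both proportional to
          \<open>\<tau> powr - ?w\<close>.\<close>
        define s where "s = A * \<tau> powr - ?w"
        have s: "0 < s" using A \<tau> by (simp add: s_def)
        let ?q = "s / (s powr ?P * c * \<tau> powr \<alpha>)"
        define g where "g x = norm (f (Complex (\<tau> * x) (\<tau> * y)))" for x
        define h where "h x = ennreal (norm (f (Complex x (\<tau> * y))) powr ?P * \<bar>x\<bar> powr \<alpha>)" for x
        have [measurable]: "(\<lambda>x. f (Complex x (\<tau> * y))) \<in> borel_measurable borel"
          using \<tau> y by (intro borel_measurable_holomorphic_line[OF holf]) auto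
        have [measurable]: "h \<in> borel_measurable borel" unfolding h_def by measurable
        have pt: "ennreal (g x) * indicator {1..8} x
            \<le> ennreal s * indicator {1..8} x + ennreal ?q * h (0 + \<tau> * x)" for x
        proof (cases "x \<in> {1..8}")
          case True
          have g0: "0 \<le> g x" by (simp add: g_def)
          have "g x / s \<le> 1 + (g x / s) powr ?P"
          proof (cases "g x / s \<le> 1")
            case True
            then show ?thesis by (meson add_increasing2 powr_ge_zero)
          next
            case False
            then have "(g x / s) powr 1 \<le> (g x / s) powr ?P" using P by (intro powr_mono) auto
            then show ?thesis using False s g0 by simp
          qed
          then have "g x \<le> s + s * (g x / s) powr ?P" using s by (simp add: field_simps)
          also have "s * (g x / s) powr ?P = s / s powr ?P * g x powr ?P"
            using s g0 by (simp add: powr_divide)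
          also have "\<dots> \<le> s / s powr ?P * (g x powr ?P * (\<bar>x\<bar> powr \<alpha> / c))"
          proof -
            have "1 \<le> \<bar>x\<bar> powr \<alpha> / c" using cle[OF True] c by simp
            from mult_left_mono[OF this, of "g x powr ?P"] show ?thesis
              using s by (intro mult_left_mono) auto
          qed
          also have "\<dots> = ?q * (g x powr ?P * \<bar>\<tau> * x\<bar> powr \<alpha>)"
            using \<tau> by (simp add: abs_mult powr_mult)
          finally have "ennreal (g x) \<le> ennreal (s + ?q * (g x powr ?P * \<bar>\<tau> * x\<bar> powr \<alpha>))"
            by (rule ennreal_leI) simp
          also have "\<dots> = ennreal s + ennreal ?q * ennreal (g x powr ?P * \<bar>\<tau> * x\<bar> powr \<alpha>)"
            using s c by (subst ennreal_plus, simp, simp, subst ennreal_mult) auto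
          also have "ennreal (g x powr ?P * \<bar>\<tau> * x\<bar> powr \<alpha>) = h (0 + \<tau> * x)"
            by (simp add: h_def g_def)
          finally show ?thesis using True by simp
        qed simp
        have "ennreal \<tau> * (\<integral>\<^sup>+x. h (0 + \<tau> * x) \<partial>lborel) = (\<integral>\<^sup>+x. h x \<partial>lborel)"
          using \<tau> by (subst nn_integral_real_affine[where c = \<tau> and t = 0 and f = h]) auto
        also have "\<dots> \<le> ennreal (A powr ?P)" unfolding h_def using A(2)[of "\<tau> * y"] \<tau> y by simp
        finally have "ennreal (1 / \<tau>) * (ennreal \<tau> * (\<integral>\<^sup>+x. h (0 + \<tau> * x) \<partial>lborel)) \<le> ennreal (1 / \<tau>) * ennreal (A powr ?P)"
          by (rule mult_left_mono) simp
        then have hI: "(\<integral>\<^sup>+x. h (0 + \<tau> * x) \<partial>lborel) \<le> ennreal (A powr ?P / \<tau>)"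
          using \<tau> by (simp add: mult.assoc[symmetric] ennreal_mult[symmetric])
        have sP: "s powr ?P * \<tau> powr \<alpha> * \<tau> = A powr ?P"
        proof -
          have "s powr ?P = A powr ?P * \<tau> powr (- (1 + \<alpha>))"
            using A \<tau> by (simp add: s_def powr_mult powr_powr wP)
          moreover have "\<tau> powr (- (1 + \<alpha>)) * \<tau> powr \<alpha> * \<tau> powr 1 = 1"
            using \<tau> by (simp flip: powr_add)
          ultimately show ?thesis using \<tau> by simp
        qed
        have "(\<integral>\<^sup>+x. ennreal (g x) * indicator {1..8} x \<partial>lborel)
          \<le> (\<integral>\<^sup>+x. ennreal s * indicator {1..8} x + ennreal ?q * h (0 + \<tau> * x) \<partial>lborel)"
          by (intro nn_integral_mono pt)
        also have "\<dots> = ennreal s * ennreal 7 + ennreal ?q * (\<integral>\<^sup>+x. h (0 + \<tau> * x) \<partial>lborel)"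
          by (subst nn_integral_add) (auto simp: nn_integral_cmult_indicator nn_integral_cmult)
        also have "\<dots> \<le> ennreal s * ennreal 7 + ennreal ?q * ennreal (A powr ?P / \<tau>)"
          by (intro add_left_mono mult_left_mono hI) simp
        also have "\<dots> = ennreal (s * 7 + ?q * (A powr ?P / \<tau>))"
          using s c \<tau> by (subst ennreal_plus, simp, simp, subst (1 2) ennreal_mult) auto
        also have "?q * (A powr ?P / \<tau>) = s / c"
          using s c \<tau> by (simp add: sP[symmetric])
        also have "s * 7 + s / c = A * (7 + 1 / c) * \<tau> powr - ?w"
          by (simp add: s_def algebra_simps)
        finally show "?J \<tau> y \<le> ennreal (A * (7 + 1 / c) * \<tau> powr - ?w)"
          by (simp add: g_def dil)
      qed
    qed
  qed
qed

section \<open>Pointwise growth of the dilates\<close>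

lemma dilation_bounded_holomorphic:
  assumes "dilation_bounded f K w"
  shows "f holomorphic_on upper_half_plane"
  using assms[unfolded dilation_bounded_def, rule_format, of 1] by (simp add: strip_bounded_def)

text \<open>The dilation by \<open>x / 3\<close> moves the point to abscissa 3, inside the range
  where the strip estimate is pointwise.\<close>

lemma dilation_bounded_pointwise:
  assumes f: "dilation_bounded f K w" and K: "0 \<le> K" and x: "0 < x" and y: "0 < y"
  shows "norm (f (Complex x y)) \<le> 3 * K * (x / 3) powr - w / min (3 * y / x) 1"
proof -
  have "strip_bounded (\<lambda>z. f (of_real (x / 3) * z)) (K * (x / 3) powr - w)"
    using f x unfolding dilation_bounded_def by (metis divide_pos_pos zero_less_numeral)
  from strip_bounded_pointwise[OF this, of 3 "3 * y / x"]
  have "norm (f (of_real (x / 3) * Complex 3 (3 * y / x))) \<le> 3 * (K * (x / 3) powr - w) / min (3 * y / x) 1"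
    using K x y by simp
  moreover have "of_real (x / 3) * Complex 3 (3 * y / x) = Complex x y"
    using x by (simp add: complex_eq_iff)
  ultimately show ?thesis by (simp add: mult.assoc)
qed

lemma dilated_point_bound_right:
  assumes f: "dilation_bounded f K w" and K: "0 \<le> K" and z: "0 < Re z" "0 < Im z" and t: "0 < t"
  shows "norm (f (z / of_real t)) \<le> 3 * K * (Re z / 3) powr - w / min (3 * Im z / Re z) 1 * t powr w"
proof -
  have "z / of_real t = Complex (Re z / t) (Im z / t)" using t by (simp add: complex_eq_iff)
  then have "norm (f (z / of_real t)) \<le> 3 * K * (Re z / t / 3) powr - w / min (3 * (Im z / t) / (Re z / t)) 1"
    using dilation_bounded_pointwise[OF f K, of "Re z / t" "Im z / t"] z t by simp
  also have "(Re z / t / 3) powr - w = (Re z / 3) powr - w * t powr w"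
  proof -
    have "Re z / t / 3 = Re z / 3 / t" by simp
    then have "(Re z / t / 3) powr - w = (Re z / 3) powr - w / t powr - w" by (simp only: powr_divide)
    moreover have "X / t powr - w = X * t powr w" for X
      by (simp only: powr_minus divide_inverse inverse_inverse_eq)
    ultimately show ?thesis by (simp only:)
  qed
  also have "3 * (Im z / t) / (Re z / t) = 3 * Im z / Re z" using t by simp
  finally show ?thesis by (simp only: mult_ac times_divide_eq_right times_divide_eq_left)
qed

lemma norm_reflected: "norm (reflected f z) = norm (f (- cnj z))"
  by (simp add: reflected_def)

text \<open>On the imaginary axis no bound comes directly from the strips, so the maximum principle is applied
  on a disc after multiplication by a function that vanishes at the two boundary points on the axis.\<close>

lemma dilated_point_bound:
  assumes f: "dilation_bounded f K w" and rf: "dilation_bounded (reflected f) K w" and K: "0 \<le> K" and w: "0 \<le> w"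
    and z: "z \<in> upper_half_plane"
  obtains C where "\<And>t. 0 < t \<Longrightarrow> norm (f (z / of_real t)) \<le> C * t powr w"
proof -
  have imz: "0 < Im z" using z by (simp add: upper_half_plane_def)
  have holf: "f holomorphic_on upper_half_plane" by (rule dilation_bounded_holomorphic[OF f])
  have off: "norm (f (z / of_real t)) \<le> 3 * K * (\<bar>Re z\<bar> / 3) powr - w / min (3 * Im z / \<bar>Re z\<bar>) 1 * t powr w"
    if "Re z \<noteq> 0" "0 < Im z" "0 < t" for z t
  proof (cases "0 < Re z")
    case True
    then show ?thesis using dilated_point_bound_right[OF f K True that(2,3)] by simp
  next
    case False
    have "norm (f (z / of_real t)) = norm (reflected f ((- cnj z) / of_real t))"
      by (simp add: norm_reflected)
    also have "\<dots> \<le> 3 * K * (Re (- cnj z) / 3) powr - w / min (3 * Im (- cnj z) / Re (- cnj z)) 1 * t powr w"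
      using that False by (intro dilated_point_bound_right[OF rf K]) auto
    finally show ?thesis using that False by simp
  qed
  show ?thesis
  proof (cases "Re z = 0")
    case False
    show ?thesis by (rule that, rule off[OF False imz])
  next
    case True
    define r where "r = Im z / 2"
    have r: "0 < r" using imz by (simp add: r_def)
    \<comment> \<open>An integer at least \<open>w\<close>, so that a zero of order \<open>k\<close>
      outweighs the blow-up of order \<open>w\<close> at the imaginary axis; it is positive so that
      \<open>F\<close> really vanishes there.\<close>
    define k where "k = nat \<lceil>w\<rceil> + 1"
    have kw: "w \<le> real k" "0 < k" by (auto simp: k_def) linarith
    define C where "C = 3 * K * 3 powr w * (2 ^ k / r ^ k) * r powr (real k - w)"
    show ?thesis
    proof (rule that[of C])
      fix t :: real assume t: "0 < t"
      \<comment> \<open>The factor is 1 at the centre and vanishes at the two points of the circle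
        on the imaginary axis; on the circle it has modulus
        \<open>(2 * \<bar>Re v\<bar> / r) ^ k\<close>.\<close>
      define F where "F v = f (v / of_real t) * (1 + ((v - z) / of_real r)\<^sup>2) ^ k" for v
      have U: "0 < Im v" if "v \<in> cball z r" for v
        using that abs_Im_le_cmod[of "z - v"] r by (auto simp: dist_norm r_def)
      have holF: "F holomorphic_on {v. 0 < Im v}"
        unfolding F_def using t r
        by (intro holomorphic_intros holomorphic_on_compose_gen[OF _ holf, unfolded o_def])
          (auto simp: upper_half_plane_def)
      have "norm (F z) \<le> C * t powr w"
      proof (rule maximum_modulus_frontier[where S = "cball z r" and f = F])
        show "F holomorphic_on interior (cball z r)"
          using holF by (rule holomorphic_on_subset) (use U interior_subset in blast)
        show "continuous_on (closure (cball z r)) F"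
          using holomorphic_on_imp_continuous_on[OF holF] by (rule continuous_on_subset) (use U in auto)
        show "z \<in> cball z r" using r by simp
        fix v assume "v \<in> frontier (cball z r)"
        then have nv: "norm (v - z) = r" using r by (simp add: frontier_cball dist_norm norm_minus_commute)
        then have imv: "0 < Im v" using U[of v] by (simp add: dist_norm norm_minus_commute)
        define u where "u = (v - z) / of_real r"
        have "(v - z) * cnj (v - z) = of_real r * of_real r"
          using complex_norm_square[of "v - z"] nv by (simp add: power2_eq_square)
        then have "u * cnj u = 1"
          using r by (simp add: u_def)
        then have "1 + u\<^sup>2 = u * (cnj u + u)" by (simp add: power2_eq_square algebra_simps)
        also have "norm \<dots> = norm u * norm (cnj u + u)" by (rule norm_mult)
        also have "norm u = 1" using nv r by (simp add: u_def norm_divide)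
        also have "cnj u + u = of_real (2 * Re u)" by (simp add: complex_eq_iff)
        also have "norm (complex_of_real (2 * Re u)) = 2 * \<bar>Re v\<bar> / r"
          unfolding norm_of_real using True r by (simp add: u_def abs_mult)
        finally have nu: "norm (1 + u\<^sup>2) = 2 * \<bar>Re v\<bar> / r" by simp
        show "norm (F v) \<le> C * t powr w"
        proof (cases "Re v = 0")
          case True
          then have "1 + u\<^sup>2 = 0" using nu by simp
          then have "F v = 0" using kw by (simp add: F_def u_def)
          then show ?thesis using K r t by (simp add: C_def)
        next
          case False
          define x where "x = \<bar>Re v\<bar>"
          have x: "0 < x" "x \<le> r" using False nv abs_Re_le_cmod[of "v - z"] True by (auto simp: x_def)
          \<comment> \<open>The centre has height \<open>2 * r\<close>, so heights on the circle are
            at least \<open>r\<close> and the abscissa does not exceed them. The minimum in the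
            off-axis bound is therefore 1, leaving only the power of \<open>x\<close>.\<close>
          have "Im z - Im v \<le> r" using nv abs_Im_le_cmod[of "v - z"] by auto
          then have "x \<le> Im v" using x by (simp add: r_def)
          then have "1 \<le> 3 * Im v / \<bar>Re v\<bar>" using x by (simp add: x_def)
          then have "norm (f (v / of_real t)) \<le> 3 * K * (x / 3) powr - w * t powr w"
            using off[OF False imv t] by (simp add: x_def min_def split: if_splits)
          moreover have "(x / 3) powr - w = 3 powr w * x powr - w"
            using x by (simp add: powr_divide powr_minus field_simps)
          ultimately have fv: "norm (f (v / of_real t)) \<le> 3 * K * 3 powr w * x powr - w * t powr w"
            by (simp add: mult.assoc)
          have "norm (F v) = norm (f (v / of_real t)) * (2 * x / r) ^ k"
            unfolding F_def norm_mult norm_power u_def[symmetric] nu x_def by simp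
          also have "\<dots> \<le> (3 * K * 3 powr w * x powr - w * t powr w) * (2 * x / r) ^ k"
            using fv x r by (intro mult_right_mono) auto
          also have "\<dots> = 3 * K * 3 powr w * (2 ^ k / r ^ k) * (x powr - w * x ^ k) * t powr w"
            by (simp add: power_divide power_mult_distrib)
          also have "\<dots> \<le> 3 * K * 3 powr w * (2 ^ k / r ^ k) * r powr (real k - w) * t powr w"
          proof -
            have "x powr - w * x ^ k = x powr (real k - w)"
              using x by (simp add: powr_realpow[symmetric] powr_add[symmetric])
            also have "\<dots> \<le> r powr (real k - w)"
              using x kw by (intro powr_mono2) auto
            finally show ?thesis
              using K r by (intro mult_right_mono mult_left_mono) auto
          qed
          finally show ?thesis by (simp add: C_def)
        qed
      qed simp
      then show "norm (f (z / of_real t)) \<le> C * t powr w" by (simp add: F_def)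
    qed
  qed
qed

section \<open>The Hausdorff operator near the boundary\<close>

text \<open>Holomorphy says nothing about values outside the half-plane; this version is Borel on
  the whole plane, as Tonelli's theorem and the integrals over all real \<open>t\<close>
  require.\<close>

definition zero_extension :: "(complex \<Rightarrow> complex) \<Rightarrow> complex \<Rightarrow> complex" where
  "zero_extension f z = (if 0 < Im z then f z else 0)"

lemma borel_measurable_zero_extension:
  assumes "f holomorphic_on upper_half_plane"
  shows "zero_extension f \<in> borel_measurable borel"
proof -
  have "(\<lambda>z. indicator upper_half_plane z *\<^sub>R f z) \<in> borel_measurable borel"
    by (intro borel_measurable_continuous_on_indicator holomorphic_on_imp_continuous_on assms)
      (use open_upper_half_plane in simp)
  also have "(\<lambda>z. indicator upper_half_plane z *\<^sub>R f z) = zero_extension f"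
    by (auto simp: zero_extension_def upper_half_plane_def indicator_def)
  finally show ?thesis .
qed

lemma borel_measurable_powr_times_norm:
  assumes [measurable]: "\<Phi> \<in> borel_measurable lebesgue"
  shows "(\<lambda>t::real. t powr w * norm (\<Phi> t :: complex)) \<in> borel_measurable lebesgue"
proof -
  have [measurable]: "(\<lambda>t::real. t) \<in> borel_measurable lebesgue" by (simp add: measurable_completion)
  show ?thesis by measurable
qed

text \<open>In what follows \<open>\<Phi> t\<close> stands for \<open>\<phi> t / t\<close>, extended by \<open>0\<close> to the non-positive axis.\<close>

definition dominated_near_boundary :: "(real \<Rightarrow> complex) \<Rightarrow> (complex \<Rightarrow> complex) \<Rightarrow> real \<Rightarrow> bool" where
  "dominated_near_boundary \<Phi> f x \<longleftrightarrow> (\<exists>\<delta>>0. \<exists>D. integrable lebesgue D \<and>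
     (\<forall>y. 0 < y \<and> y < \<delta> \<longrightarrow> (AE t in lebesgue. norm (f (Complex x y / of_real t) * \<Phi> t) \<le> D t)))"

text \<open>The maximal estimate for the dilate by \<open>1 / t\<close> has constant proportional to
  \<open>t powr w\<close>. Integrated against \<open>norm (\<Phi> t)\<close> it stays finite, so for
  almost every \<open>x\<close> the product of the maximal function in \<open>t\<close> and
  \<open>norm (\<Phi> t)\<close> is an integrable majorant, valid for all heights below 1.\<close>

lemma dominated_near_boundary_strip:
  assumes f: "dilation_bounded f K w" and K: "0 < K"
    and \<Phi>: "\<Phi> \<in> borel_measurable lebesgue" "\<And>t. t \<le> 0 \<Longrightarrow> \<Phi> t = 0"
    and fin: "(\<integral>\<^sup>+t. ennreal (t powr w * norm (\<Phi> t)) \<partial>lebesgue) < \<infinity>"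
  shows "negligible {x \<in> {3<..<5}. \<not> dominated_near_boundary \<Phi> f x}"
proof -
  have holf: "f holomorphic_on upper_half_plane" by (rule dilation_bounded_holomorphic[OF f])
  have meas: "(\<lambda>t. ennreal (t powr w * norm (\<Phi> t))) \<in> borel_measurable lebesgue"
    using measurable_compose[OF borel_measurable_powr_times_norm[OF \<Phi>(1)] measurable_ennreal] .
  note [measurable] = borel_measurable_zero_extension[OF holf]
  have "(\<lambda>t. norm (\<Phi> t)) \<in> borel_measurable lebesgue" using \<Phi>(1) by measurable
  \<comment> \<open>Tonelli's theorem is applied to the Borel product, so the merely Lebesgue
    measurable modulus is first replaced by a Borel function equal to it almost everywhere.\<close>
  then obtain \<psi> where \<psi>[measurable]: "\<psi> \<in> borel_measurable lborel" and \<psi>eq: "AE t in lborel. norm (\<Phi> t) = \<psi> t"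
    using completion_ex_borel_measurable_real by blast
  define S where "S x t = (SUP y\<in>{y\<in>\<rat>. 0 < y \<and> y < 1}. ennreal (norm (zero_extension f (Complex (x / t) (y / t)))))" for x t
  let ?T = "\<lambda>x t. S x t * indicator {3..5} x * (ennreal (\<psi> t) * indicator {0<..} t)"
  have S_meas[measurable]: "(\<lambda>(x, t). S x t) \<in> borel_measurable (borel \<Otimes>\<^sub>M borel)"
  proof -
    have "(\<lambda>p. SUP y\<in>{y\<in>\<rat>. 0 < y \<and> y < 1}. ennreal (norm (zero_extension f (Complex (fst p / snd p) (y / snd p)))))
        \<in> borel_measurable (borel \<Otimes>\<^sub>M borel)"
    proof (rule borel_measurable_SUP[OF countable_rat_Collect])
      fix y :: real
      show "(\<lambda>p. ennreal (norm (zero_extension f (Complex (fst p / snd p) (y / snd p))))) \<in> borel_measurable (borel \<Otimes>\<^sub>M borel)"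
        unfolding Complex_eq by measurable
    qed
    then show ?thesis by (simp add: S_def split_beta)
  qed
  have dil: "of_real (1 / t) * Complex x y = Complex (x / t) (y / t)" for t x y
    by (simp add: complex_eq_iff)
  have SI: "(\<integral>\<^sup>+x\<in>{3..5}. S x t \<partial>lborel) \<le> ennreal (216300 * K * t powr w)" if t: "0 < t" for t
  proof -
    have sb: "strip_bounded (\<lambda>z. f (of_real (1 / t) * z)) (K * (1 / t) powr - w)"
      using f t unfolding dilation_bounded_def by (metis zero_less_divide_1_iff)
    have "(1 / t) powr - w = t powr w"
      by (simp add: powr_minus powr_divide)
    with strip_maximal[OF sb] K t
    have "(\<integral>\<^sup>+x\<in>{3..5}. vertical_maximal (\<lambda>z. f (of_real (1 / t) * z)) x \<partial>lborel) \<le> ennreal (216300 * K * t powr w)"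
      by (simp add: mult.assoc)
    moreover have "vertical_maximal (\<lambda>z. f (of_real (1 / t) * z)) x = S x t" for x
      unfolding vertical_maximal_def S_def dil using t by (intro SUP_cong) (auto simp: zero_extension_def)
    ultimately show ?thesis by simp
  qed
  have "(\<integral>\<^sup>+x. (\<integral>\<^sup>+t. ?T x t \<partial>lborel) \<partial>lborel)
      = (\<integral>\<^sup>+t. (\<integral>\<^sup>+x. ?T x t \<partial>lborel) \<partial>lborel)"
    by (rule lborel_pair.Fubini'[symmetric]) measurable
  also have "\<dots> = (\<integral>\<^sup>+t. (\<integral>\<^sup>+x\<in>{3..5}. S x t \<partial>lborel) * (ennreal (\<psi> t) * indicator {0<..} t) \<partial>lborel)"
    by (intro nn_integral_cong nn_integral_multc) measurable
  also have "\<dots> \<le> (\<integral>\<^sup>+t. ennreal (216300 * K) * ennreal (t powr w * norm (\<Phi> t)) \<partial>lborel)"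
  proof (rule nn_integral_mono_AE)
    show "AE t in lborel. (\<integral>\<^sup>+x\<in>{3..5}. S x t \<partial>lborel) * (ennreal (\<psi> t) * indicator {0<..} t)
        \<le> ennreal (216300 * K) * ennreal (t powr w * norm (\<Phi> t))"
      using \<psi>eq
    proof eventually_elim
      case (elim t)
      show ?case
      proof (cases "0 < t")
        case True
        then have "(\<integral>\<^sup>+x\<in>{3..5}. S x t \<partial>lborel) * ennreal (\<psi> t) \<le> ennreal (216300 * K * t powr w) * ennreal (norm (\<Phi> t))"
          using SI[OF True] elim by (intro mult_mono) auto
        also have "\<dots> = ennreal (216300 * K) * ennreal (t powr w * norm (\<Phi> t))"
          using K by (simp add: ennreal_mult mult.assoc)
        finally show ?thesis using True by simp
      qed simp
    qed
  qed
  also have "\<dots> = ennreal (216300 * K) * (\<integral>\<^sup>+t. ennreal (t powr w * norm (\<Phi> t)) \<partial>lebesgue)"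
    by (subst nn_integral_completion[symmetric]) (rule nn_integral_cmult[OF meas])
  also have "\<dots> < \<infinity>" using fin by (simp add: ennreal_mult_less_top)
  finally have "(\<integral>\<^sup>+x. (\<integral>\<^sup>+t. ?T x t \<partial>lborel) \<partial>lborel) \<noteq> \<infinity>"
    by simp
  moreover have "(\<lambda>x. \<integral>\<^sup>+t. ?T x t \<partial>lborel) \<in> borel_measurable lborel"
    by measurable
  ultimately have "AE x in lborel. (\<integral>\<^sup>+t. ?T x t \<partial>lborel) \<noteq> \<infinity>"
    by (rule nn_integral_PInf_AE[rotated])
  then have "AE x in lebesgue. (\<integral>\<^sup>+t. ?T x t \<partial>lborel) \<noteq> \<infinity>"
    by (rule AE_completion)
  then have "AE x in lebesgue. x \<in> {3<..<5} \<longrightarrow> dominated_near_boundary \<Phi> f x"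
  proof eventually_elim
    case (elim x)
    show ?case
    proof
      assume x: "x \<in> {3<..<5}"
      define N where "N t = S x t * (ennreal (\<psi> t) * indicator {0<..} t)" for t
      have Nm[measurable]: "N \<in> borel_measurable lborel" unfolding N_def by measurable
      have Nfin: "(\<integral>\<^sup>+t. N t \<partial>lborel) < \<infinity>"
        using elim x by (auto simp: N_def less_top)
      then have NAE: "AE t in lborel. N t \<noteq> \<infinity>" by (intro nn_integral_PInf_AE) auto
      have "(\<integral>\<^sup>+t. ennreal (enn2real (N t)) \<partial>lborel) = (\<integral>\<^sup>+t. N t \<partial>lborel)"
        using NAE by (intro nn_integral_cong_AE) (auto simp: less_top)
      then have "integrable lborel (\<lambda>t. enn2real (N t))"
        using Nfin by (intro integrableI_bounded) auto
      then have int: "integrable lebesgue (\<lambda>t. enn2real (N t))"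
        by (simp add: integrable_completion)
      show "dominated_near_boundary \<Phi> f x"
        unfolding dominated_near_boundary_def
      proof (intro exI[of _ 1] exI[of _ "\<lambda>t. enn2real (N t)"] conjI int allI impI)
        fix y :: real assume y: "0 < y \<and> y < 1"
        have "AE t in lborel. norm (f (Complex x y / of_real t) * \<Phi> t) \<le> enn2real (N t)"
          using NAE \<psi>eq
        proof eventually_elim
          case (elim t)
          show ?case
          proof (cases "0 < t")
            case True
            have holt: "(\<lambda>z. f (of_real (1 / t) * z)) holomorphic_on upper_half_plane"
              using True by (intro holomorphic_on_dilation[OF holf]) simp
            have "ennreal (norm (f (of_real (1 / t) * Complex x y))) \<le> vertical_maximal (\<lambda>z. f (of_real (1 / t) * z)) x"
              using y by (intro norm_le_vertical_maximal[OF holt]) auto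
            also have "\<dots> = S x t"
              unfolding vertical_maximal_def S_def dil using True by (intro SUP_cong) (auto simp: zero_extension_def)
            finally have "ennreal (norm (f (Complex x y / of_real t))) * ennreal (\<psi> t) \<le> S x t * ennreal (\<psi> t)"
              by (intro mult_right_mono) auto
            moreover have "\<psi> t = norm (\<Phi> t)" using elim by simp
            ultimately have "ennreal (norm (f (Complex x y / of_real t) * \<Phi> t)) \<le> N t"
              using True by (simp add: N_def norm_mult ennreal_mult)
            also have "N t = ennreal (enn2real (N t))" using elim by (simp add: less_top)
            finally show ?thesis by simp
          qed (simp add: \<Phi>(2))
        qed
        then show "AE t in lebesgue. norm (f (Complex x y / of_real t) * \<Phi> t) \<le> enn2real (N t)"
          by (rule AE_completion)
      qed simp
    qed
  qed
  then have "AE x in lebesgue. \<not> (x \<in> {3<..<5} \<and> \<not> dominated_near_boundary \<Phi> f x)"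
    by eventually_elim auto
  then obtain N where "negligible N" "{x. \<not> \<not> (x \<in> {3<..<5} \<and> \<not> dominated_near_boundary \<Phi> f x)} \<subseteq> N"
    unfolding eventually_ae_filter_negligible by blast
  then show ?thesis by (auto elim: negligible_subset)
qed

text \<open>For every positive \<open>x\<close> there is a rational \<open>r\<close> between
  \<open>x / 5\<close> and \<open>x / 3\<close>, which puts \<open>x / r\<close> into (3, 5).
  Countably many dilates therefore suffice, and dilations preserve null sets.\<close>

lemma negligible_dilation_cover:
  assumes "\<And>r::real. 0 < r \<Longrightarrow> negligible {x \<in> {3<..<5}. \<not> Q (r * x)}"
  shows "negligible {x::real. 0 < x \<and> \<not> Q x}"
proof -
  have "negligible (\<Union>r\<in>{r\<in>\<rat>. 0 < r}. (\<lambda>x. r * x) ` {x \<in> {3<..<5}. \<not> Q (r * x)})" (is "negligible ?U")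
    using assms by (intro negligible_countable_Union)
      (auto intro!: countable_image countable_rat_Collect negligible_differentiable_image_negligible
        differentiable_on_mult differentiable_on_const differentiable_on_ident)
  then show ?thesis
  proof (rule negligible_subset, intro subsetI)
    fix x assume x: "x \<in> {x. 0 < x \<and> \<not> Q x}"
    then obtain r where r: "r \<in> \<rat>" "x / 5 < r" "r < x / 3"
      using Rats_dense_in_real[of "x / 5" "x / 3"] by auto
    moreover have "0 < r" using r x by (auto intro: less_trans[of 0 "x / 5"])
    ultimately show "x \<in> ?U"
      using x by (intro UN_I[of r] image_eqI[of _ _ "x / r"]) (auto simp: field_simps)
  qed
qed

section \<open>Transport by dilation and reflection to the whole line\<close>

lemma dilation_bounded_dilation:
  assumes "dilation_bounded f K w" "0 < r"
  shows "dilation_bounded (\<lambda>z. f (of_real r * z)) (K * r powr - w) w"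
  unfolding dilation_bounded_def
proof (intro allI impI)
  fix \<tau> :: real assume "0 < \<tau>"
  then have "strip_bounded (\<lambda>z. f (of_real (r * \<tau>) * z)) (K * (r * \<tau>) powr - w)"
    using assms unfolding dilation_bounded_def by (metis mult_pos_pos)
  then show "strip_bounded (\<lambda>z. f (of_real r * (of_real \<tau> * z))) (K * r powr - w * \<tau> powr - w)"
    using assms \<open>0 < \<tau>\<close> by (simp add: powr_mult mult.assoc)
qed

lemma has_boundary_value_dilation:
  assumes "0 < r" and b: "has_boundary_value (\<lambda>z. f (of_real r * z)) x"
  shows "has_boundary_value f (r * x)"
proof -
  obtain l where l: "((\<lambda>y. f (of_real r * Complex x y)) \<longlongrightarrow> l) (at_right 0)"
    using b by (auto simp: has_boundary_value_def)
  have "filterlim (\<lambda>y. y / r) (at_right 0) (at_right 0)"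
    using assms(1) by real_asymp
  from filterlim_compose[OF l this]
  have "((\<lambda>y. f (of_real r * Complex x (y / r))) \<longlongrightarrow> l) (at_right 0)" .
  moreover have "of_real r * Complex x (y / r) = Complex (r * x) y" for y
    using assms(1) by (simp add: complex_eq_iff)
  ultimately show ?thesis by (auto simp: has_boundary_value_def)
qed

lemma dominated_near_boundary_dilation:
  assumes r: "0 < r" and b: "dominated_near_boundary \<Phi> (\<lambda>z. f (of_real r * z)) x"
  shows "dominated_near_boundary \<Phi> f (r * x)"
proof -
  obtain \<delta> D where \<delta>: "0 < \<delta>" "integrable lebesgue D"
    "\<And>y. 0 < y \<Longrightarrow> y < \<delta> \<Longrightarrow> AE t in lebesgue. norm (f (of_real r * (Complex x y / of_real t)) * \<Phi> t) \<le> D t"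
    using b unfolding dominated_near_boundary_def by auto
  show ?thesis
    unfolding dominated_near_boundary_def
  proof (intro exI[of _ "r * \<delta>"] exI[of _ D] conjI allI impI)
    fix y assume y: "0 < y \<and> y < r * \<delta>"
    have "of_real r * (Complex x (y / r) / of_real t) = Complex (r * x) y / of_real t" for t
      using r by (simp add: complex_eq_iff)
    moreover have "0 < y / r" "y / r < \<delta>" using y r by (auto simp: pos_divide_less_eq mult.commute)
    ultimately show "AE t in lebesgue. norm (f (Complex (r * x) y / of_real t) * \<Phi> t) \<le> D t"
      using \<delta>(3)[of "y / r"] by (simp only:)
  qed (use r \<delta> in auto)
qed

lemma positive_boundary_points:
  assumes f: "dilation_bounded f K w" and K: "0 < K"
    and \<Phi>: "\<Phi> \<in> borel_measurable lebesgue" "\<And>t. t \<le> 0 \<Longrightarrow> \<Phi> t = 0"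
    and fin: "(\<integral>\<^sup>+t. ennreal (t powr w * norm (\<Phi> t)) \<partial>lebesgue) < \<infinity>"
  shows "negligible {x. 0 < x \<and> \<not> (dominated_near_boundary \<Phi> f x \<and> has_boundary_value f x)}"
proof (rule negligible_dilation_cover)
  fix r :: real assume r: "0 < r"
  let ?f = "\<lambda>z. f (of_real r * z)"
  have d: "dilation_bounded ?f (K * r powr - w) w" by (rule dilation_bounded_dilation[OF f r])
  have K': "0 < K * r powr - w" using K r by simp
  have "strip_bounded ?f (K * r powr - w)"
    using f r by (simp add: dilation_bounded_def)
  then obtain N where N: "negligible N" "\<And>x. \<lbrakk>x \<in> {3<..<5}; x \<notin> N\<rbrakk> \<Longrightarrow> has_boundary_value ?f x"
    using strip_fatou[OF _ K'] by blast
  have "negligible ({x \<in> {3<..<5}. \<not> dominated_near_boundary \<Phi> ?f x} \<union> N)"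
    by (intro negligible_Un N dominated_near_boundary_strip[OF d K' \<Phi> fin])
  then show "negligible {x \<in> {3<..<5}. \<not> (dominated_near_boundary \<Phi> f (r * x) \<and> has_boundary_value f (r * x))}"
    by (rule negligible_subset)
      (use N has_boundary_value_dilation[OF r] dominated_near_boundary_dilation[OF r] in blast)
qed

lemma has_boundary_value_reflected:
  assumes "has_boundary_value (reflected f) x"
  shows "has_boundary_value f (- x)"
proof -
  obtain l where "((\<lambda>y. reflected f (Complex x y)) \<longlongrightarrow> l) (at_right 0)"
    using assms by (auto simp: has_boundary_value_def)
  then have "((\<lambda>y. cnj (reflected f (Complex x y))) \<longlongrightarrow> cnj l) (at_right 0)" by (rule tendsto_cnj)
  then show ?thesis by (auto simp: has_boundary_value_def reflected_Complex)
qed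

lemma dominated_near_boundary_reflected:
  assumes "dominated_near_boundary \<Phi> (reflected f) x"
  shows "dominated_near_boundary \<Phi> f (- x)"
proof -
  have "- cnj (Complex x y / of_real t) = Complex (- x) y / of_real t" for y t
    by (simp add: complex_eq_iff)
  then show ?thesis using assms by (simp add: dominated_near_boundary_def norm_mult norm_reflected)
qed

lemma negligible_bad_boundary_points:
  assumes f: "dilation_bounded f K w" and rf: "dilation_bounded (reflected f) K w" and K: "0 < K"
    and \<Phi>: "\<Phi> \<in> borel_measurable lebesgue" "\<And>t. t \<le> 0 \<Longrightarrow> \<Phi> t = 0"
    and fin: "(\<integral>\<^sup>+t. ennreal (t powr w * norm (\<Phi> t)) \<partial>lebesgue) < \<infinity>"
  shows "negligible {x. \<not> (dominated_near_boundary \<Phi> f x \<and> has_boundary_value f x)}"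
proof -
  let ?A = "\<lambda>f. {x. 0 < x \<and> \<not> (dominated_near_boundary \<Phi> f x \<and> has_boundary_value f x)}"
  let ?B = "?A f \<union> uminus ` ?A (reflected f) \<union> {0}"
  have "negligible ?B"
    using positive_boundary_points[OF f K \<Phi> fin] positive_boundary_points[OF rf K \<Phi> fin]
    by (intro negligible_Un negligible_differentiable_image_negligible)
      (auto intro!: differentiable_on_minus differentiable_on_ident)
  then show ?thesis
  proof (rule negligible_subset, intro subsetI)
    fix x assume x: "x \<in> {x. \<not> (dominated_near_boundary \<Phi> f x \<and> has_boundary_value f x)}"
    consider "0 < x" | "x = 0" | "x < 0" by linarith
    then show "x \<in> ?B"
    proof cases
      case 3
      then have "- x \<in> ?A (reflected f)"
        using x has_boundary_value_reflected[of f "- x"] dominated_near_boundary_reflected[of \<Phi> f "- x"] by auto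
      then show ?thesis by (auto intro: image_eqI[of _ _ "- x"])
    qed (use x in auto)
  qed
qed

text \<open>For fixed nonzero \<open>x\<close> the map from \<open>s\<close> to \<open>x / s\<close>
  is differentiable off 0 and so preserves null sets. This makes
  \<open>boundary_value f (x / t)\<close> meaningful for almost every \<open>t\<close>, although
  boundary values exist only almost everywhere.\<close>

lemma AE_quotient:
  fixes x :: real
  assumes N: "negligible {s. \<not> P s}"
  shows "AE t in lebesgue. 0 < t \<and> x \<noteq> 0 \<longrightarrow> P (x / t)"
proof (cases "x = 0")
  case False
  let ?S = "{s. \<not> P s} - {0}"
  have "negligible ((\<lambda>s. x / s) ` ?S)"
  proof (rule negligible_differentiable_image_negligible)
    show "negligible ?S" using N by (rule negligible_subset) auto
    show "(\<lambda>s. x / s) differentiable_on ?S"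
      by (auto simp: differentiable_on_def intro!: differentiable_divide)
  qed simp
  moreover have "{t. \<not> (0 < t \<and> x \<noteq> 0 \<longrightarrow> P (x / t))} \<subseteq> (\<lambda>s. x / s) ` ?S" (is "?T \<subseteq> ?U")
  proof
    fix t assume "t \<in> ?T"
    then show "t \<in> ?U" by (intro image_eqI[of _ _ "x / t"]) auto
  qed
  ultimately show ?thesis unfolding eventually_ae_filter_negligible by blast
qed simp

lemma dilation_bounded_mono:
  assumes "dilation_bounded f K w" "K \<le> K'"
  shows "dilation_bounded f K' w"
  unfolding dilation_bounded_def strip_bounded_def
proof (intro allI impI conjI)
  fix \<tau> :: real assume \<tau>: "0 < \<tau>"
  then have sb: "strip_bounded (\<lambda>z. f (of_real \<tau> * z)) (K * \<tau> powr - w)"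
    using assms by (simp add: dilation_bounded_def)
  then show "(\<lambda>z. f (of_real \<tau> * z)) holomorphic_on upper_half_plane" by (simp add: strip_bounded_def)
  fix y :: real assume "0 < y"
  with sb have "(\<integral>\<^sup>+x\<in>{1..8}. ennreal (norm (f (of_real \<tau> * Complex x y))) \<partial>lborel) \<le> ennreal (K * \<tau> powr - w)"
    by (simp add: strip_bounded_def)
  also have "\<dots> \<le> ennreal (K' * \<tau> powr - w)"
    using assms by (intro ennreal_leI mult_right_mono) auto
  finally show "(\<integral>\<^sup>+x\<in>{1..8}. ennreal (norm (f (of_real \<tau> * Complex x y))) \<partial>lborel) \<le> ennreal (K' * \<tau> powr - w)" .
qed

section \<open>Integrability and passage to the limit in the Hausdorff operator\<close>

lemma borel_measurable_hausdorff_integrand: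
  assumes f: "f holomorphic_on upper_half_plane" and \<Phi>: "\<Phi> \<in> borel_measurable lebesgue" "\<And>t. t \<le> 0 \<Longrightarrow> \<Phi> t = 0"
    and z: "z \<in> upper_half_plane"
  shows "(\<lambda>t. f (z / of_real t) * \<Phi> t) \<in> borel_measurable lebesgue"
proof -
  note [measurable] = borel_measurable_zero_extension[OF f]
  have "(\<lambda>t. zero_extension f (z / of_real t)) \<in> borel_measurable lborel" by measurable
  then have "(\<lambda>t. zero_extension f (z / of_real t)) \<in> borel_measurable lebesgue"
    by (rule measurable_completion)
  then have "(\<lambda>t. zero_extension f (z / of_real t) * \<Phi> t) \<in> borel_measurable lebesgue"
    using \<Phi>(1) by measurable
  also have "(\<lambda>t. zero_extension f (z / of_real t) * \<Phi> t) = (\<lambda>t. f (z / of_real t) * \<Phi> t)"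
  proof
    fix t
    show "zero_extension f (z / of_real t) * \<Phi> t = f (z / of_real t) * \<Phi> t"
      using z \<Phi>(2)[of t] by (cases "0 < t") (auto simp: zero_extension_def upper_half_plane_def)
  qed
  finally show ?thesis .
qed

lemma hausdorff_integrable:
  assumes f: "dilation_bounded f K w" and rf: "dilation_bounded (reflected f) K w" and K: "0 \<le> K" and w: "0 \<le> w"
    and \<Phi>: "\<Phi> \<in> borel_measurable lebesgue" "\<And>t. t \<le> 0 \<Longrightarrow> \<Phi> t = 0"
    and fin: "(\<integral>\<^sup>+t. ennreal (t powr w * norm (\<Phi> t)) \<partial>lebesgue) < \<infinity>"
    and z: "z \<in> upper_half_plane"
  shows "integrable lebesgue (\<lambda>t. f (z / of_real t) * \<Phi> t)"
proof -
  obtain C where C: "\<And>t. 0 < t \<Longrightarrow> norm (f (z / of_real t)) \<le> C * t powr w"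
    using dilated_point_bound[OF f rf K w z] by blast
  have "integrable lebesgue (\<lambda>t. t powr w * norm (\<Phi> t))"
    using fin by (intro integrableI_bounded borel_measurable_powr_times_norm \<Phi>) simp
  then have "integrable lebesgue (\<lambda>t. C * (t powr w * norm (\<Phi> t)))" by simp
  then show ?thesis
  proof (rule Bochner_Integration.integrable_bound)
    show "(\<lambda>t. f (z / of_real t) * \<Phi> t) \<in> borel_measurable lebesgue"
      by (rule borel_measurable_hausdorff_integrand[OF dilation_bounded_holomorphic[OF f] \<Phi> z])
    show "AE t in lebesgue. norm (f (z / of_real t) * \<Phi> t) \<le> norm (C * (t powr w * norm (\<Phi> t)))"
    proof (rule AE_I2)
      fix t
      show "norm (f (z / of_real t) * \<Phi> t) \<le> norm (C * (t powr w * norm (\<Phi> t)))"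
      proof (cases "0 < t")
        case True
        have "norm (f (z / of_real t) * \<Phi> t) \<le> C * t powr w * norm (\<Phi> t)"
          unfolding norm_mult by (intro mult_right_mono C True) simp
        also have "\<dots> \<le> norm (C * (t powr w * norm (\<Phi> t)))" by (simp add: mult.assoc)
        finally show ?thesis .
      qed (simp add: \<Phi>(2))
    qed
  qed
qed

lemma hausdorff_boundary_limit:
  assumes f: "f holomorphic_on upper_half_plane"
    and \<Phi>: "\<Phi> \<in> borel_measurable lebesgue" "\<And>t. t \<le> 0 \<Longrightarrow> \<Phi> t = 0"
    and N: "negligible {x. \<not> has_boundary_value f x}"
    and x: "x \<noteq> 0" and dom: "dominated_near_boundary \<Phi> f x"
  shows "integrable lebesgue (\<lambda>t. boundary_value f (x / t) * \<Phi> t)"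
    and "((\<lambda>y. LINT t|lebesgue. f (Complex x y / of_real t) * \<Phi> t) \<longlongrightarrow>
           (LINT t|lebesgue. boundary_value f (x / t) * \<Phi> t)) (at_right 0)"
proof -
  obtain \<delta> D where \<delta>: "0 < \<delta>" and D: "integrable lebesgue D"
    "\<And>y. 0 < y \<Longrightarrow> y < \<delta> \<Longrightarrow> AE t in lebesgue. norm (f (Complex x y / of_real t) * \<Phi> t) \<le> D t"
    using dom unfolding dominated_near_boundary_def by blast
  let ?F = "\<lambda>t. boundary_value f (x / t) * \<Phi> t"
  \<comment> \<open>Sequences of heights are used because dominated convergence is sequential and
    the exceptional set of \<open>t\<close> in the domination may depend on the height; countably
    many such sets remain null.\<close>
  have main: "integrable lebesgue ?F \<and> (\<lambda>n. LINT t|lebesgue. f (Complex x (X n) / of_real t) * \<Phi> t) \<longlonglongrightarrow> (LINT t|lebesgue. ?F t)"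
    if X: "\<And>n. X n \<in> {0<..<\<delta>}" "X \<longlonglongrightarrow> 0" for X :: "nat \<Rightarrow> real"
  proof -
    let ?s = "\<lambda>n t. f (Complex x (X n) / of_real t) * \<Phi> t"
    have s: "?s n \<in> borel_measurable lebesgue" for n
      using X(1)[of n] by (intro borel_measurable_hausdorff_integrand[OF f \<Phi>]) auto
    have lim: "AE t in lebesgue. (\<lambda>n. ?s n t) \<longlonglongrightarrow> ?F t"
      using AE_quotient[OF N, of x]
    proof eventually_elim
      case (elim t)
      show ?case
      proof (cases "0 < t")
        case True
        with elim x obtain l where l: "((\<lambda>y. f (Complex (x / t) y)) \<longlongrightarrow> l) (at_right 0)"
          by (auto simp: has_boundary_value_def)
        then have bv: "boundary_value f (x / t) = l"
          unfolding boundary_value_def by (intro tendsto_Lim) auto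
        \<comment> \<open>Division by \<open>t\<close> keeps the approach vertical: the dilated
          points lie above \<open>x / t\<close> at heights \<open>X n / t\<close>.\<close>
        have "(\<lambda>n. X n / t) \<longlonglongrightarrow> 0 / t" using X(2) True by (intro tendsto_intros) auto
        then have "filterlim (\<lambda>n. X n / t) (at_right 0) sequentially"
          using X(1) True by (auto simp: filterlim_at less_imp_neq[symmetric] intro!: always_eventually)
        from filterlim_compose[OF l this]
        have "(\<lambda>n. f (Complex (x / t) (X n / t))) \<longlonglongrightarrow> boundary_value f (x / t)"
          by (simp add: bv)
        moreover have "Complex (x / t) (X n / t) = Complex x (X n) / of_real t" for n
          using True by (simp add: complex_eq_iff)
        ultimately show ?thesis by (intro tendsto_intros) simp
      qed (simp add: \<Phi>(2))
    qed
    \<comment> \<open>Boundary values carry no measurability of their own, being arbitrary where no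
      limit exists; completeness of Lebesgue measure transfers it from the sequential limit.\<close>
    have F: "?F \<in> borel_measurable lebesgue"
    proof (rule borel_measurable_AE)
      show "(\<lambda>t. lim (\<lambda>n. ?s n t)) \<in> borel_measurable lebesgue"
        by (intro borel_measurable_lim_metric s)
      show "AE t in lebesgue. lim (\<lambda>n. ?s n t) = ?F t"
        using lim by eventually_elim (rule limI)
    qed
    have bound: "AE t in lebesgue. norm (?s n t) \<le> D t" for n
      using X(1)[of n] by (intro D(2)) auto
    show ?thesis
      using integrable_dominated_convergence[OF F s D(1) lim bound]
        integral_dominated_convergence[OF F s D(1) lim bound] by blast
  qed
  have "(\<lambda>n. \<delta> / (real n + 2)) \<longlonglongrightarrow> 0" by real_asymp
  moreover have "\<delta> / (real n + 2) \<in> {0<..<\<delta>}" for n using \<delta> by (simp add: divide_less_eq)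
  ultimately show "integrable lebesgue ?F" using main[of "\<lambda>n. \<delta> / (real n + 2)"] by blast
  have "((\<lambda>y. LINT t|lebesgue. f (Complex x y / of_real t) * \<Phi> t) \<longlongrightarrow> (LINT t|lebesgue. ?F t)) (at 0 within {0<..<\<delta>})"
    unfolding tendsto_at_iff_sequentially o_def using main by auto
  then show "((\<lambda>y. LINT t|lebesgue. f (Complex x y / of_real t) * \<Phi> t) \<longlongrightarrow> (LINT t|lebesgue. ?F t)) (at_right 0)"
    by (simp add: at_within_Ioo_at_right[OF \<delta>])
qed

theorem theorem1p4:
  fixes p :: ennreal and \<alpha> :: real
    and \<phi> :: "real \<Rightarrow> complex" and f :: "complex \<Rightarrow> complex"
  assumes "1 \<le> p" and "\<alpha> > -1"
    and "\<phi> \<in> borel_measurable (lebesgue_on {0<..})"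
    and "(\<integral>\<^sup>+t\<in>{0<..}. ennreal (t powr (weight_exponent p \<alpha> - 1) * norm (\<phi> t)) \<partial>lebesgue) < \<infinity>"
    and "f \<in> hardy_space p \<alpha>"
  shows "(\<forall>z\<in>upper_half_plane. hausdorff_defined_at \<phi> f z) \<and>
    (AE x in lebesgue.
       real_hausdorff_defined_at \<phi> (boundary_value f) x \<and>
       has_boundary_value (hausdorff \<phi> f) x \<and>
       boundary_value (hausdorff \<phi> f) x = real_hausdorff \<phi> (boundary_value f) x)"
proof -
  define w where "w = weight_exponent p \<alpha>"
  have w: "0 \<le> w"
    using assms(1,2) by (auto simp: w_def weight_exponent_def)
  \<comment> \<open>Cutting off at 0 turns all set integrals over the positive axis into integrals
    over the line.\<close>
  define \<Phi> where "\<Phi> t = indicator {0<..} t *\<^sub>R (\<phi> t / of_real t)" for t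
  have \<Phi>0: "\<And>t. t \<le> 0 \<Longrightarrow> \<Phi> t = 0" by (simp add: \<Phi>_def)
  have \<Phi>m: "\<Phi> \<in> borel_measurable lebesgue"
  proof -
    have "(\<lambda>t::real. complex_of_real t) \<in> borel_measurable lebesgue"
      by (intro measurable_completion) simp
    moreover have "(\<lambda>t. indicator {0<..} t *\<^sub>R \<phi> t) \<in> borel_measurable lebesgue"
      using assms(3) by (simp add: borel_measurable_restrict_space_iff)
    ultimately have "(\<lambda>t. (indicator {0<..} t *\<^sub>R \<phi> t) / of_real t) \<in> borel_measurable lebesgue"
      by (rule borel_measurable_divide[rotated])
    also have "(\<lambda>t. (indicator {0<..} t *\<^sub>R \<phi> t) / of_real t) = \<Phi>"
      by (auto simp: \<Phi>_def indicator_def)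
    finally show ?thesis .
  qed
  have fin: "(\<integral>\<^sup>+t. ennreal (t powr w * norm (\<Phi> t)) \<partial>lebesgue) < \<infinity>"
  proof -
    have "ennreal (t powr w * norm (\<Phi> t)) = ennreal (t powr (w - 1) * norm (\<phi> t)) * indicator {0<..} t" for t
      by (cases "0 < t") (auto simp: \<Phi>_def norm_divide powr_diff)
    then show ?thesis using assms(4) by (simp add: w_def)
  qed
  have integrand: "indicator {0<..} t *\<^sub>R (c * \<phi> t / of_real t) = c * \<Phi> t" for c t
    by (simp add: \<Phi>_def)
  obtain K1 where K1: "0 < K1" "dilation_bounded f K1 w"
    using hardy_space_dilation_bounded[OF assms(1,5)] unfolding w_def by blast
  obtain K2 where K2: "0 < K2" "dilation_bounded (reflected f) K2 w"
    using hardy_space_dilation_bounded[OF assms(1) hardy_space_reflected[OF assms(5)]] unfolding w_def by blast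
  \<comment> \<open>One constant serves \<open>f\<close> and its reflection, since the bounds on the
    imaginary axis and on the full line use both.\<close>
  define K where "K = max K1 K2"
  have K: "0 < K" "dilation_bounded f K w" "dilation_bounded (reflected f) K w"
    using K1 K2 by (auto simp: K_def intro: dilation_bounded_mono)
  have holf: "f holomorphic_on upper_half_plane" by (rule dilation_bounded_holomorphic[OF K(2)])
  have "hausdorff_defined_at \<phi> f z" if "z \<in> upper_half_plane" for z
    using hausdorff_integrable[OF K(2,3) _ w \<Phi>m \<Phi>0 fin that] K(1)
    by (simp add: hausdorff_defined_at_def set_integrable_def integrand)
  moreover have "AE x in lebesgue. real_hausdorff_defined_at \<phi> (boundary_value f) x \<and>
       has_boundary_value (hausdorff \<phi> f) x \<and>
       boundary_value (hausdorff \<phi> f) x = real_hausdorff \<phi> (boundary_value f) x"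
  proof -
    have bad: "negligible {x. \<not> (dominated_near_boundary \<Phi> f x \<and> has_boundary_value f x)}" (is "negligible ?bad")
      by (rule negligible_bad_boundary_points[OF K(2,3,1) \<Phi>m \<Phi>0 fin])
    then have N: "negligible {x. \<not> has_boundary_value f x}" by (rule negligible_subset) auto
    have "negligible (?bad \<union> {0})"
      using bad by simp
    then have "AE x in lebesgue. x \<noteq> 0 \<and> dominated_near_boundary \<Phi> f x"
      unfolding eventually_ae_filter_negligible
      by (intro exI[of _ "?bad \<union> {0}"]) auto
    then show ?thesis
    proof eventually_elim
      case (elim x)
      note lim = hausdorff_boundary_limit[OF holf \<Phi>m \<Phi>0 N, of x]
      \<comment> \<open>This single limit gives existence of the boundary value of the transform
        and, by uniqueness of limits, its identity with the real operator.\<close>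
      have "((\<lambda>y. hausdorff \<phi> f (Complex x y)) \<longlongrightarrow> real_hausdorff \<phi> (boundary_value f) x) (at_right 0)"
        using lim(2) elim by (simp add: hausdorff_def real_hausdorff_def set_lebesgue_integral_def integrand)
      moreover from this have "boundary_value (hausdorff \<phi> f) x = real_hausdorff \<phi> (boundary_value f) x"
        unfolding boundary_value_def[of "hausdorff \<phi> f"] by (intro tendsto_Lim) auto
      moreover have "real_hausdorff_defined_at \<phi> (boundary_value f) x"
        using lim(1) elim by (simp add: real_hausdorff_defined_at_def set_integrable_def integrand)
      ultimately show ?case by (auto simp: has_boundary_value_def)
    qed
  qed
  ultimately show ?thesis by blast
qed

end
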